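(* Assume $q<r<qe$ and $\overline{\{x^*(t): 0<t<T\}}\subset\Omega$. Then for any $\delta>0$, $$\lim_{h\to0}\ \sup_{t\in[0,T-\delta]}|x^h(t)-x^*(t)|=0 .$$
   Context: Let $T>0$, $q>0$, $r>0$, $\Omega=(-1,1)$, $\alpha=(r-q-1)/2$, $\beta=\alpha^2+r$, $\varphi(x)=e^{\alpha x}\max(e^x-1,0)$, and $x_0=\log(r/q)$ (which lies in $(0,1)$ when $q<r<qe$). The function $u$ is the unique solution, in the a.e. sense and in the viscosity sense, belonging to $C([0,T)\times\overline\Omega)$ and with $u,u_t,u_x,u_{xx}\in L^2((0,T)\times\Omega)$, of $$\min\{u_t-u_{xx}+\beta u,\;u-\varphi\}=0\ \text{in }(0,T)\times\Omega,\quad u(0,x)=\varphi(x)\ (x\in\overline\Omega),\quad u(t,\pm1)=\varphi(\pm1)\ (t\in(0,T)).$$ $\{x^*(t)\}_{0<t<T}$ is the free boundary of this problem: for each $t\in(0,T)$, $u(t,\cdot)>\varphi$ on $(-1,x^*(t))$ and $u(t,\cdot)=\varphi$ on $[x^*(t),1]$. It is known (van Moerbeke) that $x^*\in C^1(0,T)$, $(x^* )'\ge0$ and $\lim_{t\searrow0}x^*(t)=x_0$; put $x^*(0)=x_0$. Let $[s]$ denote the integer part of $s\in\mathbb R$. For $h>0$ put $u_0=\varphi$ and, for $m=1,\dots,[T/h]$, let $u_m$ be the unique minimizer of $$J_m(v)=\frac12\int_\Omega\Big\{\frac{|v-u_{m-1}|^2}{h}+(v_x)^2+\beta v^2\Big\}dx$$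 over $\mathcal K=\{v\in H^1(\Omega): v-\varphi\in H^1_0(\Omega),\ v\ge\varphi\text{ a.e. in }\Omega\}$. For all sufficiently small $h>0$ and every $m=1,\dots,[T/h]$ there is a unique $x_m\in(x_0,1]$ such that $u_m>\varphi$ on $(-1,x_m)$ and $u_m=\varphi$ on $[x_m,1]$. Define $x^h(t)=x_m$ for $t\in[mh,(m+1)h)$, $m=0,1,\dots,[T/h]$. *)

theory Defs
  imports "HOL-Analysis.Analysis"
begin

subsection \<open>Sobolev spaces\<close>

text \<open>\<open>f\<close> is \<open>k\<close> times continuously differentiable on the whole space.\<close>

primrec Ck :: "nat \<Rightarrow> ('a::euclidean_space \<Rightarrow> real) \<Rightarrow> bool" where
  "Ck 0 f \<longleftrightarrow> continuous_on UNIV f"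
| "Ck (Suc k) f \<longleftrightarrow> (\<forall>x. f differentiable (at x)) \<and>
     (\<forall>b\<in>Basis. Ck k (\<lambda>x. frechet_derivative f (at x) b))"

definition test_function :: "'a::euclidean_space set \<Rightarrow> ('a \<Rightarrow> real) \<Rightarrow> bool" where
  "test_function S \<psi> \<longleftrightarrow> (\<forall>k. Ck k \<psi>) \<and>
     compact (closure {x. \<psi> x \<noteq> 0}) \<and> closure {x. \<psi> x \<noteq> 0} \<subseteq> S"

definition L2 :: "'a::euclidean_space set \<Rightarrow> ('a \<Rightarrow> real) set" where
  "L2 S = {f. f \<in> borel_measurable (lebesgue_on S) \<and>
              integrable (lebesgue_on S) (\<lambda>x. (f x)\<^sup>2)}"

text \<open>\<open>g\<close> is the distributional derivative of \<open>f\<close> on \<open>S\<close> in the direction \<open>b\<close>. Local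
  integrability is required explicitly because the Bochner integral of a non-integrable
  function is \<open>0\<close> by convention.\<close>

definition has_weak_deriv ::
  "'a::euclidean_space set \<Rightarrow> 'a \<Rightarrow> ('a \<Rightarrow> real) \<Rightarrow> ('a \<Rightarrow> real) \<Rightarrow> bool" where
  "has_weak_deriv S b f g \<longleftrightarrow>
     (\<forall>C. compact C \<and> C \<subseteq> S \<longrightarrow>
        integrable (lebesgue_on C) f \<and> integrable (lebesgue_on C) g) \<and>
     (\<forall>\<psi>. test_function S \<psi> \<longrightarrow>
        (LINT x|lebesgue_on S. f x * frechet_derivative \<psi> (at x) b) =
        - (LINT x|lebesgue_on S. g x * \<psi> x))"

text \<open>Weak derivatives are determined only almost everywhere; \<open>weak_deriv\<close> picks a
  representative and is only used under integrals.\<close>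

definition weak_deriv :: "'a::euclidean_space set \<Rightarrow> 'a \<Rightarrow> ('a \<Rightarrow> real) \<Rightarrow> 'a \<Rightarrow> real" where
  "weak_deriv S b f = (SOME g. has_weak_deriv S b f g)"

definition H1 :: "'a::euclidean_space set \<Rightarrow> ('a \<Rightarrow> real) set" where
  "H1 S = {f \<in> L2 S. \<forall>b\<in>Basis. \<exists>g\<in>L2 S. has_weak_deriv S b f g}"

definition H1_norm :: "'a::euclidean_space set \<Rightarrow> ('a \<Rightarrow> real) \<Rightarrow> real" where
  "H1_norm S f = sqrt ((LINT x|lebesgue_on S. (f x)\<^sup>2) +
     (\<Sum>b\<in>Basis. LINT x|lebesgue_on S. (weak_deriv S b f x)\<^sup>2))"

text \<open>The closure of the test functions in \<open>H1 S\<close>.\<close>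

definition H1_0 :: "'a::euclidean_space set \<Rightarrow> ('a \<Rightarrow> real) set" where
  "H1_0 S = {f \<in> H1 S. \<forall>\<epsilon>>0. \<exists>\<psi>. test_function S \<psi> \<and> H1_norm S (\<lambda>x. f x - \<psi> x) < \<epsilon>}"

subsection \<open>The obstacle problem\<close>

abbreviation \<Omega> :: "real set" where
  "\<Omega> \<equiv> {-1<..<1}"

definition alpha :: "real \<Rightarrow> real \<Rightarrow> real" where
  "alpha q r = (r - q - 1) / 2"

definition beta :: "real \<Rightarrow> real \<Rightarrow> real" where
  "beta q r = (alpha q r)\<^sup>2 + r"

definition phi :: "real \<Rightarrow> real \<Rightarrow> real \<Rightarrow> real" where
  "phi q r x = exp (alpha q r * x) * max (exp x - 1) 0"

definition x_zero :: "real \<Rightarrow> real \<Rightarrow> real" where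
  "x_zero q r = ln (r / q)"

text \<open>Functions on space-time take pairs \<open>(t, x)\<close>. The next predicate says that \<open>\<psi>\<close> is of
  class $C^{1,2}$ on \<open>Q\<close>, with derivatives \<open>\<psi>t = \<psi>\<^sub>t\<close>, \<open>\<psi>x = \<psi>\<^sub>x\<close>, \<open>\<psi>xx = \<psi>\<^sub>x\<^sub>x\<close>.\<close>

definition C12_on ::
  "(real \<times> real) set \<Rightarrow> (real \<times> real \<Rightarrow> real) \<Rightarrow> (real \<times> real \<Rightarrow> real) \<Rightarrow>
   (real \<times> real \<Rightarrow> real) \<Rightarrow> (real \<times> real \<Rightarrow> real) \<Rightarrow> bool" where
  "C12_on Q \<psi> \<psi>t \<psi>x \<psi>xx \<longleftrightarrow>
     continuous_on Q \<psi> \<and> continuous_on Q \<psi>t \<and> continuous_on Q \<psi>x \<and> continuous_on Q \<psi>xx \<and>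
     (\<forall>t x. (t, x) \<in> Q \<longrightarrow>
        ((\<lambda>s. \<psi> (s, x)) has_real_derivative \<psi>t (t, x)) (at t) \<and>
        ((\<lambda>y. \<psi> (t, y)) has_real_derivative \<psi>x (t, x)) (at x) \<and>
        ((\<lambda>y. \<psi>x (t, y)) has_real_derivative \<psi>xx (t, x)) (at x))"

text \<open>Viscosity sub- and supersolutions of
  \<open>min {u\<^sub>t - u\<^sub>x\<^sub>x + \<beta> u, u - \<phi>} = 0\<close> on the open set \<open>Q\<close>.\<close>

definition viscosity_solution ::
  "real \<Rightarrow> real \<Rightarrow> (real \<times> real) set \<Rightarrow> (real \<times> real \<Rightarrow> real) \<Rightarrow> bool" where
  "viscosity_solution q r Q u \<longleftrightarrow>
     (\<forall>\<psi> \<psi>t \<psi>x \<psi>xx. C12_on Q \<psi> \<psi>t \<psi>x \<psi>xx \<longrightarrow>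
       (\<forall>p\<in>Q.
          ((\<forall>\<^sub>F z in nhds p. u z - \<psi> z \<le> u p - \<psi> p) \<longrightarrow>
             min (\<psi>t p - \<psi>xx p + beta q r * u p) (u p - phi q r (snd p)) \<le> 0) \<and>
          ((\<forall>\<^sub>F z in nhds p. u z - \<psi> z \<ge> u p - \<psi> p) \<longrightarrow>
             min (\<psi>t p - \<psi>xx p + beta q r * u p) (u p - phi q r (snd p)) \<ge> 0)))"

definition ae_solution ::
  "real \<Rightarrow> real \<Rightarrow> (real \<times> real) set \<Rightarrow> (real \<times> real \<Rightarrow> real) \<Rightarrow> bool" where
  "ae_solution q r Q u \<longleftrightarrow>
     u \<in> L2 Q \<and>
     (\<exists>ut\<in>L2 Q. \<exists>ux\<in>L2 Q. \<exists>uxx\<in>L2 Q.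
        has_weak_deriv Q (1, 0) u ut \<and> has_weak_deriv Q (0, 1) u ux \<and>
        has_weak_deriv Q (0, 1) ux uxx \<and>
        (AE p in lebesgue_on Q.
           min (ut p - uxx p + beta q r * u p) (u p - phi q r (snd p)) = 0))"

definition obstacle_solution ::
  "real \<Rightarrow> real \<Rightarrow> real \<Rightarrow> (real \<times> real \<Rightarrow> real) \<Rightarrow> bool" where
  "obstacle_solution T q r u \<longleftrightarrow>
     continuous_on ({0..<T} \<times> {-1..1}) u \<and>
     ae_solution q r ({0<..<T} \<times> \<Omega>) u \<and>
     viscosity_solution q r ({0<..<T} \<times> \<Omega>) u \<and>
     (\<forall>x\<in>{-1..1}. u (0, x) = phi q r x) \<and>
     (\<forall>t\<in>{0<..<T}. u (t, -1) = phi q r (-1) \<and> u (t, 1) = phi q r 1)"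

text \<open>\<open>s\<close> separates the non-contact set from the contact set of a function \<open>v\<close> on \<open>[-1, 1]\<close>.\<close>

definition contact_point :: "real \<Rightarrow> real \<Rightarrow> (real \<Rightarrow> real) \<Rightarrow> real \<Rightarrow> bool" where
  "contact_point q r v s \<longleftrightarrow> s \<in> {-1..1} \<and>
     (\<forall>x\<in>{-1<..<s}. v x > phi q r x) \<and> (\<forall>x\<in>{s..1}. v x = phi q r x)"

definition free_boundary ::
  "real \<Rightarrow> real \<Rightarrow> real \<Rightarrow> (real \<times> real \<Rightarrow> real) \<Rightarrow> (real \<Rightarrow> real) \<Rightarrow> bool" where
  "free_boundary T q r u xs \<longleftrightarrow>
     xs 0 = x_zero q r \<and>
     (\<forall>t\<in>{0<..<T}. contact_point q r (\<lambda>x. u (t, x)) (xs t))"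

subsection \<open>The time-discrete scheme\<close>

definition J :: "real \<Rightarrow> real \<Rightarrow> real \<Rightarrow> (real \<Rightarrow> real) \<Rightarrow> (real \<Rightarrow> real) \<Rightarrow> real" where
  "J q r h w v = 1 / 2 * (LINT x|lebesgue_on \<Omega>.
     (v x - w x)\<^sup>2 / h + (weak_deriv \<Omega> 1 v x)\<^sup>2 + beta q r * (v x)\<^sup>2)"

definition K :: "real \<Rightarrow> real \<Rightarrow> (real \<Rightarrow> real) set" where
  "K q r = {v \<in> H1 \<Omega>. (\<lambda>x. v x - phi q r x) \<in> H1_0 \<Omega> \<and>
              (AE x in lebesgue_on \<Omega>. v x \<ge> phi q r x)}"

text \<open>Elements of \<open>H1 \<Omega>\<close> have a unique representative continuous on \<open>[-1, 1]\<close>; \<open>U m\<close> denotes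
  this representative, so that its values at points are meaningful. Values outside
  \<open>[-1, 1]\<close> play no role.\<close>

definition scheme :: "real \<Rightarrow> real \<Rightarrow> real \<Rightarrow> real \<Rightarrow> (nat \<Rightarrow> real \<Rightarrow> real) \<Rightarrow> bool" where
  "scheme T q r h U \<longleftrightarrow>
     (\<forall>x\<in>{-1..1}. U 0 x = phi q r x) \<and>
     (\<forall>m\<in>{1..nat \<lfloor>T / h\<rfloor>}.
        U m \<in> K q r \<and> continuous_on {-1..1} (U m) \<and>
        (\<forall>v\<in>K q r. J q r h (U (m - 1)) (U m) \<le> J q r h (U (m - 1)) v))"

definition discrete_boundary ::
  "real \<Rightarrow> real \<Rightarrow> real \<Rightarrow> real \<Rightarrow> (nat \<Rightarrow> real \<Rightarrow> real) \<Rightarrow> (nat \<Rightarrow> real) \<Rightarrow> bool" where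
  "discrete_boundary T q r h U X \<longleftrightarrow>
     X 0 = x_zero q r \<and>
     (\<forall>m\<in>{1..nat \<lfloor>T / h\<rfloor>}. X m \<in> {x_zero q r<..1} \<and> contact_point q r (U m) (X m))"

text \<open>The piecewise constant interpolation: the value is \<open>X m\<close> for \<open>t \<in> [m h, (m + 1) h)\<close>.\<close>

definition interpolation :: "real \<Rightarrow> (nat \<Rightarrow> real) \<Rightarrow> real \<Rightarrow> real" where
  "interpolation h X t = X (nat \<lfloor>t / h\<rfloor>)"

end

theory Submission
  imports Defs
begin

text \<open>
  Testing minimality with smooth functions shows that \<open>u\<^sub>m'' \<le> \<beta> u\<^sub>m + (u\<^sub>m - u\<^sub>m\<^sub>-\<^sub>1) / h\<close>
  in the sense of distributions, with equality left of \<open>x\<^sub>m\<close>. Hence \<open>u\<^sub>m\<close> is a \<open>C\<^sup>2\<close> function plus a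
  concave one, and the comparison principle gives \<open>u\<^sub>m\<^sub>-\<^sub>1 \<le> u\<^sub>m\<close> and a modulus of continuity at
  time \<open>0\<close> that does not depend on \<open>h\<close>.

  Since the discrete solutions are themselves admissible test functions in space, they can be compared
  with the viscosity solution \<open>u\<close> by doubling the time variable alone; this yields uniform convergence.

  Monotonicity in \<open>m\<close> also gives nondegeneracy: right of \<open>x\<^sub>0\<close> the function \<open>u\<^sub>m - \<phi>\<close> has second
  derivative at least \<open>c > 0\<close> up to \<open>x\<^sub>m\<close>, so it dominates \<open>c (x\<^sub>m - x)\<^sup>2 / 2\<close>. If \<open>t\<^sub>h \<rightarrow> t\<close>, then
  \<open>x\<^sup>h(t\<^sub>h)\<close> cannot stay above \<open>x\<^sup>*(t) + e\<close> by nondegeneracy, nor below \<open>x\<^sup>*(t) - e\<close> because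
  \<open>u(t, \<cdot>) > \<phi>\<close> there. This convergence along varying times is locally uniform convergence to a
  continuous limit.
\<close>

subsection \<open>Smooth functions with compact support\<close>

text \<open>A minimiser is known only to lie in \<open>H1\<close>, so its second derivative is a
  mere distribution, and neither the maximum principle nor the viscosity inequalities apply to it as
  they stand. The splitting into \<open>G\<close> plus a concave part replaces regularity theory: a
  support line of the concave part turns \<open>G\<close> into a C^2 function that touches the
  minimiser at a prescribed point from one side. The side depends on the role. Touching from above
  works everywhere in \<Omega>, because concavity holds there. Touching from below needs convexity,
  known only left of the contact point; but it is called for only where the minimiser exceeds a
  function above the obstacle, and such points lie there automatically.

  The threshold \<open>x_zero q r\<close> comes from the identity \<beta> \<phi> - \<phi>'' =
  e^(\<alpha> x) (q e^x - r) for x > 0, whose sign changes at log(r/q). Its positivity to the right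
  is the constant behind the quadratic growth; its negativity to the left forbids contact of
  \<open>u\<close> with the obstacle between 0 and x_0, which bounds the free boundary from below by
  x_0.\<close>

lemma frechet_derivative_real:
  "(f has_real_derivative f') (at x) \<Longrightarrow> frechet_derivative f (at x) 1 = f'"
  unfolding has_field_derivative_def by (drule frechet_derivative_at[symmetric]) simp

text \<open>On the line \<open>Basis\<close> is {1}, so the recursive clause concerns a single
  derivative; with an arbitrary \<open>f'\<close> explicit formulas can replace
  \<open>frechet_derivative\<close>.\<close>

lemma Ck_real_Suc:
  fixes f f' :: "real \<Rightarrow> real"
  assumes "\<And>x. (f has_real_derivative f' x) (at x)"
  shows "Ck (Suc k) f \<longleftrightarrow> Ck k f'"
proof -
  have "f differentiable (at x)" for x
    using assms real_differentiable_def by blast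
  moreover have "frechet_derivative f (at x) 1 = f' x" for x
    using assms frechet_derivative_real by blast
  ultimately show ?thesis by simp
qed

lemma Ck_real_SucD:
  fixes f :: "real \<Rightarrow> real"
  assumes "Ck (Suc k) f"
  shows "\<exists>f'. (\<forall>x. (f has_real_derivative f' x) (at x)) \<and> Ck k f'"
proof -
  have d: "(f has_real_derivative deriv f x) (at x)" for x
    using assms by (simp add: DERIV_deriv_iff_real_differentiable)
  have "Ck k (deriv f)" using Ck_real_Suc[of f "deriv f", OF d] assms by blast
  with d show ?thesis by blast
qed

lemma DERIV_continuous_on_UNIV:
  "(\<And>x. (f has_real_derivative f' x) (at x)) \<Longrightarrow> continuous_on UNIV f"
  by (rule continuous_at_imp_continuous_on) (metis DERIV_isCont)

lemma Ck_mono: "Ck (Suc k) f \<Longrightarrow> Ck k f" for f :: "real \<Rightarrow> real"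
proof (induction k arbitrary: f)
  case 0
  then obtain f' where "\<And>x. (f has_real_derivative f' x) (at x)"
    using Ck_real_SucD by blast
  from DERIV_continuous_on_UNIV[OF this] show ?case by simp
next
  case (Suc k)
  then obtain f' where d: "\<And>x. (f has_real_derivative f' x) (at x)" "Ck (Suc k) f'"
    using Ck_real_SucD by blast
  from Ck_real_Suc[OF d(1)] Suc.IH[OF d(2)] show ?case by simp
qed

lemma Ck_add: "Ck k f \<Longrightarrow> Ck k g \<Longrightarrow> Ck k (\<lambda>x. f x + g x)" for f g :: "real \<Rightarrow> real"
proof (induction k arbitrary: f g)
  case 0
  then show ?case by (simp add: continuous_on_add)
next
  case (Suc k)
  obtain f' g' where d: "\<And>x. (f has_real_derivative f' x) (at x)" "Ck k f'"
    "\<And>x. (g has_real_derivative g' x) (at x)" "Ck k g'"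
    using Suc.prems[THEN Ck_real_SucD] by blast
  have "((\<lambda>x. f x + g x) has_real_derivative f' x + g' x) (at x)" for x
    using d by (auto intro: derivative_intros)
  from Ck_real_Suc[OF this] Suc.IH[OF d(2,4)] show ?case by simp
qed

lemma Ck_mult: "Ck k f \<Longrightarrow> Ck k g \<Longrightarrow> Ck k (\<lambda>x. f x * g x)" for f g :: "real \<Rightarrow> real"
proof (induction k arbitrary: f g)
  case 0
  then show ?case by (simp add: continuous_on_mult)
next
  case (Suc k)
  obtain f' g' where d: "\<And>x. (f has_real_derivative f' x) (at x)" "Ck k f'"
    "\<And>x. (g has_real_derivative g' x) (at x)" "Ck k g'"
    using Suc.prems[THEN Ck_real_SucD] by blast
  have "((\<lambda>x. f x * g x) has_real_derivative f x * g' x + f' x * g x) (at x)" for x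
    using d by (auto intro!: derivative_eq_intros)
  moreover have "Ck k f" "Ck k g" using Suc.prems Ck_mono by blast+
  moreover from calculation have "Ck k (\<lambda>x. f x * g' x + f' x * g x)"
    using Suc.IH d by (intro Ck_add) auto
  ultimately show ?case by (subst Ck_real_Suc[where f' = "\<lambda>x. f x * g' x + f' x * g x"])
qed

lemma Ck_const: "Ck k (\<lambda>x::real. c::real)"
proof (induction k arbitrary: c)
  case (Suc k)
  show ?case by (subst Ck_real_Suc[where f' = "\<lambda>_. 0"]) (use Suc in auto)
qed simp

lemma Ck_cmult: "Ck k f \<Longrightarrow> Ck k (\<lambda>x. c * f x)" for f :: "real \<Rightarrow> real"
  by (rule Ck_mult[OF Ck_const])

lemma Ck_affine: "Ck k f \<Longrightarrow> Ck k (\<lambda>x. f (c * x + d))" for f :: "real \<Rightarrow> real"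
proof (induction k arbitrary: f)
  case 0
  then show ?case by (simp add: continuous_on_compose2[of UNIV f] continuous_intros)
next
  case (Suc k)
  obtain f' where d: "\<And>x. (f has_real_derivative f' x) (at x)" "Ck k f'"
    using Suc.prems[THEN Ck_real_SucD] by blast
  have "((\<lambda>x. f (c * x + d)) has_real_derivative c * f' (c * x + d)) (at x)" for x
    by (rule DERIV_cong[OF DERIV_chain2[OF d(1)]]) (auto intro!: derivative_eq_intros)
  from Ck_real_Suc[OF this] Ck_cmult[OF Suc.IH[OF d(2)]] show ?case by simp
qed

text \<open>The powers of 1/x close the family under differentiation: the derivative of
  \<open>flat n\<close> is a combination of \<open>flat (n + 2)\<close> and
  \<open>flat (n + 1)\<close>. Smoothness of e^(-1/x), which is \<open>flat 0\<close>, then becomes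
  an induction over the order for all \<open>n\<close> at once.\<close>

definition flat :: "nat \<Rightarrow> real \<Rightarrow> real" where
  "flat n x = (if x > 0 then exp (- (1 / x)) / x ^ n else 0)"

lemma flat_at_right_0: "(flat n \<longlongrightarrow> 0) (at_right 0)"
proof -
  have "((\<lambda>x. inverse x ^ n / exp (inverse x)) \<longlongrightarrow> (0::real)) (at_right 0)"
    by (rule filterlim_compose[OF tendsto_power_div_exp_0 filterlim_inverse_at_top_right])
  moreover have "\<forall>\<^sub>F x in at_right 0. inverse x ^ n / exp (inverse x) = flat n x"
    unfolding eventually_at_right_field
    by (intro exI[of _ 1]) (auto simp: flat_def exp_minus field_simps)
  ultimately show ?thesis by (rule Lim_transform_eventually)
qed

lemma flat_has_derivative:
  "(flat n has_real_derivative flat (n + 2) x - real n * flat (n + 1) x) (at x)"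
proof -
  consider "x > 0" | "x < 0" | "x = 0" by linarith
  then show ?thesis
  proof cases
    case 1
    have "((\<lambda>x. exp (- (1 / x)) / x ^ n) has_real_derivative
        flat (n + 2) x - real n * flat (n + 1) x) (at x)"
    proof (cases n)
      case 0
      then show ?thesis using 1
        by (auto intro!: derivative_eq_intros simp: flat_def power2_eq_square)
    next
      case (Suc d)
      have "((\<lambda>x. exp (- (1 / x)) / x ^ n) has_real_derivative
          (exp (- (1 / x)) * (1 / (x * x)) * x ^ n - exp (- (1 / x)) * (n * x ^ (n - Suc 0))) / (x ^ n * x ^ n)) (at x)"
        using 1 by (auto intro!: derivative_eq_intros)
      also have "(exp (- (1 / x)) * (1 / (x * x)) * x ^ n - exp (- (1 / x)) * (n * x ^ (n - Suc 0))) / (x ^ n * x ^ n)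
          = flat (n + 2) x - real n * flat (n + 1) x"
        using 1 Suc by (simp add: flat_def divide_simps distrib_right ring_distribs)
      finally show ?thesis .
    qed
    then show ?thesis
      by (rule has_field_derivative_transform_within_open[of _ _ _ "{0<..}"]) (use 1 in \<open>auto simp: flat_def\<close>)
  next
    case 2
    have "((\<lambda>x. 0) has_real_derivative flat (n + 2) x - real n * flat (n + 1) x) (at x)"
      using 2 by (simp add: flat_def)
    then show ?thesis
      by (rule has_field_derivative_transform_within_open[of _ _ _ "{..<0}"]) (use 2 in \<open>auto simp: flat_def\<close>)
  next
    case 3
    \<comment> \<open>Right of 0 the difference quotient of \<open>flat n\<close> at 0 is
      \<open>flat (Suc n)\<close>, so the decay known for every exponent gives derivative 0.\<close>
    have "((\<lambda>y. flat n y / y) \<longlongrightarrow> 0) (at_right 0)"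
      by (rule Lim_transform_eventually[OF flat_at_right_0[of "Suc n"]])
        (auto simp: eventually_at_right_field flat_def field_simps intro!: exI[of _ 1])
    moreover have "((\<lambda>y. flat n y / y) \<longlongrightarrow> 0) (at_left 0)"
      by (rule Lim_transform_eventually[OF tendsto_const])
        (auto simp: eventually_at_left_field flat_def intro!: exI[of _ "-1"])
    ultimately have "((\<lambda>y. flat n y / y) \<longlongrightarrow> 0) (at 0)"
      by (simp add: filterlim_split_at)
    then show ?thesis using 3 by (simp add: has_field_derivative_iff flat_def)
  qed
qed

lemma Ck_flat: "Ck k (flat n)"
proof (induction k arbitrary: n)
  case 0
  show ?case
    using DERIV_continuous_on_UNIV[OF flat_has_derivative] by simp
next
  case (Suc k)
  have "Ck k (\<lambda>x. flat (n + 2) x + (- real n) * flat (n + 1) x)"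
    by (intro Ck_add Ck_cmult Suc.IH)
  then show ?case
    by (subst Ck_real_Suc[OF flat_has_derivative]) simp
qed

definition bump :: "real \<Rightarrow> real \<Rightarrow> real \<Rightarrow> real" where
  "bump a b x = flat 0 (x - a) * flat 0 (b - x)"

lemma Ck_bump: "Ck k (bump a b)"
  unfolding bump_def using Ck_affine[OF Ck_flat[of k 0], of 1 "-a"] Ck_affine[OF Ck_flat[of k 0], of "-1" b]
  by (intro Ck_mult) simp_all

lemma bump_pos: "a < x \<Longrightarrow> x < b \<Longrightarrow> bump a b x > 0"
  and bump_zero: "x \<le> a \<or> b \<le> x \<Longrightarrow> bump a b x = 0"
  and bump_nonneg: "bump a b x \<ge> 0"
  by (auto simp: bump_def flat_def)

lemma test_functionI:
  fixes \<psi> :: "real \<Rightarrow> real"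
  assumes "\<And>k. Ck k \<psi>" "\<And>x. x \<notin> {a..b} \<Longrightarrow> \<psi> x = 0" "{a..b} \<subseteq> S"
  shows "test_function S \<psi>"
proof -
  have sub: "{x. \<psi> x \<noteq> 0} \<subseteq> {a..b}"
  proof
    fix x assume "x \<in> {x. \<psi> x \<noteq> 0}"
    then show "x \<in> {a..b}" using assms(2)[of x] by blast
  qed
  then have "compact (closure {x. \<psi> x \<noteq> 0})"
    by (simp add: bounded_subset[OF bounded_closed_interval])
  moreover have "closure {x. \<psi> x \<noteq> 0} \<subseteq> S"
    using closure_minimal[OF sub] assms(3) by simp
  ultimately show ?thesis
    unfolding test_function_def using assms(1) by (intro conjI allI)
qed

lemma test_functionE:
  fixes \<psi> :: "real \<Rightarrow> real"
  assumes "test_function \<Omega> \<psi>"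
  obtains a b \<psi>' where "-1 < a" "a < b" "b < 1" "\<And>x. x \<notin> {a..b} \<Longrightarrow> \<psi> x = 0"
    "\<And>x. x \<notin> {a..b} \<Longrightarrow> \<psi>' x = 0" "continuous_on UNIV \<psi>" "continuous_on UNIV \<psi>'"
    "\<And>x. (\<psi> has_real_derivative \<psi>' x) (at x)"
    "\<And>x. frechet_derivative \<psi> (at x) 1 = \<psi>' x" "test_function \<Omega> \<psi>'"
proof -
  \<comment> \<open>The point 0 is added so that the compact set is nonempty even for the zero
    function.\<close>
  let ?C = "closure {x. \<psi> x \<noteq> 0} \<union> {0}"
  have "compact (closure {x. \<psi> x \<noteq> 0})" and sub: "closure {x. \<psi> x \<noteq> 0} \<subseteq> \<Omega>"
    using assms unfolding test_function_def by (rule conjunct2[THEN conjunct1], rule conjunct2[THEN conjunct2])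
  then have "compact ?C" by (intro compact_Un compact_sing)
  moreover have "?C \<subseteq> \<Omega>" using sub by (rule Un_least) simp
  ultimately have C: "compact ?C" "?C \<subseteq> \<Omega>" "?C \<noteq> {}" by simp_all
  obtain m where m: "m \<in> ?C" "\<And>x. x \<in> ?C \<Longrightarrow> m \<le> x" using compact_attains_inf[OF C(1,3)] by metis
  obtain M where M: "M \<in> ?C" "\<And>x. x \<in> ?C \<Longrightarrow> x \<le> M" using compact_attains_sup[OF C(1,3)] by metis
  \<comment> \<open>Moving the bounds halfway towards -1 and 1 keeps them inside \<Omega> and makes
    a < b strict even when m = M.\<close>
  define a b where "a = (m - 1) / 2" and "b = (M + 1) / 2"
  have ab: "-1 < a" "a < m" "M < b" "b < 1" 
    using subsetD[OF C(2) m(1)] subsetD[OF C(2) M(1)] by (simp_all add: a_def b_def)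
  have z: "\<psi> x = 0" if "x \<notin> {m..M}" for x
  proof (rule ccontr)
    assume "\<psi> x \<noteq> 0"
    then have "x \<in> ?C" using closure_subset[of "{x. \<psi> x \<noteq> 0}"] by blast
    with m(2) M(2) that show False by simp
  qed
  have "Ck (Suc 0) \<psi>" and Ck: "Ck k \<psi>" for k using assms unfolding test_function_def by blast+
  obtain \<psi>' where d: "\<And>x. (\<psi> has_real_derivative \<psi>' x) (at x)" "Ck 0 \<psi>'"
    using Ck_real_SucD[OF \<open>Ck (Suc 0) \<psi>\<close>] by blast
  have z': "\<psi>' x = 0" if "x \<notin> {m..M}" for x
  proof -
    have "((\<lambda>_. 0) has_real_derivative \<psi>' x) (at x)"
      by (rule has_field_derivative_transform_within_open[OF d(1), of "UNIV - {m..M}"])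
        (use that z in \<open>auto intro!: open_Diff\<close>)
    from DERIV_unique[OF this DERIV_const] show ?thesis .
  qed
  have Ck': "Ck k \<psi>'" for k using Ck[of "Suc k"] Ck_real_Suc[OF d(1), of k] by simp
  show thesis
  proof (rule that[of a b \<psi>'])
    show "a < b" using ab m(2)[OF M(1)] by linarith
    show "\<psi> x = 0" "\<psi>' x = 0" if "x \<notin> {a..b}" for x using that z z' ab by auto
    show "continuous_on UNIV \<psi>" using Ck[of 0] by simp
    show "frechet_derivative \<psi> (at x) 1 = \<psi>' x" for x
      using d(1) by (rule frechet_derivative_real)
    show "test_function \<Omega> \<psi>'"
    proof (rule test_functionI[of _ m M])
      show "{m..M} \<subseteq> \<Omega>" using ab by auto
    qed (fact Ck' z')+
    show "continuous_on UNIV \<psi>'" using d(2) by simp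
  qed (fact ab d)+
qed

subsection \<open>The fundamental lemma of the calculus of variations\<close>

lemma lebesgue_on_zero_outside:
  fixes f :: "real \<Rightarrow> real"
  assumes "S \<subseteq> T" "S \<in> sets lebesgue" "T \<in> sets lebesgue" "\<And>x. x \<in> T \<Longrightarrow> x \<notin> S \<Longrightarrow> f x = 0"
  shows "integrable (lebesgue_on T) f \<longleftrightarrow> integrable (lebesgue_on S) f"
    and "(LINT x|lebesgue_on T. f x) = (LINT x|lebesgue_on S. f x)"
proof -
  have "(\<lambda>x. if x \<in> T then f x else 0) = (\<lambda>x. if x \<in> S then f x else 0)"
    using assms by (intro ext) auto
  then show "integrable (lebesgue_on T) f \<longleftrightarrow> integrable (lebesgue_on S) f"
    "(LINT x|lebesgue_on T. f x) = (LINT x|lebesgue_on S. f x)"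
    using assms by (metis Lebesgue_Measure.integrable_restrict_UNIV, metis Lebesgue_Measure.integral_restrict_UNIV)
qed

lemma integrable_lebesgue_on_mult_continuous:
  fixes f \<eta> :: "real \<Rightarrow> real"
  assumes "integrable (lebesgue_on {a..b}) f" "continuous_on {a..b} \<eta>"
  shows "integrable (lebesgue_on {a..b}) (\<lambda>x. f x * \<eta> x)"
proof -
  have "(\<lambda>x. \<eta> x * f x) absolutely_integrable_on {a..b}"
  proof (rule absolutely_integrable_bounded_measurable_product_real)
    show "\<eta> \<in> borel_measurable (lebesgue_on {a..b})"
      by (simp add: assms(2) continuous_imp_measurable_on_sets_lebesgue)
    show "bounded (\<eta> ` {a..b})"
      using assms(2) compact_continuous_image compact_imp_bounded by blast
    show "f absolutely_integrable_on {a..b}"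
      using assms(1) by (simp add: integrable_restrict_space set_integrable_def)
  qed simp
  then show ?thesis
    by (simp add: integrable_restrict_space set_integrable_def mult.commute)
qed

lemma integrable_times_test:
  fixes f \<eta> :: "real \<Rightarrow> real"
  assumes "\<And>C. compact C \<Longrightarrow> C \<subseteq> \<Omega> \<Longrightarrow> integrable (lebesgue_on C) f"
    and "-1 < a" "b < 1" "continuous_on UNIV \<eta>" "\<And>x. x \<notin> {a..b} \<Longrightarrow> \<eta> x = 0"
  shows "integrable (lebesgue_on \<Omega>) (\<lambda>x. f x * \<eta> x)"
proof -
  have sub: "{a..b} \<subseteq> \<Omega>" using assms(2,3) by auto
  then have "integrable (lebesgue_on {a..b}) (\<lambda>x. f x * \<eta> x)"
    by (intro integrable_lebesgue_on_mult_continuous assms(1) continuous_on_subset[OF assms(4)]) auto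
  then show ?thesis
    using lebesgue_on_zero_outside(1)[OF sub, of "\<lambda>x. f x * \<eta> x"] assms(5) by simp
qed

lemma LINT_derivative:
  fixes F f :: "real \<Rightarrow> real"
  assumes "-1 < a" "a < b" "b < 1" "\<And>x. x \<in> {a..b} \<Longrightarrow> (F has_real_derivative f x) (at x)"
    and "continuous_on {a..b} f" "\<And>x. x \<notin> {a..b} \<Longrightarrow> f x = 0"
  shows "(LINT x|lebesgue_on \<Omega>. f x) = F b - F a"
proof -
  have "(LINT x|lebesgue_on \<Omega>. f x) = (LINT x|lebesgue_on {a..b}. f x)"
    using assms by (intro lebesgue_on_zero_outside(2)) auto
  also have "\<dots> = integral {a..b} f"
    using assms by (intro lebesgue_integral_eq_integral continuous_imp_integrable_real) auto
  also have "(f has_integral F b - F a) {a..b}"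
    using assms by (intro fundamental_theorem_of_calculus)
      (auto simp: has_real_derivative_iff_has_vector_derivative[symmetric] intro: has_field_derivative_at_within)
  then have "integral {a..b} f = F b - F a" by (rule integral_unique)
  finally show ?thesis .
qed

text \<open>Vanishing of the integral over a Borel set is stable under complements, because the
  total integral is 0, and under countable disjoint unions; starting from intervals it reaches all
  Borel sets. As \<open>f\<close> is only Lebesgue measurable, the induction runs on a Borel
  function \<open>g\<close> equal to it almost everywhere.\<close>

lemma AE_zero_of_interval_integrals:
  fixes f :: "real \<Rightarrow> real"
  assumes "integrable lebesgue f" "(LINT x|lebesgue. f x) = 0"
    and "\<And>a b. a \<le> b \<Longrightarrow> (LINT x|lebesgue. indicator {a..b} x * f x) = 0"
  shows "AE x in lebesgue. f x = 0"
proof -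
  obtain g where [measurable]: "g \<in> borel_measurable lborel" and "AE x in lborel. f x = g x"
    using assms(1) completion_ex_borel_measurable_real by (metis borel_measurable_integrable)
  then have ae: "AE x in lebesgue. f x = g x" by (simp add: AE_completion)
  have ig: "integrable lebesgue g"
    using assms(1) by (rule integrable_cong_AE_imp) (use ae in \<open>auto intro: measurable_completion\<close>)
  then have ig': "integrable lborel g" by (simp add: integrable_completion)
  have eq: "(LINT x|lborel. indicator A x * g x) = (LINT x|lebesgue. indicator A x * f x)"
    if "A \<in> sets borel" for A
  proof -
    have "(LINT x|lborel. indicator A x * g x) = (LINT x|lebesgue. indicator A x * g x)"
      using that by (subst integral_completion) auto
    also have "\<dots> = (LINT x|lebesgue. indicator A x * f x)"
      using that ae assms(1) ig
      by (intro integral_cong_AE borel_measurable_times borel_measurable_indicator) auto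
    finally show ?thesis .
  qed
  have z: "(LINT x|lborel. indicator A x * g x) = 0" if A: "A \<in> sets borel" for A
  using A proof (induction rule: borel_set_induct)
    case empty
    show ?case by simp
  next
    case (interval a b)
    then show ?case using assms(3)[of a b] eq[of "{a..b}"] by simp
  next
    case (compl A)
    have "(LINT x|lborel. indicator (- A) x * g x) = (LINT x|lborel. g x - indicator A x * g x)"
      by (intro Bochner_Integration.integral_cong) (auto simp: indicator_def)
    also have "\<dots> = (LINT x|lborel. g x) - (LINT x|lborel. indicator A x * g x)"
      using integrable_mult_indicator[of A lborel g] compl(1) ig'
      by (intro Bochner_Integration.integral_diff) auto
    also have "(LINT x|lborel. g x) = 0"
      using eq[of UNIV] assms(2) by simp
    finally show ?case using compl by simp
  next
    case (union A)
    have "(LINT x:(\<Union>i. A i)|lborel. g x) = (\<Sum>i. (LINT x:(A i)|lborel. g x))"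
      using union(1,2) integrable_mult_indicator[of "\<Union>i. A i" lborel g] ig'
      by (intro lebesgue_integral_countable_add)
        (auto simp: set_integrable_def disjoint_family_on_def)
    also have "\<dots> = 0"
      using union by (simp add: set_lebesgue_integral_def)
    finally show ?case by (simp add: set_lebesgue_integral_def)
  qed
  have "AE x in lborel. g x = 0"
    using z by (intro sigma_finite_measure.density_zero[OF sigma_finite_lborel] ig') (auto simp: set_lebesgue_integral_def)
  then have "AE x in lebesgue. g x = 0" by (rule AE_completion)
  with ae show ?thesis by eventually_elim simp
qed

lemma LIMSEQ_flat_0: "(\<lambda>n. flat 0 (real n * x)) \<longlonglongrightarrow> indicator {0<..} x"
proof (cases "x > 0")
  case True
  have "(\<lambda>n. 1 / (real n * x)) \<longlonglongrightarrow> 0"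
    using True by real_asymp
  then have "(\<lambda>n. exp (- (1 / (real n * x)))) \<longlonglongrightarrow> exp (- 0)"
    by (intro tendsto_intros)
  moreover have "\<forall>\<^sub>F n in sequentially. exp (- (1 / (real n * x))) = flat 0 (real n * x)"
    using eventually_gt_at_top[of 0] by eventually_elim (use True in \<open>simp add: flat_def\<close>)
  ultimately show ?thesis using True by (simp add: Lim_transform_eventually)
next
  case False
  then have "flat 0 (real n * x) = 0" for n
    by (simp add: flat_def not_less mult_nonneg_nonpos)
  then show ?thesis using False by simp
qed

lemma flat_0_bounds: "0 \<le> flat 0 x" "flat 0 x \<le> 1"
  by (auto simp: flat_def)

text \<open>The functions \<open>x \<mapsto> flat 0 (n (x - a)) * flat 0 (n (b - x))\<close> increase to the indicator of \<open>(a, b)\<close>.\<close>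

lemma AE_zero_of_test_functions:
  assumes int: "\<And>C. compact C \<Longrightarrow> C \<subseteq> \<Omega> \<Longrightarrow> integrable (lebesgue_on C) k"
    and zero: "\<And>\<psi>. test_function \<Omega> \<psi> \<Longrightarrow> (LINT x|lebesgue_on \<Omega>. k x * \<psi> x) = 0"
  shows "AE x in lebesgue_on \<Omega>. k x = 0"
proof -
  have I: "(LINT x|lebesgue_on {a..b}. k x) = 0" if ab: "-1 < a" "a < b" "b < 1" for a b :: real
  proof -
    define \<psi> where "\<psi> n x = flat 0 (real n * (x - a)) * flat 0 (real n * (b - x))" for n x
    have int': "integrable (lebesgue_on {a..b}) k" using ab by (intro int) auto
    have Ck: "Ck j (\<psi> n)" for j n
      using Ck_affine[OF Ck_flat[of j 0], of "real n" "- real n * a"]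
        Ck_affine[OF Ck_flat[of j 0], of "- real n" "real n * b"]
      unfolding \<psi>_def by (intro Ck_mult) (simp_all add: algebra_simps)
    have out: "\<psi> n x = 0" if "x \<notin> {a..b}" for n x
      using that ab by (auto simp: \<psi>_def flat_def zero_less_mult_iff)
    have "test_function \<Omega> (\<psi> n)" for n
      by (rule test_functionI[OF Ck out]) (use ab in auto)
    have "(LINT x|lebesgue_on {a..b}. k x * \<psi> n x) = 0" for n
    proof -
      have "(LINT x|lebesgue_on \<Omega>. k x * \<psi> n x) = (LINT x|lebesgue_on {a..b}. k x * \<psi> n x)"
        by (rule lebesgue_on_zero_outside(2)) (use ab out in auto)
      with zero[OF \<open>test_function \<Omega> (\<psi> n)\<close>] show ?thesis by simp
    qed
    moreover have "(\<lambda>n. LINT x|lebesgue_on {a..b}. k x * \<psi> n x) \<longlonglongrightarrow> (LINT x|lebesgue_on {a..b}. k x)"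
    proof (rule integral_dominated_convergence[where w = "\<lambda>x. \<bar>k x\<bar>"])
      show "k \<in> borel_measurable (lebesgue_on {a..b})" using int' by simp
      show "(\<lambda>x. k x * \<psi> n x) \<in> borel_measurable (lebesgue_on {a..b})" for n
        using integrable_lebesgue_on_mult_continuous[OF int', of "\<psi> n"] Ck[of 0 n]
        by (simp add: continuous_on_subset)
      show "integrable (lebesgue_on {a..b}) (\<lambda>x. \<bar>k x\<bar>)" using int' by simp
      have "{a, b} \<in> null_sets (lebesgue_on {a..b})"
        using ab by (subst null_sets_restrict_space) auto
      then have "AE x in lebesgue_on {a..b}. x \<notin> {a, b}" by (rule AE_not_in)
      then show "AE x in lebesgue_on {a..b}. (\<lambda>n. k x * \<psi> n x) \<longlonglongrightarrow> k x"
        using AE_space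
      proof eventually_elim
        case (elim x)
        have "(\<lambda>n. k x * \<psi> n x) \<longlonglongrightarrow> k x * (indicator {0<..} (x - a) * indicator {0<..} (b - x))"
          unfolding \<psi>_def by (intro tendsto_intros LIMSEQ_flat_0)
        then show ?case using elim by (simp add: indicator_def)
      qed
      show "AE x in lebesgue_on {a..b}. norm (k x * \<psi> n x) \<le> \<bar>k x\<bar>" for n
        using flat_0_bounds by (auto simp: \<psi>_def abs_mult intro!: mult_left_le mult_le_one)
    qed
    ultimately show ?thesis by (simp add: LIMSEQ_const_iff)
  qed
  have A: "AE x in lebesgue. (if x \<in> {a..b} then k x else 0) = 0" if ab: "-1 < a" "a < b" "b < 1" for a b :: real
  proof (rule AE_zero_of_interval_integrals)
    have "integrable (lebesgue_on {a..b}) k" using ab by (intro int) auto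
    then show "integrable lebesgue (\<lambda>x. if x \<in> {a..b} then k x else 0)"
      by (subst Lebesgue_Measure.integrable_restrict_UNIV) auto
    show "(LINT x|lebesgue. (if x \<in> {a..b} then k x else 0)) = 0"
      using I[OF ab] by (subst Lebesgue_Measure.integral_restrict_UNIV) auto
    fix c d :: real assume "c \<le> d"
    have "(LINT x|lebesgue. indicator {c..d} x * (if x \<in> {a..b} then k x else 0)) =
        (LINT x|lebesgue. (if x \<in> {max a c..min b d} then k x else 0))"
      by (intro Bochner_Integration.integral_cong) (auto simp: indicator_def)
    also have "\<dots> = (LINT x|lebesgue_on {max a c..min b d}. k x)"
      by (subst Lebesgue_Measure.integral_restrict_UNIV) auto
    also have "\<dots> = 0"
    proof (cases "max a c < min b d")
      case True
      then show ?thesis using ab by (intro I) auto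
    next
      case False
      then have "AE x in lebesgue_on {max a c..min b d}. False"
        by (intro AE_I'[of "{max a c..min b d}"], subst null_sets_restrict_space)
          (cases "max a c = min b d"; auto)+
      then show ?thesis by (intro integral_eq_zero_AE) auto
    qed
    finally show "(LINT x|lebesgue. indicator {c..d} x * (if x \<in> {a..b} then k x else 0)) = 0" .
  qed
  \<comment> \<open>Local integrability says nothing up to the endpoints, so \<Omega> is exhausted
    by countably many closed intervals. The shift by 2 makes the interval nondegenerate already for
    n = 0.\<close>
  have "AE x in lebesgue. (if x \<in> {-1 + 1 / (real n + 2)..1 - 1 / (real n + 2)} then k x else 0) = 0" for n :: nat
  proof (rule A)
    show "-1 + 1 / (real n + 2) < 1 - 1 / (real n + 2)"
      using divide_less_eq_1_pos[of "real n + 2" 1] by linarith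
  qed simp_all
  then have "AE x in lebesgue. \<forall>n. (if x \<in> {-1 + 1 / (real n + 2)..1 - 1 / (real n + 2)} then k x else 0) = 0"
    by (simp only: AE_all_countable) blast
  then have "AE x in lebesgue. x \<in> \<Omega> \<longrightarrow> k x = 0"
  proof eventually_elim
    case (elim x)
    show ?case
    proof
      assume x: "x \<in> \<Omega>"
      then obtain n where n: "1 / (real n + 1) < 1 - \<bar>x\<bar>"
        using nat_approx_posE[of "1 - \<bar>x\<bar>"] by (auto simp: abs_less_iff add.commute)
      have "1 / (real n + 2) \<le> 1 / (real n + 1)" by (simp add: field_simps)
      then show "k x = 0" using n elim[rule_format, of n] by (auto split: if_splits)
    qed
  qed
  then show ?thesis by (simp add: AE_restrict_space_iff)
qed

section \<open>Weak derivatives on the interval and square integrability\<close>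

lemma has_weak_derivD:
  assumes "has_weak_deriv \<Omega> 1 f g"
  shows "\<And>C. compact C \<Longrightarrow> C \<subseteq> \<Omega> \<Longrightarrow> integrable (lebesgue_on C) f"
    and "\<And>C. compact C \<Longrightarrow> C \<subseteq> \<Omega> \<Longrightarrow> integrable (lebesgue_on C) g"
    and "\<And>\<psi> \<psi>'. test_function \<Omega> \<psi> \<Longrightarrow> (\<And>x. (\<psi> has_real_derivative \<psi>' x) (at x)) \<Longrightarrow>
      (LINT x|lebesgue_on \<Omega>. f x * \<psi>' x) = - (LINT x|lebesgue_on \<Omega>. g x * \<psi> x)"
proof -
  show "integrable (lebesgue_on C) f" "integrable (lebesgue_on C) g" if "compact C" "C \<subseteq> \<Omega>" for C
    using assms that by (auto simp: has_weak_deriv_def)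
  fix \<psi> \<psi>' :: "real \<Rightarrow> real"
  assume t: "test_function \<Omega> \<psi>" and d: "\<And>x. (\<psi> has_real_derivative \<psi>' x) (at x)"
  have "(\<lambda>x. frechet_derivative \<psi> (at x) 1) = \<psi>'"
    using frechet_derivative_real[OF d] by (intro ext)
  then show "(LINT x|lebesgue_on \<Omega>. f x * \<psi>' x) = - (LINT x|lebesgue_on \<Omega>. g x * \<psi> x)"
    using conjunct2[OF assms[unfolded has_weak_deriv_def]] t by fastforce
qed

lemma has_weak_derivI:
  assumes "\<And>C. compact C \<Longrightarrow> C \<subseteq> \<Omega> \<Longrightarrow> integrable (lebesgue_on C) f"
    and "\<And>C. compact C \<Longrightarrow> C \<subseteq> \<Omega> \<Longrightarrow> integrable (lebesgue_on C) g"
    and "\<And>\<psi> \<psi>' a b. test_function \<Omega> \<psi> \<Longrightarrow> (\<And>x. (\<psi> has_real_derivative \<psi>' x) (at x)) \<Longrightarrow>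
      continuous_on UNIV \<psi> \<Longrightarrow> continuous_on UNIV \<psi>' \<Longrightarrow> -1 < a \<Longrightarrow> a < b \<Longrightarrow> b < 1 \<Longrightarrow>
      (\<And>x. x \<notin> {a..b} \<Longrightarrow> \<psi> x = 0) \<Longrightarrow> (\<And>x. x \<notin> {a..b} \<Longrightarrow> \<psi>' x = 0) \<Longrightarrow>
      (LINT x|lebesgue_on \<Omega>. f x * \<psi>' x) = - (LINT x|lebesgue_on \<Omega>. g x * \<psi> x)"
  shows "has_weak_deriv \<Omega> 1 f g"
  unfolding has_weak_deriv_def
proof (intro conjI allI impI)
  fix \<psi> :: "real \<Rightarrow> real" assume t: "test_function \<Omega> \<psi>"
  from t show "(LINT x|lebesgue_on \<Omega>. f x * frechet_derivative \<psi> (at x) 1) = - (LINT x|lebesgue_on \<Omega>. g x * \<psi> x)"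
  proof (rule test_functionE)
    fix a b \<psi>'
    assume *: "-1 < a" "a < b" "b < 1" "\<And>x. x \<notin> {a..b} \<Longrightarrow> \<psi> x = 0"
      "\<And>x. x \<notin> {a..b} \<Longrightarrow> \<psi>' x = 0" "continuous_on UNIV \<psi>" "continuous_on UNIV \<psi>'"
      "\<And>x. (\<psi> has_real_derivative \<psi>' x) (at x)"
      "\<And>x. frechet_derivative \<psi> (at x) 1 = \<psi>' x"
    show ?thesis unfolding *(9) by (rule assms(3)[OF t *(8,6,7,1-5)])
  qed
qed (use assms in auto)

text \<open>\<open>weak_deriv\<close> selects a representative by choice; this makes
  \<open>J\<close> and \<open>H1_norm\<close> independent of the selection and lets any L2 weak
  derivative stand in for it.\<close>

lemma weak_deriv_unique:
  assumes "has_weak_deriv \<Omega> 1 f g" "has_weak_deriv \<Omega> 1 f g'"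
  shows "AE x in lebesgue_on \<Omega>. g x = g' x"
proof -
  have "AE x in lebesgue_on \<Omega>. g x - g' x = 0"
  proof (rule AE_zero_of_test_functions)
    show "integrable (lebesgue_on C) (\<lambda>x. g x - g' x)" if "compact C" "C \<subseteq> \<Omega>" for C
      using that assms by (intro Bochner_Integration.integrable_diff) (auto intro: has_weak_derivD(2))
    show "(LINT x|lebesgue_on \<Omega>. (g x - g' x) * \<psi> x) = 0" if t: "test_function \<Omega> \<psi>" for \<psi>
      using t
    proof (rule test_functionE)
      fix a b \<psi>'
      assume *: "-1 < a" "a < b" "b < 1" "\<And>x. x \<notin> {a..b} \<Longrightarrow> \<psi> x = 0" "continuous_on UNIV \<psi>"
        "\<And>x. (\<psi> has_real_derivative \<psi>' x) (at x)"
      have "integrable (lebesgue_on \<Omega>) (\<lambda>x. g x * \<psi> x)" "integrable (lebesgue_on \<Omega>) (\<lambda>x. g' x * \<psi> x)"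
        using integrable_times_test[OF has_weak_derivD(2)[OF assms(1)] *(1,3,5,4)]
          integrable_times_test[OF has_weak_derivD(2)[OF assms(2)] *(1,3,5,4)] by auto
      then show ?thesis
        using has_weak_derivD(3)[OF assms(1) t *(6)] has_weak_derivD(3)[OF assms(2) t *(6)]
        by (simp add: left_diff_distrib)
    qed
  qed
  then show ?thesis by eventually_elim simp
qed

lemma has_weak_deriv_add_scaled:
  assumes 1: "has_weak_deriv \<Omega> 1 f g" and 2: "has_weak_deriv \<Omega> 1 f' g'"
  shows "has_weak_deriv \<Omega> 1 (\<lambda>x. f x + t * f' x) (\<lambda>x. g x + t * g' x)"
proof (rule has_weak_derivI)
  note D = has_weak_derivD[OF 1] has_weak_derivD[OF 2]
  show "integrable (lebesgue_on C) (\<lambda>x. f x + t * f' x)" if "compact C" "C \<subseteq> \<Omega>" for C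
    using that D by simp
  show "integrable (lebesgue_on C) (\<lambda>x. g x + t * g' x)" if "compact C" "C \<subseteq> \<Omega>" for C
    using that D by simp
  fix \<psi> \<psi>' a b
  assume *: "test_function \<Omega> \<psi>" "\<And>x. (\<psi> has_real_derivative \<psi>' x) (at x)"
    "continuous_on UNIV \<psi>" "continuous_on UNIV \<psi>'" "-1 < a" "a < b" "b < 1"
    "\<And>x. x \<notin> {a..b} \<Longrightarrow> \<psi> x = 0" "\<And>x. x \<notin> {a..b} \<Longrightarrow> \<psi>' x = 0"
  have "integrable (lebesgue_on \<Omega>) (\<lambda>x. f x * \<psi>' x)" "integrable (lebesgue_on \<Omega>) (\<lambda>x. f' x * \<psi>' x)"
    "integrable (lebesgue_on \<Omega>) (\<lambda>x. g x * \<psi> x)" "integrable (lebesgue_on \<Omega>) (\<lambda>x. g' x * \<psi> x)"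
    by (rule integrable_times_test[OF D(1) *(5,7,4,9)] integrable_times_test[OF D(4) *(5,7,4,9)]
        integrable_times_test[OF D(2) *(5,7,3,8)] integrable_times_test[OF D(5) *(5,7,3,8)]; assumption)+
  then show "(LINT x|lebesgue_on \<Omega>. (f x + t * f' x) * \<psi>' x) = - (LINT x|lebesgue_on \<Omega>. (g x + t * g' x) * \<psi> x)"
    using D(3)[OF *(1,2)] D(6)[OF *(1,2)] by (simp add: distrib_right mult.assoc)
qed

lemma continuous_imp_locally_integrable:
  fixes f :: "real \<Rightarrow> real"
  assumes "continuous_on UNIV f" "compact C"
  shows "integrable (lebesgue_on C) f"
proof -
  obtain M where "\<And>x. x \<in> C \<Longrightarrow> \<bar>f x\<bar> \<le> M"
    using compact_imp_bounded[OF compact_continuous_image[OF continuous_on_subset[OF assms(1)] assms(2)]]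
    by (auto simp: bounded_iff)
  moreover have "f \<in> borel_measurable (lebesgue_on C)"
    using assms by (intro continuous_imp_measurable_on_sets_lebesgue)
      (auto intro: continuous_on_subset lmeasurable_compact fmeasurableD)
  ultimately have "f absolutely_integrable_on C"
    using assms(2) lmeasurable_compact
    by (intro measurable_bounded_by_integrable_imp_absolutely_integrable[where g = "\<lambda>_. M"])
      (auto intro: fmeasurableD simp: integrable_on_const)
  then show ?thesis
    using assms(2) by (simp add: integrable_restrict_space set_integrable_def lmeasurable_compact fmeasurableD)
qed

lemma has_weak_deriv_test:
  assumes "test_function \<Omega> \<psi>" "\<And>x. (\<psi> has_real_derivative \<psi>' x) (at x)"
    "continuous_on UNIV \<psi>'"
  shows "has_weak_deriv \<Omega> 1 \<psi> \<psi>'"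
proof (rule has_weak_derivI)
  have c: "continuous_on UNIV \<psi>" using DERIV_continuous_on_UNIV[OF assms(2)] .
  show "integrable (lebesgue_on C) \<psi>" "integrable (lebesgue_on C) \<psi>'" if "compact C" "C \<subseteq> \<Omega>" for C
    using that continuous_imp_locally_integrable c assms(3) by auto
  fix \<eta> \<eta>' :: "real \<Rightarrow> real" and a b :: real
  assume *: "test_function \<Omega> \<eta>" "\<And>x. (\<eta> has_real_derivative \<eta>' x) (at x)"
    "continuous_on UNIV \<eta>" "continuous_on UNIV \<eta>'" "-1 < a" "a < b" "b < 1"
    "\<And>x. x \<notin> {a..b} \<Longrightarrow> \<eta> x = 0" "\<And>x. x \<notin> {a..b} \<Longrightarrow> \<eta>' x = 0"
  have i: "integrable (lebesgue_on \<Omega>) (\<lambda>x. \<psi> x * \<eta>' x)" "integrable (lebesgue_on \<Omega>) (\<lambda>x. \<psi>' x * \<eta> x)"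
    using continuous_imp_locally_integrable[OF c] continuous_imp_locally_integrable[OF assms(3)]
    by (auto intro!: integrable_times_test[OF _ *(5,7,4,9)] integrable_times_test[OF _ *(5,7,3,8)])
  \<comment> \<open>The interval is widened because \<eta> is known to vanish only outside [a, b],
    and the boundary terms have to be 0.\<close>
  obtain a' b' where ab': "-1 < a'" "a' < a" "b < b'" "b' < 1"
    using dense *(5,7) by metis
  have "(LINT x|lebesgue_on \<Omega>. \<psi> x * \<eta>' x + \<psi>' x * \<eta> x) = \<psi> b' * \<eta> b' - \<psi> a' * \<eta> a'"
  proof (rule LINT_derivative[of a' b' "\<lambda>x. \<psi> x * \<eta> x"])
    show "((\<lambda>x. \<psi> x * \<eta> x) has_real_derivative \<psi> x * \<eta>' x + \<psi>' x * \<eta> x) (at x)" for x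
      using assms(2) *(2) by (auto intro!: derivative_eq_intros)
    show "continuous_on {a'..b'} (\<lambda>x. \<psi> x * \<eta>' x + \<psi>' x * \<eta> x)"
      by (intro continuous_intros continuous_on_subset[OF c] continuous_on_subset[OF assms(3)]
          continuous_on_subset[OF *(3)] continuous_on_subset[OF *(4)]) auto
  qed (use ab' * in auto)
  then show "(LINT x|lebesgue_on \<Omega>. \<psi> x * \<eta>' x) = - (LINT x|lebesgue_on \<Omega>. \<psi>' x * \<eta> x)"
    using i ab' *(8) by simp
qed

lemma L2_add_scaled:
  fixes f g :: "real \<Rightarrow> real"
  assumes "f \<in> L2 S" "g \<in> L2 S"
  shows "(\<lambda>x. f x + t * g x) \<in> L2 S"
    and "integrable (lebesgue_on S) (\<lambda>x. f x * g x)"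
proof -
  have [measurable]: "f \<in> borel_measurable (lebesgue_on S)" "g \<in> borel_measurable (lebesgue_on S)"
    and i: "integrable (lebesgue_on S) (\<lambda>x. (f x)\<^sup>2)" "integrable (lebesgue_on S) (\<lambda>x. (g x)\<^sup>2)"
    using assms by (auto simp: L2_def)
  have fg: "\<bar>a * b\<bar> \<le> a\<^sup>2 + b\<^sup>2" for a b :: real
    using zero_le_power2[of "a + b"] zero_le_power2[of "a - b"] zero_le_power2[of a] zero_le_power2[of b]
    unfolding power2_sum power2_diff by (auto simp: abs_le_iff)
  show 1: "integrable (lebesgue_on S) (\<lambda>x. f x * g x)"
    by (rule Bochner_Integration.integrable_bound[OF Bochner_Integration.integrable_add[OF i]])
      (use fg in auto)
  have "integrable (lebesgue_on S) (\<lambda>x. (f x)\<^sup>2 + 2 * t * (f x * g x) + t\<^sup>2 * (g x)\<^sup>2)"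
    using i 1 by simp
  then show "(\<lambda>x. f x + t * g x) \<in> L2 S"
    by (simp add: L2_def power2_sum power_mult_distrib algebra_simps)
qed

lemma continuous_imp_L2:
  fixes f :: "real \<Rightarrow> real"
  assumes "continuous_on {-1..1} f"
  shows "f \<in> L2 \<Omega>"
proof -
  have "integrable (lebesgue_on {-1..1}) (\<lambda>x. (f x)\<^sup>2)"
    using assms by (intro continuous_imp_integrable_real continuous_intros)
  then have "set_integrable lebesgue {-1..1} (\<lambda>x. (f x)\<^sup>2)"
    by (simp add: set_integrable_def integrable_restrict_space)
  then have "set_integrable lebesgue \<Omega> (\<lambda>x. (f x)\<^sup>2)"
    by (rule set_integrable_subset) auto
  moreover have "continuous_on \<Omega> f" using assms by (rule continuous_on_subset) auto
  ultimately show ?thesis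
    by (simp add: L2_def set_integrable_def integrable_restrict_space continuous_imp_measurable_on_sets_lebesgue)
qed

text \<open>Measurability passes to \<open>g\<close> since Lebesgue measure is complete. This serves
  \<open>weak_deriv\<close>, whose representative is a priori only locally integrable.\<close>

lemma L2_cong_AE:
  fixes f g :: "real \<Rightarrow> real"
  assumes "f \<in> L2 S" "AE x in lebesgue_on S. f x = g x" "S \<in> sets lebesgue"
  shows "g \<in> L2 S"
proof -
  have "AE x in lebesgue. (if x \<in> S then f x else 0) = (if x \<in> S then g x else 0)"
    using assms(2,3) by (auto simp: AE_restrict_space_iff elim!: eventually_mono)
  moreover have "(\<lambda>x. if x \<in> S then f x else 0) \<in> borel_measurable lebesgue"
    using assms by (simp add: L2_def borel_measurable_if)
  ultimately have "(\<lambda>x. if x \<in> S then g x else 0) \<in> borel_measurable lebesgue"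
    by (rule borel_measurable_AE[rotated])
  then have g: "g \<in> borel_measurable (lebesgue_on S)"
    using assms(3) by (simp add: borel_measurable_if)
  have "AE x in lebesgue_on S. (f x)\<^sup>2 = (g x)\<^sup>2" using assms(2) by eventually_elim simp
  moreover have "integrable (lebesgue_on S) (\<lambda>x. (f x)\<^sup>2)" using assms(1) by (simp add: L2_def)
  moreover have "(\<lambda>x. (g x)\<^sup>2) \<in> borel_measurable (lebesgue_on S)" using g by measurable
  ultimately have "integrable (lebesgue_on S) (\<lambda>x. (g x)\<^sup>2)"
    using integrable_cong_AE_imp by (metis (mono_tags, lifting) eq_commute eventually_mono)
  with g show ?thesis by (simp add: L2_def)
qed

subsection \<open>The variational inequality\<close>

lemma test_function_add_scaled:
  fixes \<psi> \<eta> :: "real \<Rightarrow> real"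
  assumes "test_function \<Omega> \<psi>" "test_function \<Omega> \<eta>"
  shows "test_function \<Omega> (\<lambda>x. \<psi> x + t * \<eta> x)"
  using assms(1)
proof (rule test_functionE)
  fix a b assume 1: "-1 < a" "a < b" "b < 1" "\<And>x. x \<notin> {a..b} \<Longrightarrow> \<psi> x = 0"
  from assms(2) show ?thesis
  proof (rule test_functionE)
    fix c d assume 2: "-1 < c" "c < d" "d < 1" "\<And>x. x \<notin> {c..d} \<Longrightarrow> \<eta> x = 0"
    have "Ck k \<psi>" "Ck k \<eta>" for k using assms by (simp_all add: test_function_def)
    then have "Ck k (\<lambda>x. \<psi> x + t * \<eta> x)" for k by (intro Ck_add Ck_cmult)
    moreover have "\<psi> x + t * \<eta> x = 0" if "x \<notin> {min a c..max b d}" for x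
      using that 1(4)[of x] 2(4)[of x] by (cases "x \<in> {a..b}"; cases "x \<in> {c..d}") auto
    moreover have "{min a c..max b d} \<subseteq> \<Omega>" using 1 2 by auto
    ultimately show ?thesis by (rule test_functionI)
  qed
qed

lemma test_function_L2:
  assumes "test_function \<Omega> \<psi>"
  shows "\<psi> \<in> L2 \<Omega>"
  using assms by (rule test_functionE) (blast intro: continuous_imp_L2 continuous_on_subset)

lemma H1_real: "f \<in> H1 \<Omega> \<longleftrightarrow> f \<in> L2 \<Omega> \<and> (\<exists>g\<in>L2 \<Omega>. has_weak_deriv \<Omega> 1 f g)"
  by (simp add: H1_def)

lemma H1_add_test:
  assumes "f \<in> H1 \<Omega>" "test_function \<Omega> \<psi>"
  shows "(\<lambda>x. f x + t * \<psi> x) \<in> H1 \<Omega>"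
proof -
  obtain g where g: "f \<in> L2 \<Omega>" "g \<in> L2 \<Omega>" "has_weak_deriv \<Omega> 1 f g"
    using assms(1) by (auto simp: H1_real)
  from assms(2) show ?thesis
  proof (rule test_functionE)
    fix \<psi>' assume *: "continuous_on UNIV \<psi>'" "\<And>x. (\<psi> has_real_derivative \<psi>' x) (at x)"
      "test_function \<Omega> \<psi>'"
    then show ?thesis
      unfolding H1_real
      using L2_add_scaled(1)[OF g(1) test_function_L2[OF assms(2)]] L2_add_scaled(1)[OF g(2) test_function_L2[OF *(3)]]
        has_weak_deriv_add_scaled[OF g(3) has_weak_deriv_test[OF assms(2) *(2,1)]] by blast
  qed
qed

text \<open>The approximants are shifted by the same t \<psi>, so the differences are literally
  unchanged and no triangle inequality for \<open>H1_norm\<close> enters.\<close>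

lemma H1_0_add_test:
  assumes "f \<in> H1_0 \<Omega>" "test_function \<Omega> \<psi>"
  shows "(\<lambda>x. f x + t * \<psi> x) \<in> H1_0 \<Omega>"
  unfolding H1_0_def
proof (intro CollectI conjI allI impI)
  show "(\<lambda>x. f x + t * \<psi> x) \<in> H1 \<Omega>"
    using assms H1_add_test by (auto simp: H1_0_def)
  fix \<epsilon> :: real assume "\<epsilon> > 0"
  then obtain \<eta> where \<eta>: "test_function \<Omega> \<eta>" "H1_norm \<Omega> (\<lambda>x. f x - \<eta> x) < \<epsilon>"
    using assms(1) by (auto simp: H1_0_def)
  have "(\<lambda>x. f x + t * \<psi> x - (\<eta> x + t * \<psi> x)) = (\<lambda>x. f x - \<eta> x)" by auto
  with \<eta>(2) test_function_add_scaled[OF \<eta>(1) assms(2), of t]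
  show "\<exists>\<psi>'. test_function \<Omega> \<psi>' \<and> H1_norm \<Omega> (\<lambda>x. f x + t * \<psi> x - \<psi>' x) < \<epsilon>"
    by (intro exI[of _ "\<lambda>x. \<eta> x + t * \<psi> x"]) auto
qed

lemma K_add_test:
  assumes "v \<in> K q r" "test_function \<Omega> \<psi>" "\<And>x. x \<in> \<Omega> \<Longrightarrow> phi q r x \<le> v x + t * \<psi> x"
  shows "(\<lambda>x. v x + t * \<psi> x) \<in> K q r"
proof -
  have "(\<lambda>x. v x + t * \<psi> x - phi q r x) = (\<lambda>x. (v x - phi q r x) + t * \<psi> x)" by auto
  then have "(\<lambda>x. v x + t * \<psi> x - phi q r x) \<in> H1_0 \<Omega>"
    using assms(1) H1_0_add_test[OF _ assms(2)] by (simp add: K_def)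
  moreover have "AE x in lebesgue_on \<Omega>. phi q r x \<le> v x + t * \<psi> x"
    using assms(3) by (intro AE_I2) simp
  ultimately show ?thesis using assms H1_add_test by (simp add: K_def)
qed

lemma weak_deriv_in_L2:
  assumes "f \<in> H1 \<Omega>"
  shows "has_weak_deriv \<Omega> 1 f (weak_deriv \<Omega> 1 f)" "weak_deriv \<Omega> 1 f \<in> L2 \<Omega>"
proof -
  obtain g where g: "g \<in> L2 \<Omega>" "has_weak_deriv \<Omega> 1 f g" using assms by (auto simp: H1_real)
  then show 1: "has_weak_deriv \<Omega> 1 f (weak_deriv \<Omega> 1 f)"
    unfolding weak_deriv_def by (metis someI)
  show "weak_deriv \<Omega> 1 f \<in> L2 \<Omega>"
    by (rule L2_cong_AE[OF g(1) weak_deriv_unique[OF g(2) 1]]) simp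
qed

lemma LINT_weak_deriv_square:
  assumes "f \<in> H1 \<Omega>" "has_weak_deriv \<Omega> 1 f g" "g \<in> L2 \<Omega>"
  shows "AE x in lebesgue_on \<Omega>. (weak_deriv \<Omega> 1 f x)\<^sup>2 = (g x)\<^sup>2"
  using weak_deriv_unique[OF weak_deriv_in_L2(1)[OF assms(1)] assms(2)] by eventually_elim simp

lemma J_eq:
  assumes "v \<in> H1 \<Omega>" "has_weak_deriv \<Omega> 1 v d" "d \<in> L2 \<Omega>" "w \<in> L2 \<Omega>"
  shows "J q r h w v = 1 / 2 * (LINT x|lebesgue_on \<Omega>. (v x - w x)\<^sup>2 / h + (d x)\<^sup>2 + beta q r * (v x)\<^sup>2)"
proof -
  have v: "v \<in> L2 \<Omega>" using assms(1) by (simp add: H1_real)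
  have [measurable]: "v \<in> borel_measurable (lebesgue_on \<Omega>)" "w \<in> borel_measurable (lebesgue_on \<Omega>)"
    "d \<in> borel_measurable (lebesgue_on \<Omega>)" "weak_deriv \<Omega> 1 v \<in> borel_measurable (lebesgue_on \<Omega>)"
    using v assms weak_deriv_in_L2[OF assms(1)] by (auto simp: L2_def)
  show ?thesis
    unfolding J_def
    by (intro arg_cong[where f = "(*) (1 / 2)"] integral_cong_AE)
      (use LINT_weak_deriv_square[OF assms(1-3)] in \<open>auto elim!: eventually_mono\<close>)
qed

lemma nonneg_coefficient:
  fixes B C t0 :: real
  assumes "t0 > 0" "\<And>t. 0 < t \<Longrightarrow> t < t0 \<Longrightarrow> 0 \<le> t * B + t\<^sup>2 * C"
  shows "0 \<le> B"
proof -
  have "((\<lambda>t. B + t * C) \<longlongrightarrow> B + 0 * C) (at_right 0)"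
    by (intro tendsto_intros)
  moreover have "\<forall>\<^sub>F t in at_right 0. 0 \<le> B + t * C"
    unfolding eventually_at_right_field
  proof (intro exI[of _ t0] conjI allI impI)
    fix t :: real assume "0 < t" "t < t0"
    then have "0 \<le> t * (B + t * C)" using assms(2)[of t] by (simp add: algebra_simps power2_eq_square)
    then show "0 \<le> B + t * C" using \<open>0 < t\<close> by (simp add: zero_le_mult_iff)
  qed (use assms in auto)
  ultimately show ?thesis using tendsto_lowerbound by fastforce
qed

text \<open>Along U + t \<psi> the functional is a quadratic polynomial in t, and minimality for
  small t > 0 makes its linear coefficient nonnegative. The weak derivative of \<open>U\<close> in
  that coefficient is tested with \<psi>', itself a test function, so that in the end both
  derivatives fall on \<psi>.\<close>

lemma variational_inequality:
  assumes "h > 0" "U \<in> K q r" "continuous_on {-1..1} U" "continuous_on {-1..1} w"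
    and min: "\<And>v. v \<in> K q r \<Longrightarrow> J q r h w U \<le> J q r h w v"
    and \<psi>: "test_function \<Omega> \<psi>" "\<And>x. (\<psi> has_real_derivative \<psi>' x) (at x)"
      "\<And>x. (\<psi>' has_real_derivative \<psi>'' x) (at x)"
    and t0: "t0 > 0" "\<And>t x. 0 < t \<Longrightarrow> t < t0 \<Longrightarrow> x \<in> \<Omega> \<Longrightarrow> phi q r x \<le> U x + t * \<psi> x"
  shows "(LINT x|lebesgue_on \<Omega>. U x * \<psi>'' x) \<le>
    (LINT x|lebesgue_on \<Omega>. ((U x - w x) / h + beta q r * U x) * \<psi> x)"
proof -
  let ?d = "weak_deriv \<Omega> 1 U"
  have U: "U \<in> H1 \<Omega>" using assms(2) by (simp add: K_def)
  note d = weak_deriv_in_L2[OF U]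
  have test': "test_function \<Omega> \<psi>'"
    using \<psi>(1)
  proof (rule test_functionE)
    fix f assume "\<And>x. (\<psi> has_real_derivative f x) (at x)" and t: "test_function \<Omega> f"
    then have "\<psi>' = f" using \<psi>(2) DERIV_unique by blast
    with t show ?thesis by simp
  qed
  have c': "continuous_on UNIV \<psi>'" using DERIV_continuous_on_UNIV[OF \<psi>(3)] .
  have L2: "U \<in> L2 \<Omega>" "w \<in> L2 \<Omega>" "\<psi> \<in> L2 \<Omega>" "\<psi>' \<in> L2 \<Omega>"
    using assms continuous_imp_L2 test_function_L2 test' by auto
  \<comment> \<open>The coefficients of 1, t and t^2 in the integrand of twice the functional at U +
    t \<psi>.\<close>
  define A B C where "A x = (U x - w x)\<^sup>2 / h + (?d x)\<^sup>2 + beta q r * (U x)\<^sup>2"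
    and "B x = 2 * (((U x - w x) / h + beta q r * U x) * \<psi> x) + 2 * (?d x * \<psi>' x)"
    and "C x = (\<psi> x)\<^sup>2 / h + (\<psi>' x)\<^sup>2 + beta q r * (\<psi> x)\<^sup>2" for x
  have Uw: "(\<lambda>x. U x + (-1) * w x) \<in> L2 \<Omega>" by (rule L2_add_scaled(1)[OF L2(1,2)])
  have i1: "integrable (lebesgue_on \<Omega>) (\<lambda>x. ((U x - w x) / h + beta q r * U x) * \<psi> x)"
    using L2_add_scaled(2)[OF Uw L2(3)] L2_add_scaled(2)[OF L2(1,3)]
    by (auto simp: distrib_right mult.assoc intro!: Bochner_Integration.integrable_add)
  have i2: "integrable (lebesgue_on \<Omega>) (\<lambda>x. ?d x * \<psi>' x)"
    by (rule L2_add_scaled(2)[OF d(2) L2(4)])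
  have iA: "integrable (lebesgue_on \<Omega>) A"
    unfolding A_def using Uw d(2) L2 by (auto simp: L2_def intro!: Bochner_Integration.integrable_add)
  have iB: "integrable (lebesgue_on \<Omega>) B"
    unfolding B_def using i1 i2 by simp
  have iC: "integrable (lebesgue_on \<Omega>) C"
    unfolding C_def using L2 by (auto simp: L2_def intro!: Bochner_Integration.integrable_add)
  have "0 \<le> t * (LINT x|lebesgue_on \<Omega>. B x) + t\<^sup>2 * (LINT x|lebesgue_on \<Omega>. C x)"
    if t: "0 < t" "t < t0" for t
  proof -
    have v: "(\<lambda>x. U x + t * \<psi> x) \<in> K q r"
      using t0(2)[OF t] by (rule K_add_test[OF assms(2) \<psi>(1)])
    have "J q r h w (\<lambda>x. U x + t * \<psi> x) = 1 / 2 * (LINT x|lebesgue_on \<Omega>.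
      (U x + t * \<psi> x - w x)\<^sup>2 / h + (?d x + t * \<psi>' x)\<^sup>2 + beta q r * (U x + t * \<psi> x)\<^sup>2)"
      using v by (intro J_eq has_weak_deriv_add_scaled d has_weak_deriv_test L2_add_scaled L2 \<psi> c')
        (simp add: K_def)
    also have "(\<lambda>x. (U x + t * \<psi> x - w x)\<^sup>2 / h + (?d x + t * \<psi>' x)\<^sup>2 + beta q r * (U x + t * \<psi> x)\<^sup>2)
        = (\<lambda>x. A x + (t * B x + t\<^sup>2 * C x))"
      using \<open>h > 0\<close> unfolding A_def B_def C_def
      by (intro ext) (simp add: power2_eq_square field_simps)
    also have "(LINT x|lebesgue_on \<Omega>. A x + (t * B x + t\<^sup>2 * C x)) = (LINT x|lebesgue_on \<Omega>. A x)
        + (t * (LINT x|lebesgue_on \<Omega>. B x) + t\<^sup>2 * (LINT x|lebesgue_on \<Omega>. C x))"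
      using iA iB iC by simp
    finally have "J q r h w (\<lambda>x. U x + t * \<psi> x) = \<dots> / 2" by simp
    moreover have "J q r h w U = (LINT x|lebesgue_on \<Omega>. A x) / 2"
      using J_eq[OF U d L2(2), of q r h] by (simp add: A_def)
    ultimately show ?thesis using min[OF v] by simp
  qed
  then have "0 \<le> (LINT x|lebesgue_on \<Omega>. B x)" by (rule nonneg_coefficient[OF t0(1)])
  also have "\<dots> = 2 * (LINT x|lebesgue_on \<Omega>. ((U x - w x) / h + beta q r * U x) * \<psi> x)
      + 2 * (LINT x|lebesgue_on \<Omega>. ?d x * \<psi>' x)"
    unfolding B_def using i1 i2 by simp
  also have "(LINT x|lebesgue_on \<Omega>. ?d x * \<psi>' x) = - (LINT x|lebesgue_on \<Omega>. U x * \<psi>'' x)"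
    using has_weak_derivD(3)[OF d(1) test' \<psi>(3)] by simp
  finally show ?thesis by simp
qed

subsection \<open>Distributional second derivatives and convexity\<close>

lemma ex_antiderivative:
  fixes f :: "real \<Rightarrow> real"
  assumes "continuous_on UNIV f"
  shows "\<exists>F. \<forall>x. (F has_real_derivative f x) (at x)"
proof -
  have "\<exists>F. \<forall>x :: real. - \<infinity> < ereal x \<longrightarrow> ereal x < \<infinity> \<longrightarrow> (F has_vector_derivative f x) (at x)"
    by (rule einterval_antiderivative) (use assms in \<open>auto simp: continuous_on_eq_continuous_at\<close>)
  then show ?thesis by (simp add: has_real_derivative_iff_has_vector_derivative)
qed

lemma ex_antiderivative_\<Omega>:
  fixes f :: "real \<Rightarrow> real"
  assumes "continuous_on \<Omega> f"
  shows "\<exists>F. \<forall>x\<in>\<Omega>. (F has_real_derivative f x) (at x)"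
proof -
  have "isCont f x" if "ereal (-1) < ereal x" "ereal x < ereal 1" for x
    using assms that by (auto simp: continuous_on_eq_continuous_at)
  then have "\<exists>F. \<forall>x :: real. ereal (-1) < ereal x \<longrightarrow> ereal x < ereal 1 \<longrightarrow> (F has_vector_derivative f x) (at x)"
    by (intro einterval_antiderivative) auto
  then show ?thesis by (simp add: Ball_def imp_conjL has_real_derivative_iff_has_vector_derivative)
qed

lemma smooth_antiderivative:
  fixes f :: "real \<Rightarrow> real"
  assumes "\<And>k. Ck k f" "\<And>x. (F has_real_derivative f x) (at x)"
  shows "Ck k F"
proof (cases k)
  case 0
  then show ?thesis using DERIV_continuous_on_UNIV[OF assms(2)] by simp
next
  case (Suc j)
  then show ?thesis using Ck_real_Suc[OF assms(2)] assms(1) by blast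
qed

lemma constant_of_DERIV_0:
  fixes f :: "real \<Rightarrow> real"
  assumes "convex S" "\<And>x. x \<in> S \<Longrightarrow> (f has_real_derivative 0) (at x)" "x \<in> S" "y \<in> S"
  shows "f x = f y"
proof -
  have "\<exists>c. \<forall>x\<in>S. f x = c"
    using assms(1,2) by (intro has_field_derivative_zero_constant) (auto intro: has_field_derivative_at_within)
  then show ?thesis using assms(3,4) by auto
qed

text \<open>\<open>R\<close> is a smoothed convex kink: affine on either side of
  [-\<epsilon>, \<epsilon>], with all its curvature in between. Combinations of translates whose
  weights annihilate affine functions therefore have compact support.\<close>

lemma ex_double_antiderivative_bump:
  assumes "\<epsilon> > 0"
  obtains R R1 s s' c c' where
    "\<And>x. (R has_real_derivative R1 x) (at x)"
    "\<And>x. (R1 has_real_derivative bump (-\<epsilon>) \<epsilon> x) (at x)"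
    "\<And>k. Ck k R" "convex_on UNIV R"
    "\<And>x. x \<le> -\<epsilon> \<Longrightarrow> R x = s * x + c" "\<And>x. x \<ge> \<epsilon> \<Longrightarrow> R x = s' * x + c'"
proof -
  let ?b = "bump (-\<epsilon>) \<epsilon>"
  have "continuous_on UNIV ?b" using Ck_bump[of 0] by simp
  then obtain R1 where R1: "\<And>x. (R1 has_real_derivative ?b x) (at x)"
    using ex_antiderivative by blast
  obtain R where R: "\<And>x. (R has_real_derivative R1 x) (at x)"
    using ex_antiderivative[OF DERIV_continuous_on_UNIV[OF R1]] by blast
  have "convex_on UNIV R"
    using R R1 bump_nonneg by (intro f''_ge0_imp_convex) auto
  moreover have "Ck k R" for k
    using smooth_antiderivative[OF smooth_antiderivative[OF Ck_bump R1] R] .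
  moreover have aff: "R x - R1 y * x = R y - R1 y * y"
    if "x \<in> S" "y \<in> S" "convex S" "\<And>z. z \<in> S \<Longrightarrow> ?b z = 0" for x y S
  proof -
    have "R1 z = R1 y" if "z \<in> S" for z
    proof (rule constant_of_DERIV_0[OF \<open>convex S\<close> _ that \<open>y \<in> S\<close>])
      show "(R1 has_real_derivative 0) (at u)" if "u \<in> S" for u
        using R1[of u] \<open>\<And>z. z \<in> S \<Longrightarrow> ?b z = 0\<close>[OF that] by simp
    qed
    then have "((\<lambda>x. R x - R1 y * x) has_real_derivative 0) (at z)" if "z \<in> S" for z
      using that R[of z] by (auto intro!: derivative_eq_intros)
    then show ?thesis using constant_of_DERIV_0[OF \<open>convex S\<close> _ \<open>x \<in> S\<close> \<open>y \<in> S\<close>, of "\<lambda>x. R x - R1 y * x"]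
      by blast
  qed
  have "R x = R1 (-\<epsilon>) * x + (R (-\<epsilon>) + R1 (-\<epsilon>) * \<epsilon>)" if "x \<le> -\<epsilon>" for x
    using aff[of x "{..-\<epsilon>}" "-\<epsilon>"] that bump_zero by auto
  moreover have "R x = R1 \<epsilon> * x + (R \<epsilon> - R1 \<epsilon> * \<epsilon>)" if "x \<ge> \<epsilon>" for x
    using aff[of x "{\<epsilon>..}" \<epsilon>] that bump_zero by auto
  ultimately show thesis using that[OF R R1] by blast
qed

text \<open>The test functions are mollified hat functions: with \<open>R'' = bump\<close> the function
  \<open>\<lambda> R(x - a) + (1 - \<lambda>) R(x - c) - R(x - b)\<close> is nonnegative by Jensen's inequality and has compact support.\<close>

lemma convex_on_of_weak_second_derivative:
  fixes k :: "real \<Rightarrow> real"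
  assumes lr: "-1 \<le> l" "l < r" "r \<le> 1" and cont: "continuous_on {l<..<r} k"
    and weak: "\<And>\<psi> \<psi>' \<psi>'' a b. test_function \<Omega> \<psi> \<Longrightarrow> (\<And>x. (\<psi> has_real_derivative \<psi>' x) (at x)) \<Longrightarrow>
      (\<And>x. (\<psi>' has_real_derivative \<psi>'' x) (at x)) \<Longrightarrow> continuous_on UNIV \<psi>'' \<Longrightarrow> (\<And>x. 0 \<le> \<psi> x) \<Longrightarrow>
      l < a \<Longrightarrow> a < b \<Longrightarrow> b < r \<Longrightarrow> (\<And>x. x \<notin> {a..b} \<Longrightarrow> \<psi> x = 0) \<Longrightarrow> (\<And>x. x \<notin> {a..b} \<Longrightarrow> \<psi>' x = 0) \<Longrightarrow>
      (\<And>x. x \<notin> {a..b} \<Longrightarrow> \<psi>'' x = 0) \<Longrightarrow>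
      0 \<le> (LINT x|lebesgue_on \<Omega>. k x * \<psi>'' x)"
  shows "convex_on {l<..<r} k"
proof (rule convex_onI)
  fix t a c :: real
  assume t: "0 < t" "t < 1" and a: "a \<in> {l<..<r}" and c: "c \<in> {l<..<r}"
  define b where "b = (1 - t) * a + t * c"
  have b: "min a c \<le> b" "b \<le> max a c"
    using t convex_bound_le[of a "max a c" c "1 - t" t] convex_bound_le[of "-a" "- min a c" "-c" "1 - t" t]
    unfolding b_def by simp_all
  then have b': "b \<in> {l<..<r}" using a c by auto
  show "k ((1 - t) *\<^sub>R a + t *\<^sub>R c) \<le> (1 - t) * k a + t * k c"
  proof (rule ccontr)
    assume "\<not> k ((1 - t) *\<^sub>R a + t *\<^sub>R c) \<le> (1 - t) * k a + t * k c"
    \<comment> \<open>The convexity defect of \<open>k\<close> with all three points translated by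
      y. It is negative at 0, hence by continuity for all small y, and integrating against a
      mollified hat function averages exactly these defects.\<close>
    define D where "D y = (1 - t) * k (a + y) + t * k (c + y) - k (b + y)" for y
    have D0: "D 0 < 0"
      using \<open>\<not> _\<close> by (simp add: D_def b_def)
    define \<rho> where "\<rho> = min (min (a - l) (c - l)) (min (r - a) (r - c))"
    have \<rho>: "\<rho> > 0" using a c by (auto simp: \<rho>_def)
    have shift: "continuous_on {-\<rho><..<\<rho>} (\<lambda>y. k (p + y))" if "min a c \<le> p" "p \<le> max a c" for p
      by (rule continuous_on_compose2[OF cont])
        (use that in \<open>auto intro!: continuous_intros simp: \<rho>_def\<close>)
    have Dc: "continuous_on {-\<rho><..<\<rho>} D"
      unfolding D_def using b by (intro continuous_intros shift) auto
    have "\<forall>\<^sub>F y in nhds 0. D y < 0"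
    proof -
      have "isCont D 0" using Dc \<rho> by (simp add: continuous_on_eq_continuous_at)
      then have "(D \<longlongrightarrow> D 0) (nhds 0)" by (simp add: continuous_at tendsto_at_iff_tendsto_nhds)
      then show ?thesis using D0 by (rule order_tendstoD(2))
    qed
    then obtain \<delta> where \<delta>: "\<delta> > 0" "\<And>y. \<bar>y\<bar> < \<delta> \<Longrightarrow> D y < 0"
      unfolding eventually_nhds_metric by (auto simp: dist_real_def)
    define \<epsilon> where "\<epsilon> = min \<delta> \<rho> / 2"
    have \<epsilon>: "\<epsilon> > 0" "\<epsilon> < \<delta>" "\<epsilon> < \<rho>" using \<delta> \<rho> by (auto simp: \<epsilon>_def)
    let ?b = "bump (-\<epsilon>) \<epsilon>"
    obtain R R1 s s' d d' where R: "\<And>x. (R has_real_derivative R1 x) (at x)"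
      "\<And>x. (R1 has_real_derivative ?b x) (at x)" "\<And>k. Ck k R" "convex_on UNIV R"
      "\<And>x. x \<le> -\<epsilon> \<Longrightarrow> R x = s * x + d" "\<And>x. x \<ge> \<epsilon> \<Longrightarrow> R x = s' * x + d'"
      using ex_double_antiderivative_bump[OF \<epsilon>(1)] by metis
    define \<psi> where "\<psi> x = (1 - t) * R (x - a) + t * R (x - c) + (-1) * R (x - b)" for x
    define \<psi>' where "\<psi>' x = (1 - t) * R1 (x - a) + t * R1 (x - c) - R1 (x - b)" for x
    define \<psi>'' where "\<psi>'' x = (1 - t) * ?b (x - a) + t * ?b (x - c) - ?b (x - b)" for x
    define m M where "m = min a c - \<epsilon>" and "M = max a c + \<epsilon>"
    have mM: "l < m" "M < r" "m < M" using \<epsilon> by (auto simp: m_def M_def \<rho>_def)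
    have sh: "((\<lambda>x. f (x - p)) has_real_derivative f' (x - p)) (at x)"
      if "\<And>x. (f has_real_derivative f' x) (at x)" for f f' :: "real \<Rightarrow> real" and p x
      using DERIV_shift[of f "f' (x - p)" x "-p"] that[of "x - p"] by simp
    have d1: "(\<psi> has_real_derivative \<psi>' x) (at x)" for x
      unfolding \<psi>_def \<psi>'_def
      by (rule derivative_eq_intros sh[OF R(1)] refl | simp)+
    have d2: "(\<psi>' has_real_derivative \<psi>'' x) (at x)" for x
      unfolding \<psi>'_def \<psi>''_def
      by (rule derivative_eq_intros sh[OF R(2)] refl | simp)+
    have Cb: "continuous_on S (\<lambda>x. ?b (x - p))" for p S
      using Ck_affine[OF Ck_bump[of 0 "-\<epsilon>" \<epsilon>], of 1 "-p"] by (auto intro: continuous_on_subset)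
    have Ck: "Ck j \<psi>" for j
    proof -
      have "Ck j (\<lambda>x. R (x - p))" for p
        using Ck_affine[OF R(3)[of j], of 1 "-p"] by simp
      then show ?thesis unfolding \<psi>_def by (intro Ck_add Ck_cmult)
    qed
    have z: "\<psi> x = 0" if "x \<notin> {m..M}" for x
    proof (cases "x < m")
      case True
      have "\<psi> x = (1 - t) * (s * (x - a) + d) + t * (s * (x - c) + d) - (s * (x - b) + d)"
        using R(5) True b by (simp add: \<psi>_def m_def)
      also have "\<dots> = 0" unfolding b_def by (simp add: algebra_simps)
      finally show ?thesis .
    next
      case False
      then have "M < x" using that by auto
      then have "\<psi> x = (1 - t) * (s' * (x - a) + d') + t * (s' * (x - c) + d') - (s' * (x - b) + d')"
        using R(6) b by (simp add: \<psi>_def M_def)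
      also have "\<dots> = 0" unfolding b_def by (simp add: algebra_simps)
      finally show ?thesis .
    qed
    have z': "\<psi>' x = 0" if "x \<notin> {m..M}" for x
    proof -
      have "((\<lambda>_. 0) has_real_derivative \<psi>' x) (at x)"
        by (rule has_field_derivative_transform_within_open[OF d1, of "UNIV - {m..M}"])
          (use that z in \<open>auto intro!: open_Diff\<close>)
      from DERIV_unique[OF this DERIV_const] show ?thesis .
    qed
    have z'': "\<psi>'' x = 0" if "x \<notin> {m..M}" for x
    proof -
      have "?b (x - p) = 0" if "min a c \<le> p" "p \<le> max a c" for p
        using that \<open>x \<notin> {m..M}\<close> by (intro bump_zero) (auto simp: m_def M_def)
      from this[of a] this[of b] this[of c] b show ?thesis by (simp add: \<psi>''_def)
    qed
    have nonneg: "0 \<le> \<psi> x" for x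
    proof -
      have "R ((1 - t) *\<^sub>R (x - a) + t *\<^sub>R (x - c)) \<le> (1 - t) * R (x - a) + t * R (x - c)"
        using R(4) t by (intro convex_onD) auto
      moreover have "(1 - t) *\<^sub>R (x - a) + t *\<^sub>R (x - c) = x - b"
        by (simp add: b_def algebra_simps)
      ultimately show ?thesis by (simp add: \<psi>_def)
    qed
    have c'': "continuous_on S \<psi>''" for S unfolding \<psi>''_def by (intro continuous_intros Cb)
    have kc: "continuous_on {p-\<epsilon>..p+\<epsilon>} k" if "min a c \<le> p" "p \<le> max a c" for p
      by (rule continuous_on_subset[OF cont]) (use that \<epsilon> in \<open>auto simp: \<rho>_def\<close>)
    have kcM: "continuous_on {m..M} k"
      by (rule continuous_on_subset[OF cont]) (use mM in auto)
    \<comment> \<open>Substituting x = p + y brings the three bumps to the common interval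
      [-\<epsilon>, \<epsilon>], where the integrals merge into that of \<open>D\<close> times one
      bump.\<close>
    have piece: "((\<lambda>x. k x * ?b (x - p)) has_integral integral {-\<epsilon>..\<epsilon>} (\<lambda>y. k (p + y) * ?b y)) {m..M}"
      if p: "min a c \<le> p" "p \<le> max a c" for p
    proof -
      have "((\<lambda>x. k x * ?b (x - p)) has_integral integral {p-\<epsilon>..p+\<epsilon>} (\<lambda>x. k x * ?b (x - p))) {p-\<epsilon>..p+\<epsilon>}"
        by (intro integrable_integral integrable_continuous_real continuous_intros kc[OF p] Cb)
      also have "integral {p-\<epsilon>..p+\<epsilon>} (\<lambda>x. k x * ?b (x - p)) = integral {-\<epsilon>..\<epsilon>} (\<lambda>y. k (p + y) * ?b y)"
        using integral_shift_real_ivl[of "p - \<epsilon>" p "p + \<epsilon>" "\<lambda>x. k x * ?b (x - p)"] by (simp add: add.commute)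
      finally show ?thesis
        by (rule has_integral_on_superset) (use p bump_zero in \<open>auto simp: m_def M_def\<close>)
    qed
    have kci: "(\<lambda>y. k (p + y) * ?b y) integrable_on {-\<epsilon>..\<epsilon>}" if "min a c \<le> p" "p \<le> max a c" for p
      using Cb[of _ 0] \<epsilon> by (intro integrable_continuous_real continuous_intros continuous_on_subset[OF shift[OF that]]) auto
    have "(LINT x|lebesgue_on \<Omega>. k x * \<psi>'' x) = (LINT x|lebesgue_on {m..M}. k x * \<psi>'' x)"
      by (rule lebesgue_on_zero_outside(2)) (use mM lr z'' in auto)
    also have "\<dots> = integral {m..M} (\<lambda>x. k x * \<psi>'' x)"
      by (intro lebesgue_integral_eq_integral continuous_imp_integrable_real continuous_intros kcM c'') simp
    also have "((\<lambda>x. (1 - t) * (k x * ?b (x - a)) + t * (k x * ?b (x - c)) - k x * ?b (x - b)) has_integral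
        ((1 - t) * integral {-\<epsilon>..\<epsilon>} (\<lambda>y. k (a + y) * ?b y) + t * integral {-\<epsilon>..\<epsilon>} (\<lambda>y. k (c + y) * ?b y)
          - integral {-\<epsilon>..\<epsilon>} (\<lambda>y. k (b + y) * ?b y))) {m..M}"
      using b by (intro has_integral_add has_integral_diff has_integral_mult_right piece) auto
    then have "integral {m..M} (\<lambda>x. k x * \<psi>'' x) =
        (1 - t) * integral {-\<epsilon>..\<epsilon>} (\<lambda>y. k (a + y) * ?b y) + t * integral {-\<epsilon>..\<epsilon>} (\<lambda>y. k (c + y) * ?b y)
          - integral {-\<epsilon>..\<epsilon>} (\<lambda>y. k (b + y) * ?b y)"
      by (intro integral_unique) (simp add: \<psi>''_def algebra_simps)
    also have "\<dots> = integral {-\<epsilon>..\<epsilon>} (\<lambda>y. (1 - t) * (k (a + y) * ?b y) + t * (k (c + y) * ?b y) - k (b + y) * ?b y)"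
      using b by (simp add: Henstock_Kurzweil_Integration.integral_add Henstock_Kurzweil_Integration.integral_diff
          kci integrable_add integrable_on_mult_right)
    also have "\<dots> = integral {-\<epsilon>..\<epsilon>} (\<lambda>y. D y * ?b y)"
      by (simp add: D_def algebra_simps)
    also have "\<dots> < integral {-\<epsilon>..\<epsilon>} (\<lambda>y. 0)"
    proof (rule integral_less_real)
      show "continuous_on {-\<epsilon>..\<epsilon>} (\<lambda>y. D y * ?b y)"
        using Cb[of _ 0] \<epsilon> by (intro continuous_intros continuous_on_subset[OF Dc]) auto
      show "D y * ?b y < 0" if "y \<in> {-\<epsilon><..<\<epsilon>}" for y
        using that \<delta>(2)[of y] \<epsilon> bump_pos[of "-\<epsilon>" y \<epsilon>] by (auto simp: mult_less_0_iff)
    qed (use \<epsilon> in auto)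
    also have "\<dots> = 0" by simp
    finally have "(LINT x|lebesgue_on \<Omega>. k x * \<psi>'' x) < 0" .
    moreover have "0 \<le> (LINT x|lebesgue_on \<Omega>. k x * \<psi>'' x)"
    proof (rule weak[OF _ d1 d2 c'' nonneg mM(1,3,2) z z' z''])
      show "test_function \<Omega> \<psi>" by (rule test_functionI[OF Ck z]) (use mM lr in auto)
    qed
    ultimately show False by simp
  qed
qed simp

section \<open>The one-step obstacle problem solved by a minimiser\<close>

lemma phi_continuous: "continuous_on S (phi q r)"
  unfolding phi_def by (intro continuous_intros)

text \<open>\<open>obstacle_step b h p w v s\<close> collects what is used of a minimiser \<open>v\<close> with predecessor \<open>w\<close>
  and obstacle \<open>p\<close>: \<open>v'' \<le> b v + (v - w) / h\<close>, with equality left of the contact point \<open>s\<close>, where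
  the inequality is expressed by the concavity of \<open>v - G\<close> for a second antiderivative \<open>G\<close> of the right-hand side.\<close>

definition obstacle_step ::
  "real \<Rightarrow> real \<Rightarrow> (real \<Rightarrow> real) \<Rightarrow> (real \<Rightarrow> real) \<Rightarrow> (real \<Rightarrow> real) \<Rightarrow> real \<Rightarrow> bool" where
  "obstacle_step b h p w v s \<longleftrightarrow> continuous_on {-1..1} v \<and> v (-1) = p (-1) \<and> -1 < s \<and> s \<le> 1 \<and>
     (\<forall>x\<in>{-1<..<s}. p x < v x) \<and> (\<forall>x\<in>{s..1}. v x = p x) \<and>
     (\<exists>G G1. (\<forall>x\<in>\<Omega>. (G has_real_derivative G1 x) (at x) \<and>
         (G1 has_real_derivative b * v x + (v x - w x) / h) (at x)) \<and>
       concave_on \<Omega> (\<lambda>x. v x - G x) \<and> convex_on {-1<..<s} (\<lambda>x. v x - G x))"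

text \<open>Both integrations by parts at once: G \<psi>' - G1 \<psi> is an antiderivative of the
  integrand and vanishes outside the support.\<close>

lemma LINT_second_antiderivative:
  assumes G: "\<And>x. x \<in> \<Omega> \<Longrightarrow> (G has_real_derivative G1 x) (at x)"
      "\<And>x. x \<in> \<Omega> \<Longrightarrow> (G1 has_real_derivative g x) (at x)" "continuous_on \<Omega> g"
    and \<psi>: "\<And>x. (\<psi> has_real_derivative \<psi>' x) (at x)" "\<And>x. (\<psi>' has_real_derivative \<psi>'' x) (at x)"
      "continuous_on UNIV \<psi>''"
    and supp: "-1 < a" "a < b" "b < 1" "\<And>x. x \<notin> {a..b} \<Longrightarrow> \<psi> x = 0" "\<And>x. x \<notin> {a..b} \<Longrightarrow> \<psi>' x = 0"
      "\<And>x. x \<notin> {a..b} \<Longrightarrow> \<psi>'' x = 0"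
  shows "(LINT x|lebesgue_on \<Omega>. G x * \<psi>'' x - g x * \<psi> x) = 0"
proof -
  obtain a' b' where ab': "-1 < a'" "a' < a" "b < b'" "b' < 1"
    using dense supp by metis
  have sub: "{a'..b'} \<subseteq> \<Omega>" using ab' by auto
  have "(LINT x|lebesgue_on \<Omega>. G x * \<psi>'' x - g x * \<psi> x) =
      (G b' * \<psi>' b' - G1 b' * \<psi> b') - (G a' * \<psi>' a' - G1 a' * \<psi> a')"
  proof (rule LINT_derivative[where F = "\<lambda>x. G x * \<psi>' x - G1 x * \<psi> x"])
    show "((\<lambda>x. G x * \<psi>' x - G1 x * \<psi> x) has_real_derivative G x * \<psi>'' x - g x * \<psi> x) (at x)"
      if "x \<in> {a'..b'}" for x
      using G(1,2)[of x] that sub \<psi>(1,2) by (auto intro!: derivative_eq_intros)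
    have "continuous_on {a'..b'} G" "continuous_on {a'..b'} \<psi>"
      using G(1) sub \<psi>(1) by (blast intro!: continuous_at_imp_continuous_on DERIV_isCont)+
    moreover have "continuous_on {a'..b'} g" "continuous_on {a'..b'} \<psi>''"
      using continuous_on_subset[OF G(3) sub] continuous_on_subset[OF \<psi>(3)] by auto
    ultimately show "continuous_on {a'..b'} (\<lambda>x. G x * \<psi>'' x - g x * \<psi> x)"
      by (intro continuous_intros)
  qed (use ab' supp in auto)
  also have "\<dots> = 0" using supp ab' by simp
  finally show ?thesis .
qed

text \<open>A nonnegative test function may be added with every factor t > 0, which gives one sign
  on all of \<Omega>. On a compact subinterval left of the contact point the gap to the obstacle has
  a positive minimum, so small multiples may also be subtracted, and there the opposite sign holds
  as well. Both become statements on U - G because G'' accounts for the right-hand side.\<close>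

lemma minimiser_obstacle_step:
  assumes "h > 0" "U \<in> K q r" and cU: "continuous_on {-1..1} U" and cw: "continuous_on {-1..1} w"
    and min: "\<And>v. v \<in> K q r \<Longrightarrow> J q r h w U \<le> J q r h w v"
    and s: "contact_point q r U s" "-1 < s" and left: "U (-1) = phi q r (-1)"
  shows "obstacle_step (beta q r) h (phi q r) w U s"
proof -
  define g where "g x = (U x - w x) / h + beta q r * U x" for x
  have "continuous_on {-1..1} g" unfolding g_def using \<open>h > 0\<close> by (intro continuous_intros cU cw) auto
  then have cg: "continuous_on \<Omega> g" by (rule continuous_on_subset) auto
  obtain G1 where G1: "\<And>x. x \<in> \<Omega> \<Longrightarrow> (G1 has_real_derivative g x) (at x)"
    using ex_antiderivative_\<Omega>[OF cg] by blast
  have "continuous_on \<Omega> G1"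
    by (rule continuous_at_imp_continuous_on) (use G1 DERIV_isCont in blast)
  then obtain G where G: "\<And>x. x \<in> \<Omega> \<Longrightarrow> (G has_real_derivative G1 x) (at x)"
    using ex_antiderivative_\<Omega> by blast
  have cG: "continuous_on \<Omega> G"
    by (rule continuous_at_imp_continuous_on) (use G DERIV_isCont in blast)
  have cU': "continuous_on \<Omega> U" by (rule continuous_on_subset[OF cU]) auto
  have ge: "phi q r x \<le> U x" if "x \<in> \<Omega>" for x
    using s that unfolding contact_point_def by (cases "x < s") (auto simp: less_imp_le)
  have s1: "s \<le> 1" using s(1) by (simp add: contact_point_def)
  have key: "(LINT x|lebesgue_on \<Omega>. (U x - G x) * \<psi>'' x) \<le> 0"
    if t: "test_function \<Omega> \<psi>"
      and \<psi>: "\<And>x. (\<psi> has_real_derivative \<psi>' x) (at x)" "\<And>x. (\<psi>' has_real_derivative \<psi>'' x) (at x)"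
        "continuous_on UNIV \<psi>''"
      and supp: "-1 < a" "a < b" "b < 1" "\<And>x. x \<notin> {a..b} \<Longrightarrow> \<psi> x = 0" "\<And>x. x \<notin> {a..b} \<Longrightarrow> \<psi>' x = 0"
        "\<And>x. x \<notin> {a..b} \<Longrightarrow> \<psi>'' x = 0"
      and t0: "t0 > 0" "\<And>t x. 0 < t \<Longrightarrow> t < t0 \<Longrightarrow> x \<in> \<Omega> \<Longrightarrow> phi q r x \<le> U x + t * \<psi> x"
    for \<psi> \<psi>' \<psi>'' a b t0
  proof -
    have c\<psi>: "continuous_on UNIV \<psi>" using DERIV_continuous_on_UNIV[OF \<psi>(1)] .
    have i: "integrable (lebesgue_on \<Omega>) (\<lambda>x. f x * \<eta> x)"
      if "continuous_on \<Omega> f" "continuous_on UNIV \<eta>" "\<And>x. x \<notin> {a..b} \<Longrightarrow> \<eta> x = 0" for f \<eta> :: "real \<Rightarrow> real"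
    proof -
      have sub: "{a..b} \<subseteq> \<Omega>" using supp by auto
      have "integrable (lebesgue_on {a..b}) (\<lambda>x. f x * \<eta> x)"
        by (intro continuous_imp_integrable_real continuous_intros continuous_on_subset[OF that(1) sub]
            continuous_on_subset[OF that(2)]) simp
      then show ?thesis using lebesgue_on_zero_outside(1)[OF sub, of "\<lambda>x. f x * \<eta> x"] that(3) by simp
    qed
    note int = i[OF cU' \<psi>(3) supp(6)] i[OF cG \<psi>(3) supp(6)] i[OF cg c\<psi> supp(4)]
    have "(LINT x|lebesgue_on \<Omega>. (U x - G x) * \<psi>'' x) =
        (LINT x|lebesgue_on \<Omega>. U x * \<psi>'' x) - (LINT x|lebesgue_on \<Omega>. G x * \<psi>'' x)"
      using int by (simp add: left_diff_distrib)
    also have "(LINT x|lebesgue_on \<Omega>. G x * \<psi>'' x) = (LINT x|lebesgue_on \<Omega>. g x * \<psi> x)"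
      using LINT_second_antiderivative[OF G G1 cg \<psi> supp] int by simp
    also have "(LINT x|lebesgue_on \<Omega>. U x * \<psi>'' x) \<le> (LINT x|lebesgue_on \<Omega>. g x * \<psi> x)"
      unfolding g_def by (rule variational_inequality[OF assms(1-4) min t \<psi>(1,2) t0])
    finally show ?thesis by simp
  qed
  have "concave_on \<Omega> (\<lambda>x. U x - G x)"
    unfolding concave_on_def
  proof (rule convex_on_of_weak_second_derivative)
    show "continuous_on \<Omega> (\<lambda>x. - (U x - G x))" by (intro continuous_intros cU' cG)
    fix \<psi> \<psi>' \<psi>'' a b
    assume *: "test_function \<Omega> \<psi>" "\<And>x. (\<psi> has_real_derivative \<psi>' x) (at x)"
      "\<And>x. (\<psi>' has_real_derivative \<psi>'' x) (at x)" "continuous_on UNIV \<psi>''"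
      and nn: "\<And>x. 0 \<le> \<psi> x" and
      supp: "-1 < a" "a < b" "b < 1" "\<And>x. x \<notin> {a..b} \<Longrightarrow> \<psi> x = 0" "\<And>x. x \<notin> {a..b} \<Longrightarrow> \<psi>' x = 0"
        "\<And>x. x \<notin> {a..b} \<Longrightarrow> \<psi>'' x = 0"
    have adm: "phi q r x \<le> U x + t * \<psi> x" if "0 < t" "t < 1" "x \<in> \<Omega>" for t x
      using ge[OF that(3)] nn[of x] that by (simp add: add_increasing2)
    have "(LINT x|lebesgue_on \<Omega>. (U x - G x) * \<psi>'' x) \<le> 0"
      by (rule key[OF * supp zero_less_one adm])
    then show "0 \<le> (LINT x|lebesgue_on \<Omega>. - (U x - G x) * \<psi>'' x)"
      by (simp only: mult_minus_left Bochner_Integration.integral_minus neg_0_le_iff_le)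
  qed auto
  moreover have "convex_on {-1<..<s} (\<lambda>x. U x - G x)"
  proof (rule convex_on_of_weak_second_derivative)
    show "continuous_on {-1<..<s} (\<lambda>x. U x - G x)"
      by (rule continuous_on_subset[of \<Omega>]) (use s1 in \<open>auto intro!: continuous_intros cU' cG\<close>)
    fix \<psi> \<psi>' \<psi>'' a b
    assume *: "test_function \<Omega> \<psi>" "\<And>x. (\<psi> has_real_derivative \<psi>' x) (at x)"
      "\<And>x. (\<psi>' has_real_derivative \<psi>'' x) (at x)" "continuous_on UNIV \<psi>''"
      and nn: "\<And>x. 0 \<le> \<psi> x" and
      supp: "-1 < a" "a < b" "b < s" "\<And>x. x \<notin> {a..b} \<Longrightarrow> \<psi> x = 0" "\<And>x. x \<notin> {a..b} \<Longrightarrow> \<psi>' x = 0"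
        "\<And>x. x \<notin> {a..b} \<Longrightarrow> \<psi>'' x = 0"
    have sub: "{a..b} \<subseteq> {-1..1}" using supp s1 by auto
    have c: "continuous_on {a..b} \<psi>"
      using DERIV_continuous_on_UNIV[OF *(2)] continuous_on_subset by blast
    obtain x0 where x0: "x0 \<in> {a..b}" "\<And>x. x \<in> {a..b} \<Longrightarrow> U x0 - phi q r x0 \<le> U x - phi q r x"
      using continuous_attains_inf[OF _ _ continuous_on_diff[OF continuous_on_subset[OF cU sub] phi_continuous[of _ q r]]] supp(2)
      by auto
    obtain x1 where x1: "x1 \<in> {a..b}" "\<And>x. x \<in> {a..b} \<Longrightarrow> \<psi> x \<le> \<psi> x1"
      using continuous_attains_sup[OF _ _ c] supp(2) by auto
    \<comment> \<open>\<open>M\<close> exceeds the maximum of \<psi> by 1, so it is positive even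
      for \<psi> = 0; then t < m / M keeps t \<psi> below the smallest gap \<open>m\<close>.\<close>
    define m M where "m = U x0 - phi q r x0" and "M = \<psi> x1 + 1"
    have m: "m > 0" using s x0(1) supp by (auto simp: m_def contact_point_def)
    have M: "M > 0" using nn[of x1] by (simp add: M_def)
    have "phi q r x \<le> U x + t * (-1 * \<psi> x)" if "0 < t" "t < m / M" "x \<in> \<Omega>" for t x
    proof (cases "x \<in> {a..b}")
      case True
      have "t * \<psi> x \<le> t * M" using x1(2)[OF True] that by (intro mult_left_mono) (auto simp: M_def)
      also have "\<dots> \<le> m" using that M by (simp add: field_simps)
      also have "\<dots> \<le> U x - phi q r x" using x0(2)[OF True] by (simp add: m_def)
      finally show ?thesis by simp
    next
      case False
      then show ?thesis using ge[OF that(3)] supp(4) by simp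
    qed
    note adm = this
    have neg: "((\<lambda>x. -1 * f x) has_real_derivative -1 * f' x) (at x)"
      if "\<And>x. (f has_real_derivative f' x) (at x)" for f f' :: "real \<Rightarrow> real" and x
      using that by (intro DERIV_cmult)
    \<comment> \<open>-\<psi> is obtained as \<psi> + (-2) \<psi>, to which closure under scaled
      sums applies.\<close>
    have "test_function \<Omega> (\<lambda>x. -1 * \<psi> x)"
      using test_function_add_scaled[OF *(1) *(1), of "-2"] by simp
    then have "(LINT x|lebesgue_on \<Omega>. (U x - G x) * (-1 * \<psi>'' x)) \<le> 0"
    proof (rule key[OF _ neg[OF *(2)] neg[OF *(3)] _ supp(1,2) _ _ _ _ divide_pos_pos[OF m M] adm])
      show "continuous_on UNIV (\<lambda>x. -1 * \<psi>'' x)" using *(4) by (intro continuous_intros)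
    qed (use supp(3) s1 in \<open>simp_all add: supp(4-6)\<close>)
    then show "0 \<le> (LINT x|lebesgue_on \<Omega>. (U x - G x) * \<psi>'' x)"
      by simp
  qed (use s s1 in auto)
  ultimately show ?thesis
    unfolding obstacle_step_def using G G1 s s1 cU left
    by (intro conjI exI[of _ G] exI[of _ G1]) (auto simp: contact_point_def g_def add.commute)
qed

section \<open>Boundary values of continuous functions in \<open>H1_0\<close>\<close>

lemma smooth_step:
  fixes a b :: real
  assumes "a < b"
  shows "\<exists>S s. (\<forall>x. (S has_real_derivative s x) (at x)) \<and> (\<forall>k. Ck k S) \<and> (\<forall>k. Ck k s) \<and> (\<forall>x. 0 \<le> s x) \<and>
    (\<forall>x. x \<notin> {a..b} \<longrightarrow> s x = 0) \<and> (\<forall>x\<le>a. S x = 0) \<and> (\<forall>x\<ge>b. S x = 1) \<and> (\<forall>x. 0 \<le> S x \<and> S x \<le> 1)"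
proof -
  have "continuous_on UNIV (bump a b)" using Ck_bump[of 0] by simp
  then obtain B where B: "\<And>x. (B has_real_derivative bump a b x) (at x)"
    using ex_antiderivative by blast
  have mono: "B x \<le> B y" if "x \<le> y" for x y
    by (rule DERIV_nonneg_imp_nondecreasing[OF that]) (use B bump_nonneg in blast)
  have le: "B x = B a" if x: "x \<le> a" for x
  proof (rule constant_of_DERIV_0[of "{..a}" B])
    show "(B has_real_derivative 0) (at y)" if "y \<in> {..a}" for y
      using B[of y] that bump_zero[of y a b] by simp
  qed (use x in auto)
  have ge: "B x = B b" if x: "b \<le> x" for x
  proof (rule constant_of_DERIV_0[of "{b..}" B])
    show "(B has_real_derivative 0) (at y)" if "y \<in> {b..}" for y
      using B[of y] that bump_zero[of y a b] by simp
  qed (use x in auto)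
  have lt: "B a < B b"
  proof (rule DERIV_pos_imp_increasing_open[OF \<open>a < b\<close>])
    show "\<exists>y. (B has_real_derivative y) (at x) \<and> 0 < y" if "a < x" "x < b" for x
      using B[of x] bump_pos[OF that] by blast
    show "continuous_on {a..b} B"
      by (rule continuous_on_subset[OF DERIV_continuous_on_UNIV[OF B]]) simp
  qed
  define N where "N = B b - B a"
  have N: "N > 0" using lt by (simp add: N_def)
  define S where "S x = (B x - B a) / N" for x
  define s where "s x = (1 / N) * bump a b x" for x
  have d: "(S has_real_derivative s x) (at x)" for x
    using DERIV_cdivide[OF DERIV_diff[OF B[of x] DERIV_const[of "B a"]], of N] by (simp add: S_def[abs_def] s_def)
  have Cs: "Ck k s" for k using Ck_cmult[OF Ck_bump[of k a b], of "1 / N"] by (simp only: s_def[abs_def])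
  have lower: "B a \<le> B x" for x
  proof (cases "x \<le> a")
    case True
    from le[OF True] show ?thesis by simp
  next
    case False
    then show ?thesis by (intro mono) simp
  qed
  have upper: "B x \<le> B b" for x
  proof (cases "b \<le> x")
    case True
    from ge[OF True] show ?thesis by simp
  next
    case False
    then show ?thesis by (intro mono) simp
  qed
  have "Ck k S" for k by (rule smooth_antiderivative[OF Cs d])
  moreover have "S x = 0" if "x \<le> a" for x using le[OF that] by (simp add: S_def)
  moreover have "S x = 1" if "b \<le> x" for x using ge[OF that] N by (simp add: S_def N_def)
  moreover have "0 \<le> S x \<and> S x \<le> 1" for x using lower[of x] upper[of x] N by (simp add: S_def N_def)
  moreover have "0 \<le> s x" for x using N bump_nonneg by (simp add: s_def)
  moreover have "s x = 0" if "x \<notin> {a..b}" for x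
    using that bump_zero[of x a b] by (simp add: s_def not_le) linarith
  ultimately show ?thesis using d Cs by (intro exI[of _ S] exI[of _ s]) simp
qed

lemma continuous_on_Icc_bounded:
  fixes f :: "real \<Rightarrow> real"
  assumes "continuous_on {a..b} f"
  shows "\<exists>B. \<forall>x\<in>{a..b}. \<bar>f x\<bar> \<le> B"
  using compact_imp_bounded[OF compact_continuous_image[OF assms compact_Icc]] by (simp add: bounded_iff)

text \<open>Suppose f(-1) is not 0 and let e = f - \<psi> be small in H1. Near -1 the test function
  \<psi> vanishes, so e = f there. The weak derivative of e is tested with a function \<eta> that
  rises from 0 to 1 close to -1 and falls back to 0 on [-1/2, 1/2]. This compares the average of e
  over the rise, which is close to f(-1), with quantities controlled by the H1 norm of e alone,
  since \<eta> is bounded by 1 however steep the rise is.\<close>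

lemma H1_0_left_endpoint:
  assumes "f \<in> H1_0 \<Omega>" "continuous_on {-1..1} f"
  shows "f (-1) = 0"
proof (rule ccontr)
  assume "f (-1) \<noteq> 0"
  define c where "c = \<bar>f (-1)\<bar>"
  have "c > 0" using \<open>f (-1) \<noteq> 0\<close> by (simp add: c_def)
  \<comment> \<open>The descent is fixed first, since its slope bound \<open>B0\<close> enters the
    choice of \<epsilon>; the position of the rise depends on \<psi> and has to wait.\<close>
  obtain S0 s0 where S0: "\<And>x. (S0 has_real_derivative s0 x) (at x)" "\<And>k. Ck k S0" "\<And>k. Ck k s0" "\<And>x. 0 \<le> s0 x"
      "\<And>x. x \<notin> {-1/2..1/2} \<Longrightarrow> s0 x = 0" "\<And>x. x \<le> -1/2 \<Longrightarrow> S0 x = 0" "\<And>x. 1/2 \<le> x \<Longrightarrow> S0 x = 1"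
      "\<And>x. 0 \<le> S0 x \<and> S0 x \<le> 1"
    using smooth_step[of "-1/2" "1/2"] by auto
  have c0: "continuous_on T s0" for T using S0(3)[of 0] by (auto intro: continuous_on_subset)
  obtain B0 where B0: "\<forall>x\<in>{-1/2..1/2}. \<bar>s0 x\<bar> \<le> B0"
    using continuous_on_Icc_bounded[OF c0[of "{-1/2..1/2}"]] by blast
  have B0': "\<bar>s0 x\<bar> \<le> B0" for x
    using bspec[OF B0, of x] bspec[OF B0, of 0] S0(5)[of x] by (cases "x \<in> {-1/2..1/2}") auto
  have B0pos: "0 \<le> B0" using B0'[of 0] by linarith
  \<comment> \<open>The weak identity leaves 3 \<epsilon> from the derivative and 3 \<epsilon>
    \<open>B0\<close> from the descent. The factor 12 makes the sum at most c / 4, which together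
    with the error c / 2 near -1 stays below c.\<close>
  define \<epsilon> where "\<epsilon> = c / (12 * (B0 + 1))"
  have \<epsilon>: "\<epsilon> > 0" using \<open>c > 0\<close> B0pos by (simp add: \<epsilon>_def)
  obtain \<psi> where \<psi>: "test_function \<Omega> \<psi>" "H1_norm \<Omega> (\<lambda>x. f x - \<psi> x) < \<epsilon>"
    using assms(1) \<epsilon> by (auto simp: H1_0_def)
  define e where "e x = f x - \<psi> x" for x
  have "e \<in> H1 \<Omega>"
    using H1_add_test[OF _ \<psi>(1), of f "-1"] assms(1) by (simp add: e_def[abs_def] H1_0_def)
  define d where "d = weak_deriv \<Omega> 1 e"
  have d: "has_weak_deriv \<Omega> 1 e d" "d \<in> L2 \<Omega>" and e: "e \<in> L2 \<Omega>"
    using weak_deriv_in_L2[OF \<open>e \<in> H1 \<Omega>\<close>] \<open>e \<in> H1 \<Omega>\<close> by (simp_all add: d_def H1_real)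
  have sq: "(LINT x|lebesgue_on \<Omega>. (e x)\<^sup>2) + (LINT x|lebesgue_on \<Omega>. (d x)\<^sup>2) < \<epsilon>\<^sup>2"
  proof -
    have "sqrt ((LINT x|lebesgue_on \<Omega>. (e x)\<^sup>2) + (LINT x|lebesgue_on \<Omega>. (d x)\<^sup>2)) < \<epsilon>"
      using \<psi>(2) by (simp add: H1_norm_def e_def[abs_def] d_def)
    then have "sqrt ((LINT x|lebesgue_on \<Omega>. (e x)\<^sup>2) + (LINT x|lebesgue_on \<Omega>. (d x)\<^sup>2)) < sqrt (\<epsilon>\<^sup>2)"
      using \<epsilon> by simp
    then show ?thesis by (simp only: real_sqrt_less_iff)
  qed
  have nn: "0 \<le> (LINT x|lebesgue_on \<Omega>. (e x)\<^sup>2)" "0 \<le> (LINT x|lebesgue_on \<Omega>. (d x)\<^sup>2)"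
    by (simp_all add: Bochner_Integration.integral_nonneg)
  have iconst: "integrable (lebesgue_on \<Omega>) (\<lambda>x. k :: real)" for k
    using L2_add_scaled(2)[OF continuous_imp_L2[of "\<lambda>_. k"] continuous_imp_L2[of "\<lambda>_. 1"]] by simp
  have L1: "integrable (lebesgue_on \<Omega>) (\<lambda>x. \<bar>k x\<bar>) \<and> (LINT x|lebesgue_on \<Omega>. \<bar>k x\<bar>) \<le> 3 * \<epsilon>"
    if k: "k \<in> L2 \<Omega>" "(LINT x|lebesgue_on \<Omega>. (k x)\<^sup>2) \<le> \<epsilon>\<^sup>2" for k
  proof -
    \<comment> \<open>This replaces the Cauchy-Schwarz inequality: integrated over \<Omega>, of
      length 2, it gives at most 2 \<epsilon> + \<epsilon>.\<close>
    have le: "\<bar>y\<bar> \<le> \<epsilon> + y\<^sup>2 / \<epsilon>" for y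
    proof (cases "\<bar>y\<bar> \<le> \<epsilon>")
      case True
      then show ?thesis using \<epsilon> by (simp add: add_increasing2)
    next
      case False
      then have "\<bar>y\<bar> * \<epsilon> \<le> \<bar>y\<bar> * \<bar>y\<bar>" by (intro mult_left_mono) auto
      then have "\<bar>y\<bar> \<le> y\<^sup>2 / \<epsilon>" using \<epsilon> by (simp add: field_simps power2_eq_square)
      then show ?thesis using \<epsilon> by simp
    qed
    have i: "integrable (lebesgue_on \<Omega>) (\<lambda>x. \<epsilon> + (k x)\<^sup>2 / \<epsilon>)"
      using k(1) by (intro Bochner_Integration.integrable_add iconst) (simp add: L2_def)
    then have i': "integrable (lebesgue_on \<Omega>) (\<lambda>x. \<bar>k x\<bar>)"
      by (rule Bochner_Integration.integrable_bound) (use k(1) le \<epsilon> in \<open>auto simp: L2_def\<close>)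
    have "(LINT x|lebesgue_on \<Omega>. \<bar>k x\<bar>) \<le> (LINT x|lebesgue_on \<Omega>. \<epsilon> + (k x)\<^sup>2 / \<epsilon>)"
      by (rule Bochner_Integration.integral_mono[OF i' i le])
    also have "\<dots> = (LINT x|lebesgue_on \<Omega>. \<epsilon>) + (LINT x|lebesgue_on \<Omega>. (k x)\<^sup>2) / \<epsilon>"
      using k(1) iconst by (subst Bochner_Integration.integral_add) (auto simp: L2_def)
    also have "(LINT x|lebesgue_on \<Omega>. \<epsilon>) = 2 * \<epsilon>"
      by (simp add: measure_restrict_space)
    also have "(LINT x|lebesgue_on \<Omega>. (k x)\<^sup>2) / \<epsilon> \<le> \<epsilon>"
      using k(2) \<epsilon> by (simp add: field_simps power2_eq_square)
    finally show ?thesis using i' by simp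
  qed
  have eL1: "integrable (lebesgue_on \<Omega>) (\<lambda>x. \<bar>e x\<bar>)" "(LINT x|lebesgue_on \<Omega>. \<bar>e x\<bar>) \<le> 3 * \<epsilon>"
    using L1[OF e] sq nn by auto
  have dL1: "integrable (lebesgue_on \<Omega>) (\<lambda>x. \<bar>d x\<bar>)" "(LINT x|lebesgue_on \<Omega>. \<bar>d x\<bar>) \<le> 3 * \<epsilon>"
    using L1[OF d(2)] sq nn by auto
  obtain a1 where a1: "-1 < a1" "\<And>x. x < a1 \<Longrightarrow> \<psi> x = 0"
    using \<psi>(1) by (rule test_functionE) auto
  obtain \<delta> where \<delta>: "\<delta> > 0" "\<And>x. x \<in> {-1..1} \<Longrightarrow> \<bar>x - (-1)\<bar> < \<delta> \<Longrightarrow> \<bar>f x - f (-1)\<bar> < c / 2"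
    using assms(2)[unfolded continuous_on_iff dist_real_def, rule_format, of "-1" "c / 2"] \<open>c > 0\<close> by auto
  \<comment> \<open>On [a, b] the test function vanishes, \<open>f\<close> is within c / 2 of f(-1),
    and the rise ends before the descent begins at -1/2.\<close>
  define b where "b = -1 + min (min \<delta> (a1 + 1)) (1/2) / 2"
  define a where "a = -1 + min (min \<delta> (a1 + 1)) (1/2) / 4"
  have ab: "-1 < a" "a < b" "b < -1/2" "b < a1" "b < -1 + \<delta>"
    using \<delta>(1) a1(1) by (auto simp: a_def b_def min_def)
  obtain S s where S: "\<And>x. (S has_real_derivative s x) (at x)" "\<And>k. Ck k S" "\<And>k. Ck k s" "\<And>x. 0 \<le> s x"
      "\<And>x. x \<notin> {a..b} \<Longrightarrow> s x = 0" "\<And>x. x \<le> a \<Longrightarrow> S x = 0" "\<And>x. b \<le> x \<Longrightarrow> S x = 1"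
      "\<And>x. 0 \<le> S x \<and> S x \<le> 1"
    using smooth_step[OF ab(2)] by auto
  have cs: "continuous_on T s" for T using S(3)[of 0] by (auto intro: continuous_on_subset)
  define \<eta> where "\<eta> x = S x + (-1) * S0 x" for x
  have t: "test_function \<Omega> \<eta>"
  proof (rule test_functionI)
    show "Ck k \<eta>" for k unfolding \<eta>_def by (intro Ck_add Ck_cmult S S0)
    show "\<eta> x = 0" if "x \<notin> {a..1/2}" for x
      using that S(6)[of x] S(7)[of x] S0(6)[of x] S0(7)[of x] ab by (auto simp: \<eta>_def)
  qed (use ab in auto)
  have \<eta>': "(\<eta> has_real_derivative s x - s0 x) (at x)" for x
    unfolding \<eta>_def by (rule derivative_eq_intros S(1) S0(1) refl | simp)+
  have \<eta>1: "\<bar>\<eta> x\<bar> \<le> 1" for x using S(8)[of x] S0(8)[of x] by (auto simp: \<eta>_def)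
  have weak: "(LINT x|lebesgue_on \<Omega>. e x * (s x - s0 x)) = - (LINT x|lebesgue_on \<Omega>. d x * \<eta> x)"
    by (rule has_weak_derivD(3)[OF d(1) t \<eta>'])
  have ies: "integrable (lebesgue_on \<Omega>) (\<lambda>x. e x * s x)" "integrable (lebesgue_on \<Omega>) (\<lambda>x. e x * s0 x)"
    using L2_add_scaled(2)[OF e continuous_imp_L2[OF cs]] L2_add_scaled(2)[OF e continuous_imp_L2[OF c0]] by auto
  have id\<eta>: "integrable (lebesgue_on \<Omega>) (\<lambda>x. d x * \<eta> x)"
    by (rule L2_add_scaled(2)[OF d(2) test_function_L2[OF t]])
  have "\<bar>LINT x|lebesgue_on \<Omega>. d x * \<eta> x\<bar> \<le> (LINT x|lebesgue_on \<Omega>. \<bar>d x * \<eta> x\<bar>)"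
    by (rule integral_abs_bound)
  also have "\<dots> \<le> (LINT x|lebesgue_on \<Omega>. \<bar>d x\<bar>)"
    using \<eta>1 by (intro Bochner_Integration.integral_mono integrable_abs id\<eta> dL1)
      (simp add: abs_mult mult_left_le)
  finally have 1: "\<bar>LINT x|lebesgue_on \<Omega>. d x * \<eta> x\<bar> \<le> 3 * \<epsilon>" using dL1(2) by simp
  have "\<bar>LINT x|lebesgue_on \<Omega>. e x * s0 x\<bar> \<le> (LINT x|lebesgue_on \<Omega>. \<bar>e x * s0 x\<bar>)"
    by (rule integral_abs_bound)
  also have "\<dots> \<le> (LINT x|lebesgue_on \<Omega>. B0 * \<bar>e x\<bar>)"
    using B0' by (intro Bochner_Integration.integral_mono integrable_abs ies integrable_mult_right eL1)
      (simp add: abs_mult mult.commute[of B0] mult_left_mono)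
  also have "\<dots> \<le> B0 * (3 * \<epsilon>)" using eL1 B0pos by (simp add: mult_left_mono)
  finally have 2: "\<bar>LINT x|lebesgue_on \<Omega>. e x * s0 x\<bar> \<le> B0 * (3 * \<epsilon>)" .
  have "\<bar>LINT x|lebesgue_on \<Omega>. e x * s x\<bar> \<le> 3 * \<epsilon> * (B0 + 1)"
    using weak 1 2 ies by (simp add: right_diff_distrib algebra_simps)
  also have "\<dots> = c / 4" using B0pos by (simp add: \<epsilon>_def field_simps)
  finally have small: "\<bar>LINT x|lebesgue_on \<Omega>. e x * s x\<bar> \<le> c / 4" .
  have int_s: "integrable (lebesgue_on \<Omega>) s"
    using L2_add_scaled(2)[OF continuous_imp_L2[OF cs] continuous_imp_L2[of "\<lambda>_. 1"]] by simp
  have "(LINT x|lebesgue_on \<Omega>. s x) = S b - S a"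
    by (rule LINT_derivative) (use ab S(1,5) cs in auto)
  then have s1: "(LINT x|lebesgue_on \<Omega>. s x) = 1" using S(6)[of a] S(7)[of b] by simp
  have "\<bar>(LINT x|lebesgue_on \<Omega>. e x * s x) - f (-1)\<bar> = \<bar>LINT x|lebesgue_on \<Omega>. (e x - f (-1)) * s x\<bar>"
    using s1 int_s ies by (simp add: left_diff_distrib)
  also have "\<dots> \<le> (LINT x|lebesgue_on \<Omega>. \<bar>(e x - f (-1)) * s x\<bar>)"
    by (rule integral_abs_bound)
  also have "\<dots> \<le> (LINT x|lebesgue_on \<Omega>. c / 2 * s x)"
  proof (rule Bochner_Integration.integral_mono)
    show "integrable (lebesgue_on \<Omega>) (\<lambda>x. \<bar>(e x - f (-1)) * s x\<bar>)"
      using int_s ies by (simp add: left_diff_distrib)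
    show "integrable (lebesgue_on \<Omega>) (\<lambda>x. c / 2 * s x)" using int_s by simp
    show "\<bar>(e x - f (-1)) * s x\<bar> \<le> c / 2 * s x" for x
    proof (cases "x \<in> {a..b}")
      case True
      then have "\<bar>e x - f (-1)\<bar> \<le> c / 2"
        using \<delta>(2)[of x] a1(2)[of x] ab by (auto simp: e_def)
      then have "\<bar>e x - f (-1)\<bar> * s x \<le> c / 2 * s x" using S(4) by (rule mult_right_mono)
      then show ?thesis using S(4)[of x] by (simp add: abs_mult)
    next
      case False
      then show ?thesis using S(5) by simp
    qed
  qed
  also have "\<dots> = c / 2" using s1 int_s by simp
  finally show False using small \<open>c > 0\<close> by (auto simp: c_def abs_if split: if_splits)
qed

subsection \<open>Comparison and nondegeneracy\<close>

text \<open>The supremum of the difference quotients to the left of x is finite and lies below every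
  quotient to the right, so it serves as a common slope.\<close>

lemma convex_on_support_line:
  fixes c :: "real \<Rightarrow> real"
  assumes "convex_on {l<..<r} c" "x \<in> {l<..<r}"
  shows "\<exists>\<mu>. \<forall>y\<in>{l<..<r}. c x + \<mu> * (y - x) \<le> c y"
proof -
  define sl where "sl y = (c y - c x) / (y - x)" for y
  have slope: "sl y \<le> sl z" if "y \<in> {l<..<x}" "z \<in> {x<..<r}" for y z
  proof -
    have "y \<in> {l<..<r}" "z \<in> {l<..<r}" "y < x" "x < z" using that assms(2) by auto
    from convex_on_slope_le[OF assms(1) this]
    have "(c y - c x) / (y - x) \<le> (c x - c z) / (x - z)" by linarith
    also have "\<dots> = (c z - c x) / (z - x)" using minus_divide_divide[of "c x - c z" "x - z"] by simp
    finally show ?thesis by (simp add: sl_def)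
  qed
  define \<mu> where "\<mu> = Sup (sl ` {l<..<x})"
  have ne: "sl ` {l<..<x} \<noteq> {}" using assms(2) by auto
  have "(x + r) / 2 \<in> {x<..<r}" using assms(2) by auto
  then have "bdd_above (sl ` {l<..<x})" using slope by (intro bdd_aboveI2) blast
  then have lower: "sl y \<le> \<mu>" if "y \<in> {l<..<x}" for y
    unfolding \<mu>_def using that by (intro cSup_upper) auto
  have upper: "\<mu> \<le> sl z" if "z \<in> {x<..<r}" for z
    unfolding \<mu>_def using that slope by (intro cSup_least[OF ne]) auto
  show ?thesis
  proof (intro exI ballI)
    fix y assume y: "y \<in> {l<..<r}"
    consider "y < x" | "y = x" | "x < y" by linarith
    then show "c x + \<mu> * (y - x) \<le> c y"
    proof cases
      case 1
      then show ?thesis using lower[of y] y by (simp add: sl_def neg_divide_le_eq)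
    next
      case 3
      then show ?thesis using upper[of y] y by (simp add: sl_def pos_le_divide_eq)
    qed simp
  qed
qed

text \<open>Replacing \<open>c\<close> by its support line at x lowers the sum and keeps its value
  at x, so x stays a maximum. The new sum is differentiable, hence critical at x, and a positive
  \<open>a2\<close> would make it increase to the right.\<close>

lemma local_max_second_derivative_le_0:
  fixes A A1 c :: "real \<Rightarrow> real"
  assumes x: "x \<in> {l<..<r}"
    and A: "\<And>y. y \<in> {l<..<r} \<Longrightarrow> (A has_real_derivative A1 y) (at y)" "(A1 has_real_derivative a2) (at x)"
    and c: "convex_on {l<..<r} c"
    and max: "\<And>y. y \<in> {l<..<r} \<Longrightarrow> A y + c y \<le> A x + c x"
  shows "a2 \<le> 0"
proof (rule ccontr)
  assume "\<not> a2 \<le> 0"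
  obtain \<mu> where \<mu>: "\<And>y. y \<in> {l<..<r} \<Longrightarrow> c x + \<mu> * (y - x) \<le> c y"
    using convex_on_support_line[OF c x] by blast
  define B where "B y = A y + \<mu> * (y - x)" for y
  have B: "(B has_real_derivative A1 y + \<mu>) (at y)" if "y \<in> {l<..<r}" for y
    unfolding B_def by (rule derivative_eq_intros A(1)[OF that] refl | simp)+
  have B_max: "B y \<le> B x" if "y \<in> {l<..<r}" for y
    using \<mu>[OF that] max[OF that] by (simp add: B_def)
  define d where "d = min (x - l) (r - x)"
  have "d > 0" using x by (simp add: d_def)
  have "A1 x + \<mu> = 0"
  proof (rule DERIV_local_max[OF B[OF x] \<open>d > 0\<close>], intro allI impI)
    fix y assume "\<bar>x - y\<bar> < d"
    then show "B y \<le> B x" by (intro B_max) (auto simp: d_def)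
  qed
  moreover obtain e where e: "e > 0" "\<And>t. 0 < t \<Longrightarrow> t < e \<Longrightarrow> A1 x < A1 (x + t)"
    using DERIV_pos_inc_right[OF A(2)] \<open>\<not> a2 \<le> 0\<close> by auto
  define z where "z = x + min e d / 2"
  have z: "x < z" "z < x + e" "z < x + d" using e \<open>d > 0\<close> by (auto simp: z_def min_def)
  have sub: "{x..z} \<subseteq> {l<..<r}" using x z by (auto simp: d_def)
  have "B x < B z"
  proof (rule DERIV_pos_imp_increasing_open[OF z(1)])
    show "\<exists>D. (B has_real_derivative D) (at y) \<and> 0 < D" if "x < y" "y < z" for y
    proof -
      have "y \<in> {l<..<r}" using that by (intro subsetD[OF sub]) simp
      moreover have "0 < A1 y + \<mu>" using e(2)[of "y - x"] \<open>A1 x + \<mu> = 0\<close> that z by simp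
      ultimately show ?thesis using B by blast
    qed
    show "continuous_on {x..z} B"
      by (rule continuous_at_imp_continuous_on) (use B sub DERIV_isCont in blast)
  qed
  then show False using B_max[of z] sub z by (simp add: subset_eq)
qed

lemma obstacle_step_ge:
  assumes "obstacle_step b h p w v s" "x \<in> {-1..1}"
  shows "p x \<le> v x"
proof -
  consider "x = -1" | "x \<in> {-1<..<s}" | "x \<in> {s..1}" using assms(2) by fastforce
  then show ?thesis using assms(1) by cases (auto simp: obstacle_step_def less_imp_le)
qed

lemma obstacle_step_less:
  assumes "obstacle_step b h p w v s" "x \<in> {-1..1}" "p x < v x"
  shows "x \<in> {-1<..<s}"
  using assms unfolding obstacle_step_def by (metis atLeastAtMost_iff greaterThanLessThan_iff less_irrefl not_le order_le_less)

text \<open>At a positive maximum point z of v - V one has v > V \<ge> p, which places z left of the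
  contact point; there \<open>v - G\<close> is convex, and so is the negative of V - G'. The
  second-order condition gives b v + (v - w) / h \<le> g' at z, against the supersolution
  inequality, since b > 0 and w \<le> W. The supersolution comes with its own antiderivative G', so
  both discrete solutions and smooth barriers qualify.\<close>

lemma obstacle_step_comparison:
  assumes "b > 0" "h > 0" and step: "obstacle_step b h p w v s"
    and V: "continuous_on {-1..1} V" "\<And>x. x \<in> {-1..1} \<Longrightarrow> p x \<le> V x"
    and G': "\<And>x. x \<in> \<Omega> \<Longrightarrow> (G' has_real_derivative G1' x) (at x)"
      "\<And>x. x \<in> \<Omega> \<Longrightarrow> (G1' has_real_derivative g' x) (at x)" "concave_on \<Omega> (\<lambda>x. V x - G' x)"
    and super: "\<And>x. x \<in> \<Omega> \<Longrightarrow> g' x \<le> b * V x + (V x - W x) / h"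
    and W: "\<And>x. x \<in> \<Omega> \<Longrightarrow> w x \<le> W x"
    and x: "x \<in> {-1..1}"
  shows "v x \<le> V x"
proof (rule ccontr)
  assume "\<not> v x \<le> V x"
  have v: "continuous_on {-1..1} v" "s \<le> 1" using step by (simp_all add: obstacle_step_def)
  obtain z where z: "z \<in> {-1..1}" "\<And>y. y \<in> {-1..1} \<Longrightarrow> v y - V y \<le> v z - V z"
    using continuous_attains_sup[OF _ _ continuous_on_diff[OF v(1) V(1)]] by auto
  have pos: "V z < v z" using z(2)[OF x] \<open>\<not> v x \<le> V x\<close> by linarith
  then have zs: "z \<in> {-1<..<s}" using V(2)[OF z(1)] by (intro obstacle_step_less[OF step z(1)]) simp
  have sub: "{-1<..<s} \<subseteq> \<Omega>" using v(2) by auto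
  then have z\<Omega>: "z \<in> \<Omega>" using zs by blast
  obtain G G1 where G: "\<And>x. x \<in> \<Omega> \<Longrightarrow> (G has_real_derivative G1 x) (at x)"
    "\<And>x. x \<in> \<Omega> \<Longrightarrow> (G1 has_real_derivative b * v x + (v x - w x) / h) (at x)"
    "convex_on {-1<..<s} (\<lambda>x. v x - G x)"
    using step unfolding obstacle_step_def by blast
  have "convex_on {-1<..<s} (\<lambda>x. - (V x - G' x))"
    using G'(3) convex_on_subset[OF _ sub] by (simp add: concave_on_def)
  then have c: "convex_on {-1<..<s} (\<lambda>x. (v x - G x) + - (V x - G' x))"
    by (rule convex_on_add[OF G(3)])
  have "b * v z + (v z - w z) / h - g' z \<le> 0"
  proof (rule local_max_second_derivative_le_0[OF zs _ _ c])
    show "((\<lambda>x. G x - G' x) has_real_derivative G1 y - G1' y) (at y)" if "y \<in> {-1<..<s}" for y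
      using G(1) G'(1) that sub by (intro DERIV_diff) auto
    show "((\<lambda>x. G1 x - G1' x) has_real_derivative b * v z + (v z - w z) / h - g' z) (at z)"
      using G(2) G'(2) z\<Omega> by (intro DERIV_diff) auto
    show "G y - G' y + (v y - G y + - (V y - G' y)) \<le> G z - G' z + (v z - G z + - (V z - G' z))"
      if "y \<in> {-1<..<s}" for y
      using z(2)[of y] that v(2) by simp
  qed
  then have "b * v z + (v z - w z) / h \<le> b * V z + (V z - W z) / h"
    using super[OF z\<Omega>] by linarith
  moreover have "b * V z < b * v z" using pos assms(1) by simp
  moreover have "(V z - W z) / h \<le> (v z - w z) / h"
    using pos W[OF z\<Omega>] assms(2) by (intro divide_right_mono) auto
  ultimately show False by linarith
qed

text \<open>The function W = v - p - c/2 (s - x)^2 is convex on (l, s), because the difference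
  quotient in time is nonnegative and b p - p'' \<ge> c. It tends to 0 at s, and v \<ge> p gives W
  \<ge> -c/2 (s - x)^2, so its slope at s is at most 0. Hence W \<ge> 0. The slope argument is
  carried out with chords, which avoids differentiating \<open>v\<close> at s.\<close>

lemma obstacle_step_nondegenerate:
  assumes "b > 0" "h > 0" and step: "obstacle_step b h p w v s"
    and w: "\<And>x. x \<in> \<Omega> \<Longrightarrow> w x \<le> v x" and cp: "continuous_on {-1..1} p"
    and p: "\<And>x. x \<in> {l<..<s} \<Longrightarrow> (p has_real_derivative p1 x) (at x)"
      "\<And>x. x \<in> {l<..<s} \<Longrightarrow> (p1 has_real_derivative p2 x) (at x)"
      "\<And>x. x \<in> {l<..<s} \<Longrightarrow> c \<le> b * p x - p2 x"
    and l: "-1 \<le> l" and y: "y \<in> {l<..<s}"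
  shows "c / 2 * (s - y)\<^sup>2 \<le> v y - p y"
proof -
  have v: "continuous_on {-1..1} v" "s \<le> 1" "-1 < s" using step by (simp_all add: obstacle_step_def)
  have sub: "{l<..<s} \<subseteq> {-1<..<s}" "{l<..<s} \<subseteq> \<Omega>" using l v by auto
  define W where "W x = v x - p x - c / 2 * (s - x)\<^sup>2" for x
  obtain G G1 where G: "\<And>x. x \<in> \<Omega> \<Longrightarrow> (G has_real_derivative G1 x) (at x)"
    "\<And>x. x \<in> \<Omega> \<Longrightarrow> (G1 has_real_derivative b * v x + (v x - w x) / h) (at x)"
    "convex_on {-1<..<s} (\<lambda>x. v x - G x)"
    using step unfolding obstacle_step_def by blast
  have "convex_on {l<..<s} (\<lambda>x. G x - p x - c / 2 * (s - x)\<^sup>2)"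
  proof (rule f''_ge0_imp_convex)
    fix x assume x: "x \<in> {l<..<s}"
    note d = G(1)[OF subsetD[OF sub(2) x]] G(2)[OF subsetD[OF sub(2) x]] p(1,2)[OF x]
    show "((\<lambda>x. G x - p x - c / 2 * (s - x)\<^sup>2) has_real_derivative G1 x - p1 x + c * (s - x)) (at x)"
      by (rule derivative_eq_intros d refl | simp add: field_simps)+
    show "((\<lambda>x. G1 x - p1 x + c * (s - x)) has_real_derivative b * v x + (v x - w x) / h - p2 x - c) (at x)"
      by (rule derivative_eq_intros d refl | simp)+
    have "x \<in> {-1..1}" using x sub v by auto
    then have "b * p x \<le> b * v x" using obstacle_step_ge[OF step] assms(1) by simp
    moreover have "0 \<le> (v x - w x) / h" using w[OF subsetD[OF sub(2) x]] assms(2) by simp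
    ultimately show "0 \<le> b * v x + (v x - w x) / h - p2 x - c" using p(3)[OF x] by linarith
  qed simp
  from convex_on_add[OF convex_on_subset[OF G(3) sub(1)] this]
  have conv: "convex_on {l<..<s} W" by (simp add: W_def[abs_def] algebra_simps)
  have Ws: "(W \<longlongrightarrow> 0) (at_left s)"
  proof -
    have "continuous_on {-1..s} W"
      unfolding W_def using v cp by (intro continuous_intros) (auto elim: continuous_on_subset)
    then have "(W \<longlongrightarrow> W s) (at s within {-1..s})" using v by (simp add: continuous_on_def)
    moreover have "v s = p s" using step by (simp add: obstacle_step_def)
    ultimately show ?thesis using v by (simp add: W_def at_within_Icc_at_left)
  qed
  have lim_s: "(f \<longlongrightarrow> f s) (at_left s)" if "continuous_on UNIV f" for f :: "real \<Rightarrow> real"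
    using that by (simp add: continuous_on_def filterlim_at_split)
  \<comment> \<open>Convexity holds only on the open interval, so the chord from y to s is the limit
    of chords from y to z as z increases to s.\<close>
  have step1: "(s - y) * W x \<le> (s - x) * W y" if x: "y < x" "x < s" for x
  proof (rule tendsto_le[of "at_left s" "\<lambda>z. (z - x) * W y + (x - y) * W z" _ "\<lambda>z. (z - y) * W x"])
    show "((\<lambda>z. (z - y) * W x) \<longlongrightarrow> (s - y) * W x) (at_left s)"
      by (intro tendsto_intros)
    have "((\<lambda>z. (z - x) * W y + (x - y) * W z) \<longlongrightarrow> (s - x) * W y + (x - y) * 0) (at_left s)"
      by (intro tendsto_intros Ws)
    then show "((\<lambda>z. (z - x) * W y + (x - y) * W z) \<longlongrightarrow> (s - x) * W y) (at_left s)" by simp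
    show "\<forall>\<^sub>F z in at_left s. (z - y) * W x \<le> (z - x) * W y + (x - y) * W z"
      unfolding eventually_at_left_field
    proof (intro exI[of _ x] conjI allI impI)
      fix z assume z: "x < z" "z < s"
      define t where "t = (x - y) / (z - y)"
      have t: "0 \<le> t" "t \<le> 1" "(1 - t) * (z - y) = z - x" "t * (z - y) = x - y"
        using x z by (auto simp: t_def field_simps)
      have "(1 - t) * y + t * z = y + t * (z - y)" by (simp add: algebra_simps)
      also have "\<dots> = x" by (simp add: t(4))
      finally have "W x \<le> (1 - t) * W y + t * W z"
        using convex_onD[OF conv t(1,2), of y z] y x z by simp
      then have "(z - y) * W x \<le> (z - y) * ((1 - t) * W y + t * W z)"
        using x z by (intro mult_left_mono) auto
      also have "\<dots> = ((1 - t) * (z - y)) * W y + (t * (z - y)) * W z" by (simp add: algebra_simps)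
      finally show "(z - y) * W x \<le> (z - x) * W y + (x - y) * W z" unfolding t(3,4) .
    qed (use x in auto)
  qed simp
  have "0 \<le> W y"
  proof (rule tendsto_upperbound[of "\<lambda>x. - (c / 2) * (s - x) * (s - y)" _ "at_left s"])
    have "((\<lambda>x. - (c / 2) * (s - x) * (s - y)) \<longlongrightarrow> - (c / 2) * (s - s) * (s - y)) (at_left s)"
      by (intro tendsto_intros)
    then show "((\<lambda>x. - (c / 2) * (s - x) * (s - y)) \<longlongrightarrow> 0) (at_left s)" by simp
    show "\<forall>\<^sub>F x in at_left s. - (c / 2) * (s - x) * (s - y) \<le> W y"
      unfolding eventually_at_left_field
    proof (intro exI[of _ y] conjI allI impI)
      fix x assume x: "y < x" "x < s"
      have "p x \<le> v x" using x y l v by (intro obstacle_step_ge[OF step]) auto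
      then have "(s - y) * (- (c / 2) * (s - x)\<^sup>2) \<le> (s - y) * W x"
        using x by (intro mult_left_mono) (auto simp: W_def)
      also have "\<dots> \<le> (s - x) * W y" by (rule step1[OF x])
      finally have "(s - x) * (- (c / 2) * (s - x) * (s - y)) \<le> (s - x) * W y"
        by (simp add: power2_eq_square mult_ac)
      then show "- (c / 2) * (s - x) * (s - y) \<le> W y"
        using x by (simp only: mult_le_cancel_left_pos diff_gt_0_iff_gt)
    qed (use y in auto)
  qed simp
  then show ?thesis by (simp add: W_def)
qed

subsection \<open>The time-discrete scheme\<close>

text \<open>The obstacle without its positive part: smooth, below the obstacle, and equal to it for
  x \<ge> 0. Derivatives are taken of this function, so the kink at 0 never has to be
  differentiated.\<close>

definition phi_ext :: "real \<Rightarrow> real \<Rightarrow> real \<Rightarrow> real" where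
  "phi_ext q r x = exp (alpha q r * x) * (exp x - 1)"

definition phi_ext1 :: "real \<Rightarrow> real \<Rightarrow> real \<Rightarrow> real" where
  "phi_ext1 q r x = exp (alpha q r * x) * ((alpha q r + 1) * exp x - alpha q r)"

definition phi_ext2 :: "real \<Rightarrow> real \<Rightarrow> real \<Rightarrow> real" where
  "phi_ext2 q r x = exp (alpha q r * x) * ((alpha q r + 1)\<^sup>2 * exp x - (alpha q r)\<^sup>2)"

lemma phi_ext_derivatives:
  "(phi_ext q r has_real_derivative phi_ext1 q r x) (at x)"
  "(phi_ext1 q r has_real_derivative phi_ext2 q r x) (at x)"
  unfolding phi_ext_def[abs_def] phi_ext1_def[abs_def] phi_ext2_def
  by (auto intro!: derivative_eq_intros simp: algebra_simps power2_eq_square)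

lemma phi_eq_max: "phi q r x = max (phi_ext q r x) 0"
  by (simp add: phi_def phi_ext_def max_def mult_le_0_iff zero_le_mult_iff)

lemma phi_nonneg: "0 \<le> phi q r x" and phi_ext_le_phi: "phi_ext q r x \<le> phi q r x"
  and phi_eq_phi_ext: "0 \<le> x \<Longrightarrow> phi q r x = phi_ext q r x"
  by (simp_all add: phi_def phi_ext_def)

text \<open>Writing v = e^(\<alpha> x) w turns v'' - \<beta> v into e^(\<alpha> x) (w'' + 2 \<alpha>
  w' - r w), as \<beta> - \<alpha>^2 = r; for w = e^x - 1 and 2 \<alpha> = r - q - 1 the bracket is
  r - q e^x.\<close>

lemma phi_ext_operator:
  "beta q r * phi_ext q r x - phi_ext2 q r x = exp (alpha q r * x) * (q * exp x - r)"
proof -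
  have q: "q = r - 1 - 2 * alpha q r" by (simp add: alpha_def field_simps)
  have "beta q r * phi_ext q r x - phi_ext2 q r x
      = exp (alpha q r * x) * ((r - 1 - 2 * alpha q r) * exp x - r)"
    by (simp add: beta_def phi_ext_def phi_ext2_def algebra_simps power2_eq_square)
  then show ?thesis using q by simp
qed

lemma phi_Lipschitz:
  "\<exists>L>0. \<forall>x\<in>{-1..1}. \<forall>y\<in>{-1..1}. \<bar>phi q r x - phi q r y\<bar> \<le> L * \<bar>x - y\<bar>"
proof -
  have "continuous_on {-1..1} (phi_ext1 q r)"
    using DERIV_continuous_on_UNIV[OF phi_ext_derivatives(2)] by (rule continuous_on_subset) simp
  then obtain B where B: "\<forall>x\<in>{-1..1}. \<bar>phi_ext1 q r x\<bar> \<le> B"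
    using continuous_on_Icc_bounded by blast
  have "\<bar>phi q r x - phi q r y\<bar> \<le> (\<bar>B\<bar> + 1) * \<bar>x - y\<bar>" if "x \<in> {-1..1}" "y \<in> {-1..1}" for x y
  proof -
    have "\<bar>phi q r x - phi q r y\<bar> \<le> \<bar>phi_ext q r x - phi_ext q r y\<bar>"
      unfolding phi_eq_max by linarith
    also have "\<dots> \<le> B * \<bar>x - y\<bar>"
      using field_differentiable_bound[of "{-1..1}" "phi_ext q r" "phi_ext1 q r" B x y] that B
      by (auto intro: has_field_derivative_at_within phi_ext_derivatives)
    also have "\<dots> \<le> (\<bar>B\<bar> + 1) * \<bar>x - y\<bar>" by (intro mult_right_mono) auto
    finally show ?thesis .
  qed
  then show ?thesis by (intro exI[of _ "\<bar>B\<bar> + 1"]) auto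
qed

text \<open>By completing the square, a Lipschitz function lies below a parabola with vertex at any
  given point, at the price of \<eta>. Smooth barriers thus cope with the kink.\<close>

lemma phi_le_parabola:
  assumes "\<And>x y. x \<in> {-1..1} \<Longrightarrow> y \<in> {-1..1} \<Longrightarrow> \<bar>phi q r x - phi q r y\<bar> \<le> L * \<bar>x - y\<bar>"
    and "\<eta> > 0" "x \<in> {-1..1}" "y \<in> {-1..1}"
  shows "phi q r y \<le> phi q r x + \<eta> + L\<^sup>2 / (4 * \<eta>) * (y - x)\<^sup>2"
proof -
  have "0 \<le> (2 * \<eta> - L * \<bar>y - x\<bar>)\<^sup>2 / (4 * \<eta>)" using assms(2) by simp
  also have "\<dots> = \<eta> - L * \<bar>y - x\<bar> + L\<^sup>2 / (4 * \<eta>) * (y - x)\<^sup>2"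
    using assms(2) by (simp add: power2_diff power_mult_distrib field_simps power2_eq_square)
  finally show ?thesis using assms(1)[OF assms(4,3)] by linarith
qed

text \<open>The interface between the variational part and the comparison arguments: minimality
  enters the latter only through pointwise obstacle steps.\<close>

definition discrete_solution ::
  "real \<Rightarrow> real \<Rightarrow> real \<Rightarrow> nat \<Rightarrow> (nat \<Rightarrow> real \<Rightarrow> real) \<Rightarrow> (nat \<Rightarrow> real) \<Rightarrow> bool" where
  "discrete_solution q r h N U X \<longleftrightarrow> (\<forall>x\<in>{-1..1}. U 0 x = phi q r x) \<and>
     (\<forall>m\<in>{1..N}. obstacle_step (beta q r) h (phi q r) (U (m - 1)) (U m) (X m))"

lemma beta_pos: "r > 0 \<Longrightarrow> beta q r > 0"
  unfolding beta_def by (rule add_nonneg_pos) auto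

lemma scheme_discrete_solution:
  assumes "h > 0" "0 < q" "q < r" and U: "scheme T q r h U" and X: "discrete_boundary T q r h U X"
  shows "discrete_solution q r h (nat \<lfloor>T / h\<rfloor>) U X"
  unfolding discrete_solution_def
proof (intro conjI ballI)
  show U0: "U 0 x = phi q r x" if "x \<in> {-1..1}" for x using U that by (simp add: scheme_def)
  fix m assume m: "m \<in> {1..nat \<lfloor>T / h\<rfloor>}"
  have Um: "U m \<in> K q r" "continuous_on {-1..1} (U m)"
    "\<And>v. v \<in> K q r \<Longrightarrow> J q r h (U (m - 1)) (U m) \<le> J q r h (U (m - 1)) v"
    using U m unfolding scheme_def by blast+
  have "continuous_on {-1..1} (U (m - 1))"
  proof (cases "m = 1")
    case True
    then show ?thesis using continuous_on_eq[OF phi_continuous U0[symmetric], of "{-1..1}"] by simp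
  next
    case False
    then have "m - 1 \<in> {1..nat \<lfloor>T / h\<rfloor>}" using m by auto
    then show ?thesis using U unfolding scheme_def by blast
  qed
  moreover have "contact_point q r (U m) (X m)" "x_zero q r < X m"
    using X m unfolding discrete_boundary_def by auto
  moreover have "0 < x_zero q r" using assms(2,3) by (simp add: x_zero_def)
  moreover have "U m (-1) - phi q r (-1) = 0"
    using Um(1) by (intro H1_0_left_endpoint continuous_on_diff Um(2) phi_continuous) (simp add: K_def)
  ultimately show "obstacle_step (beta q r) h (phi q r) (U (m - 1)) (U m) (X m)"
    using assms(1) Um by (intro minimiser_obstacle_step) auto
qed

context
  fixes q r h :: real and N :: nat and U :: "nat \<Rightarrow> real \<Rightarrow> real" and X :: "nat \<Rightarrow> real"
  assumes pos: "h > 0" "r > 0" and sol: "discrete_solution q r h N U X"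
begin

lemma discrete_solution_0: "x \<in> {-1..1} \<Longrightarrow> U 0 x = phi q r x"
  using sol by (simp add: discrete_solution_def)

lemma discrete_solution_step: "m \<noteq> 0 \<Longrightarrow> m \<le> N \<Longrightarrow> obstacle_step (beta q r) h (phi q r) (U (m - 1)) (U m) (X m)"
  using sol by (simp add: discrete_solution_def)

lemma discrete_solution_continuous: "m \<le> N \<Longrightarrow> continuous_on {-1..1} (U m)"
proof (cases "m = 0")
  case True
  then show ?thesis using continuous_on_eq[OF phi_continuous discrete_solution_0[symmetric], of "{-1..1}"] by simp
qed (use discrete_solution_step in \<open>auto simp: obstacle_step_def\<close>)

lemma discrete_solution_ge: "m \<le> N \<Longrightarrow> x \<in> {-1..1} \<Longrightarrow> phi q r x \<le> U m x"
  using discrete_solution_0 obstacle_step_ge[OF discrete_solution_step] by (cases "m = 0") auto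

lemma discrete_solution_boundary: "m \<le> N \<Longrightarrow> U m (-1) = phi q r (-1)" "m \<le> N \<Longrightarrow> U m 1 = phi q r 1"
  using discrete_solution_0 discrete_solution_step[of m] by (cases "m = 0"; force simp: obstacle_step_def)+

text \<open>Two consecutive steps solve the same problem with ordered predecessors, so comparison
  propagates the order. It starts from the obstacle itself, which lies below every solution.\<close>

lemma discrete_solution_mono: "Suc m \<le> N \<Longrightarrow> x \<in> {-1..1} \<Longrightarrow> U m x \<le> U (Suc m) x"
proof (induction m arbitrary: x)
  case 0
  then show ?case using discrete_solution_0 discrete_solution_ge by simp
next
  case (Suc m)
  have step: "obstacle_step (beta q r) h (phi q r) (U m) (U (Suc m)) (X (Suc m))"
    "obstacle_step (beta q r) h (phi q r) (U (Suc m)) (U (Suc (Suc m))) (X (Suc (Suc m)))"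
    using Suc.prems discrete_solution_step[of "Suc m"] discrete_solution_step[of "Suc (Suc m)"] by auto
  obtain G G1 where G: "\<And>x. x \<in> \<Omega> \<Longrightarrow> (G has_real_derivative G1 x) (at x)"
    "\<And>x. x \<in> \<Omega> \<Longrightarrow> (G1 has_real_derivative
      beta q r * U (Suc (Suc m)) x + (U (Suc (Suc m)) x - U (Suc m) x) / h) (at x)"
    "concave_on \<Omega> (\<lambda>x. U (Suc (Suc m)) x - G x)"
    using step(2) unfolding obstacle_step_def by blast
  show ?case
  proof (rule obstacle_step_comparison[OF beta_pos[OF pos(2)] pos(1) step(1) _ _ G order_refl _ Suc.prems(2)])
    show "U m x \<le> U (Suc m) x" if "x \<in> \<Omega>" for x using Suc that by simp
  qed (use Suc.prems discrete_solution_continuous discrete_solution_ge in auto)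
qed

text \<open>A parabola raised at the speed 2 M, its own second derivative, is a discrete
  supersolution: its difference quotient in time is exactly 2 M, and the \<beta> term is nonnegative
  because the barrier stays above the nonnegative obstacle.\<close>

lemma discrete_solution_le_parabola:
  assumes M: "M \<ge> 0" "\<And>y. y \<in> {-1..1} \<Longrightarrow> phi q r y \<le> a + M * (y - x)\<^sup>2"
  shows "m \<le> N \<Longrightarrow> y \<in> {-1..1} \<Longrightarrow> U m y \<le> a + M * (y - x)\<^sup>2 + 2 * M * (real m * h)"
proof (induction m arbitrary: y)
  case 0
  then show ?case using discrete_solution_0 M by simp
next
  case (Suc m)
  have ge: "phi q r y \<le> a + M * (y - x)\<^sup>2 + 2 * M * (real k * h)" if "y \<in> {-1..1}" for y k
    using M(2)[OF that] M(1) pos(1) by (simp add: add_increasing2)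
  have "obstacle_step (beta q r) h (phi q r) (U m) (U (Suc m)) (X (Suc m))"
    using Suc.prems discrete_solution_step[of "Suc m"] by auto
  then show ?case
  proof (rule obstacle_step_comparison[OF beta_pos[OF pos(2)] pos(1)])
    show "((\<lambda>y. a + M * (y - x)\<^sup>2 + 2 * M * (real (Suc m) * h)) has_real_derivative 2 * M * (z - x)) (at z)"
      "((\<lambda>z. 2 * M * (z - x)) has_real_derivative 2 * M) (at z)" for z
      by (auto intro!: derivative_eq_intros)
    show "concave_on \<Omega> (\<lambda>z. (a + M * (z - x)\<^sup>2 + 2 * M * (real (Suc m) * h)) - (a + M * (z - x)\<^sup>2 + 2 * M * (real (Suc m) * h)))"
      by (simp add: concave_on_def convex_on_def)
    show "2 * M \<le> beta q r * (a + M * (z - x)\<^sup>2 + 2 * M * (real (Suc m) * h)) +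
      ((a + M * (z - x)\<^sup>2 + 2 * M * (real (Suc m) * h)) - (a + M * (z - x)\<^sup>2 + 2 * M * (real m * h))) / h"
      if "z \<in> \<Omega>" for z
    proof -
      have "0 \<le> a + M * (z - x)\<^sup>2 + 2 * M * (real (Suc m) * h)"
        using that by (intro order_trans[OF phi_nonneg ge]) simp
      then have "0 \<le> beta q r * (a + M * (z - x)\<^sup>2 + 2 * M * (real (Suc m) * h))"
        using beta_pos[OF pos(2), of q] by simp
      moreover have "((a + M * (z - x)\<^sup>2 + 2 * M * (real (Suc m) * h)) - (a + M * (z - x)\<^sup>2 + 2 * M * (real m * h))) / h = 2 * M"
        using pos(1) by (simp add: field_simps)
      ultimately show ?thesis by linarith
    qed
    show "U m z \<le> a + M * (z - x)\<^sup>2 + 2 * M * (real m * h)" if "z \<in> \<Omega>" for z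
      using Suc that by simp
    show "phi q r z \<le> a + M * (z - x)\<^sup>2 + 2 * M * (real (Suc m) * h)" if "z \<in> {-1..1}" for z
      by (rule ge[OF that])
    show "continuous_on {-1..1} (\<lambda>z. a + M * (z - x)\<^sup>2 + 2 * M * (real (Suc m) * h))"
      by (intro continuous_intros)
  qed (fact Suc.prems)
qed

text \<open>The barrier is read off at its vertex: opening L^2 / (4 \<eta>), speed L^2 / (2 \<eta>).
  Only the time m h enters, so the bound is uniform in the step size.\<close>

lemma discrete_solution_modulus:
  assumes "\<And>x y. x \<in> {-1..1} \<Longrightarrow> y \<in> {-1..1} \<Longrightarrow> \<bar>phi q r x - phi q r y\<bar> \<le> L * \<bar>x - y\<bar>"
    and "\<eta> > 0" "m \<le> N" "x \<in> {-1..1}"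
  shows "U m x \<le> phi q r x + \<eta> + L\<^sup>2 / (2 * \<eta>) * (real m * h)"
  using discrete_solution_le_parabola[of "L\<^sup>2 / (4 * \<eta>)" "phi q r x + \<eta>" x m x] phi_le_parabola[OF assms(1,2,4)] assms(2-4)
  by (simp add: field_simps)

text \<open>The growth constant bounds e^(\<alpha> x) (q e^x - r) from below on (l, 1]: the first
  factor is at least e^(-|\<alpha>|) because 0 < x \<le> 1, the second increases in x and is
  positive at l > x_0. Monotonicity in \<open>m\<close> supplies the sign of the difference
  quotient, so the constant depends on neither h nor m.\<close>

lemma discrete_solution_nondegenerate:
  assumes "q > 0" "q < r" "x_zero q r < l" "m \<noteq> 0" "m \<le> N" "l < y" "y < X m"
  shows "exp (- \<bar>alpha q r\<bar>) * (q * exp l - r) / 2 * (X m - y)\<^sup>2 \<le> U m y - phi q r y"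
proof (rule obstacle_step_nondegenerate[OF beta_pos[OF pos(2)] pos(1) discrete_solution_step[OF assms(4,5)]])
  have x0: "0 < x_zero q r" using assms by (simp add: x_zero_def)
  have X1: "X m \<le> 1" using discrete_solution_step[OF assms(4,5)] by (simp add: obstacle_step_def)
  have "r / q < exp l" using assms(1-3) by (metis divide_pos_pos exp_less_cancel_iff exp_ln pos(2) x_zero_def)
  then have ql: "0 < q * exp l - r" using assms(1) by (simp add: field_simps)
  show "U (m - 1) x \<le> U m x" if "x \<in> \<Omega>" for x using discrete_solution_mono[of "m - 1" x] assms(4,5) that by simp
  show "continuous_on {-1..1} (phi q r)" by (rule phi_continuous)
  show "-1 \<le> l" "y \<in> {l<..<X m}" using assms x0 by auto
  fix x assume x: "x \<in> {l<..<X m}"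
  then have "x \<in> {0<..}" using assms(3) x0 by simp
  then show "(phi q r has_real_derivative phi_ext1 q r x) (at x)"
    by (rule has_field_derivative_transform_within_open[OF phi_ext_derivatives(1) open_greaterThan]) 
      (simp add: phi_eq_phi_ext)
  show "(phi_ext1 q r has_real_derivative phi_ext2 q r x) (at x)" by (rule phi_ext_derivatives)
  have "- \<bar>alpha q r\<bar> \<le> alpha q r * x"
  proof -
    have "\<bar>alpha q r * x\<bar> \<le> \<bar>alpha q r\<bar> * 1"
      unfolding abs_mult using x X1 \<open>x \<in> {0<..}\<close> by (intro mult_left_mono) auto
    then show ?thesis by linarith
  qed
  then have "exp (- \<bar>alpha q r\<bar>) * (q * exp l - r) \<le> exp (alpha q r * x) * (q * exp x - r)"
    using x ql assms(1) by (intro mult_mono) auto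
  also have "\<dots> = beta q r * phi q r x - phi_ext2 q r x"
    using \<open>x \<in> {0<..}\<close> by (simp add: phi_ext_operator phi_eq_phi_ext)
  finally show "exp (- \<bar>alpha q r\<bar>) * (q * exp l - r) \<le> beta q r * phi q r x - phi_ext2 q r x" .
qed

end

subsection \<open>Comparison with the viscosity solution\<close>

lemma C12_on_separable:
  assumes "\<And>s. (a has_real_derivative a' s) (at s)" "continuous_on UNIV a'"
    and B: "\<And>y. y \<in> \<Omega> \<Longrightarrow> (B has_real_derivative B1 y) (at y)"
      "\<And>y. y \<in> \<Omega> \<Longrightarrow> (B1 has_real_derivative B2 y) (at y)" "continuous_on \<Omega> B2"
  shows "C12_on ({0<..<T} \<times> \<Omega>) (\<lambda>p. a (fst p) + B (snd p)) (\<lambda>p. a' (fst p)) (\<lambda>p. B1 (snd p)) (\<lambda>p. B2 (snd p))"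
proof -
  have c: "continuous_on UNIV a" using DERIV_continuous_on_UNIV[OF assms(1)] .
  have cB: "continuous_on \<Omega> B" "continuous_on \<Omega> B1"
    using B(1,2) by (blast intro!: continuous_at_imp_continuous_on DERIV_isCont)+
  have 1: "continuous_on ({0<..<T} \<times> \<Omega>) (\<lambda>p. f (fst p))" if "continuous_on UNIV f" for f :: "real \<Rightarrow> real"
    by (rule continuous_on_compose2[OF that continuous_on_fst[OF continuous_on_id]]) simp
  have 2: "continuous_on ({0<..<T} \<times> \<Omega>) (\<lambda>p. f (snd p))" if "continuous_on \<Omega> f" for f :: "real \<Rightarrow> real"
    by (rule continuous_on_compose2[OF that continuous_on_snd[OF continuous_on_id]]) auto
  have "((\<lambda>s. a (fst (s, x)) + B (snd (s, x))) has_real_derivative a' t) (at t)" for t x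
    using DERIV_add[OF assms(1) DERIV_const] by simp
  moreover have "((\<lambda>y. a (fst (t, y)) + B (snd (t, y))) has_real_derivative B1 x) (at x)" if "x \<in> \<Omega>" for t x
    using DERIV_add[OF DERIV_const B(1)[OF that]] by simp
  ultimately show ?thesis
    unfolding C12_on_def using 1[OF c] 1[OF assms(2)] 2[OF cB(1)] 2[OF cB(2)] 2[OF B(3)] B(2)
    by (auto intro: continuous_on_add)
qed

lemma finite_attains_max:
  fixes f :: "'a \<Rightarrow> real"
  assumes "finite A" "A \<noteq> {}"
  shows "\<exists>m\<in>A. \<forall>k\<in>A. f k \<le> f m"
  using Max_in[of "f ` A"] Max_ge[of "f ` A"] assms by fastforce

lemma attains_max_space_time:
  fixes F :: "nat \<Rightarrow> real \<times> real \<Rightarrow> real"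
  assumes "\<And>m. m \<le> N \<Longrightarrow> continuous_on ({0..T1} \<times> {-1..1}) (F m)" "0 \<le> T1"
  shows "\<exists>m s x. m \<le> N \<and> s \<in> {0..T1} \<and> x \<in> {-1..1} \<and>
    (\<forall>k t y. k \<le> N \<longrightarrow> t \<in> {0..T1} \<longrightarrow> y \<in> {-1..1} \<longrightarrow> F k (t, y) \<le> F m (s, x))"
proof -
  have "\<exists>p\<in>{0..T1} \<times> {-1..1}. \<forall>z\<in>{0..T1} \<times> {-1..1}. F m z \<le> F m p" if "m \<le> N" for m
    using assms that by (intro continuous_attains_sup compact_Times compact_Icc) auto
  then obtain p where p: "\<And>m. m \<le> N \<Longrightarrow> p m \<in> {0..T1} \<times> {-1..1}"
    "\<And>m z. m \<le> N \<Longrightarrow> z \<in> {0..T1} \<times> {-1..1} \<Longrightarrow> F m z \<le> F m (p m)" by metis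
  obtain m where m: "m \<le> N" "\<And>k. k \<le> N \<Longrightarrow> F k (p k) \<le> F m (p m)"
    using finite_attains_max[of "{..N}" "\<lambda>m. F m (p m)"] by auto
  obtain s x where sx: "p m = (s, x)" by fastforce
  have "F k (t, y) \<le> F m (s, x)" if "k \<le> N" "t \<in> {0..T1}" "y \<in> {-1..1}" for k t y
    using p(2)[OF that(1), of "(t, y)"] m(2)[OF that(1)] that sx by auto
  then show ?thesis using m(1) p(1)[OF m(1)] sx by (intro exI[of _ m] exI[of _ s] exI[of _ x]) simp
qed

text \<open>The variables are doubled in time only: in space the discrete solution is regular enough
  to serve as a test function. Maximality in \<open>m\<close>, compared with \<open>m - 1\<close>, turns the time
  derivative of the penalty \<open>(s - m h)\<^sup>2 / (2 \<epsilon>)\<close> into the backward difference quotient,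
  up to an error \<open>h / (2 \<epsilon>)\<close>; \<open>\<kappa>\<close> keeps the maximum away from the final time.\<close>

context
  fixes T q r h :: real and u :: "real \<times> real \<Rightarrow> real"
    and N :: nat and U :: "nat \<Rightarrow> real \<Rightarrow> real" and X :: "nat \<Rightarrow> real"
    and T1 \<epsilon> \<eta> :: real and \<kappa> \<kappa>' :: "real \<Rightarrow> real"
  assumes pos: "h > 0" "r > 0" "\<epsilon> > 0" "\<eta> \<ge> 0" and T1: "0 < T1" "T1 < T"
    and sol: "discrete_solution q r h N U X"
    and cu: "continuous_on ({0..<T} \<times> {-1..1}) u"
    and visc: "viscosity_solution q r ({0<..<T} \<times> \<Omega>) u"
    and u0: "\<And>x. x \<in> {-1..1} \<Longrightarrow> u (0, x) = phi q r x"
    and ub: "\<And>t. t \<in> {0<..<T} \<Longrightarrow> u (t, -1) = phi q r (-1)" "\<And>t. t \<in> {0<..<T} \<Longrightarrow> u (t, 1) = phi q r 1"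
    and u_ge: "\<And>t x. t \<in> {0<..<T} \<Longrightarrow> x \<in> {-1..1} \<Longrightarrow> phi q r x \<le> u (t, x)"
    and \<kappa>: "\<And>s. (\<kappa> has_real_derivative \<kappa>' s) (at s)" "continuous_on UNIV \<kappa>'"
      "\<And>s. 0 \<le> s \<Longrightarrow> 0 \<le> \<kappa> s" "\<And>s. 0 \<le> s \<Longrightarrow> 0 \<le> \<kappa>' s"
begin

lemma penalty_derivative:
  "((\<lambda>s. c * ((s - a)\<^sup>2 / (2 * \<epsilon>) + \<kappa> s)) has_real_derivative c * ((s - a) / \<epsilon> + \<kappa>' s)) (at s)"
  using pos by (auto intro!: derivative_eq_intros \<kappa>(1) simp: field_simps)

lemma penalty_derivative_continuous: "continuous_on UNIV (\<lambda>s. c * ((s - a) / \<epsilon> + \<kappa>' s))"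
  using pos by (intro continuous_intros \<kappa>(2)) auto

lemma continuous_F:
  assumes "m \<le> N"
  shows "continuous_on ({0..T1} \<times> {-1..1})
    (\<lambda>p. c * (u p - U m (snd p)) - 1 * ((fst p - real m * h)\<^sup>2 / (2 * \<epsilon>) + \<kappa> (fst p)))"
proof -
  have "continuous_on ({0..T1} \<times> {-1..1}) u" using cu by (rule continuous_on_subset) (use T1 in auto)
  moreover have "continuous_on ({0..T1} \<times> {-1..1}) (\<lambda>p. U m (snd p))"
    by (rule continuous_on_compose2[OF discrete_solution_continuous[OF pos(1,2) sol assms] continuous_on_snd[OF continuous_on_id]]) auto
  moreover have "continuous_on ({0..T1} \<times> {-1..1}) (\<lambda>p. \<kappa> (fst p))"
    by (rule continuous_on_compose2[OF DERIV_continuous_on_UNIV[OF \<kappa>(1)] continuous_on_fst[OF continuous_on_id]]) simp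
  ultimately show ?thesis using pos by (intro continuous_intros) auto
qed

lemma ex_antiderivatives:
  assumes "m \<noteq> 0" "m \<le> N"
  shows "\<exists>G G1. (\<forall>x\<in>\<Omega>. (G has_real_derivative G1 x) (at x)) \<and>
    (\<forall>x\<in>\<Omega>. (G1 has_real_derivative beta q r * U m x + (U m x - U (m - 1) x) / h) (at x)) \<and>
    continuous_on \<Omega> (\<lambda>x. beta q r * U m x + (U m x - U (m - 1) x) / h) \<and>
    concave_on \<Omega> (\<lambda>x. U m x - G x) \<and> convex_on {-1<..<X m} (\<lambda>x. U m x - G x)"
proof -
  have "continuous_on \<Omega> (U m)" "continuous_on \<Omega> (U (m - 1))"
    by (rule continuous_on_subset[OF discrete_solution_continuous[OF pos(1,2) sol]]; use assms(2) in auto)+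
  then have "continuous_on \<Omega> (\<lambda>x. beta q r * U m x + (U m x - U (m - 1) x) / h)"
    using pos by (intro continuous_intros) auto
  with discrete_solution_step[OF pos(1,2) sol assms] show ?thesis unfolding obstacle_step_def by blast
qed

text \<open>If the bound fails, initial, final and lateral values rule out every maximum point
  except those with m > 0, 0 < s < T1 and x in \<Omega>. There the concave part of
  \<open>U m\<close> lies below a line, so the penalty plus \<open>G\<close> plus an affine function
  touches \<open>u\<close> from above and is an admissible test function.\<close>

lemma viscosity_upper_bound:
  assumes init: "\<And>s x. s \<in> {0..T1} \<Longrightarrow> x \<in> {-1..1} \<Longrightarrow> u (s, x) - phi q r x - s\<^sup>2 / (2 * \<epsilon>) \<le> \<eta>"
    and final: "\<And>m x. m \<le> N \<Longrightarrow> x \<in> {-1..1} \<Longrightarrow> u (T1, x) - U m x \<le> \<kappa> T1"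
    and at: "m0 \<le> N" "s0 \<in> {0..T1}" "x0 \<in> {-1..1}"
  shows "u (s0, x0) - U m0 x0 - ((s0 - real m0 * h)\<^sup>2 / (2 * \<epsilon>) + \<kappa> s0) \<le> max \<eta> (h / (2 * \<epsilon>) / beta q r)"
proof (rule ccontr)
  assume neg: "\<not> ?thesis"
  define F where "F m p = 1 * (u p - U m (snd p)) - 1 * ((fst p - real m * h)\<^sup>2 / (2 * \<epsilon>) + \<kappa> (fst p))" for m p
  have "continuous_on ({0..T1} \<times> {-1..1}) (F m)" if "m \<le> N" for m
    unfolding F_def by (rule continuous_F[OF that])
  then obtain m s x where m: "m \<le> N" and s: "s \<in> {0..T1}" and x: "x \<in> {-1..1}"
    and max: "\<And>k t y. k \<le> N \<Longrightarrow> t \<in> {0..T1} \<Longrightarrow> y \<in> {-1..1} \<Longrightarrow> F k (t, y) \<le> F m (s, x)"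
    using attains_max_space_time[of N T1 F] T1(1) by auto
  have big: "F m (s, x) > \<eta>" "F m (s, x) > h / (2 * \<epsilon>) / beta q r"
    using neg max[OF at] by (simp_all add: F_def)
  have b: "beta q r > 0" by (rule beta_pos[OF pos(2)])
  have pen: "0 \<le> (s - real m * h)\<^sup>2 / (2 * \<epsilon>)" "0 \<le> \<kappa> s" using pos \<kappa>(3) s by auto
  have gap: "u (s, x) - U m x \<ge> F m (s, x)" using pen by (simp add: F_def)
  have gap0: "u (s, x) > U m x" using gap big pos by linarith
  have Um_ge: "phi q r x \<le> U m x" using discrete_solution_ge[OF pos(1,2) sol m x] .
  have m0: "m \<noteq> 0"
  proof
    assume "m = 0"
    then show False using big(1) init[OF s x] discrete_solution_0[OF pos(1,2) sol x] pen by (simp add: F_def)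
  qed
  have "s \<noteq> 0" using gap0 Um_ge u0[OF x] by auto
  moreover have "s \<noteq> T1"
  proof
    assume "s = T1"
    with big(1) pen(1) pos(4) final[OF m x] show False by (simp add: F_def)
  qed
  ultimately have s': "0 < s" "s < T1" "s < T" using s T1 by auto
  have "s \<in> {0<..<T}" using s' by simp
  then have "x \<noteq> -1" "x \<noteq> 1" using gap0 ub[of s] discrete_solution_boundary[OF pos(1,2) sol m] by force+
  then have x': "x \<in> \<Omega>" using x by simp
  obtain G G1 where G: "\<And>x. x \<in> \<Omega> \<Longrightarrow> (G has_real_derivative G1 x) (at x)"
    "\<And>x. x \<in> \<Omega> \<Longrightarrow> (G1 has_real_derivative beta q r * U m x + (U m x - U (m - 1) x) / h) (at x)"
    "continuous_on \<Omega> (\<lambda>x. beta q r * U m x + (U m x - U (m - 1) x) / h)"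
    "concave_on \<Omega> (\<lambda>x. U m x - G x)" "convex_on {-1<..<X m} (\<lambda>x. U m x - G x)"
    using ex_antiderivatives[OF m0 m] by blast
  obtain \<mu> where \<mu>: "\<And>y. y \<in> \<Omega> \<Longrightarrow> - (U m x - G x) + \<mu> * (y - x) \<le> - (U m y - G y)"
    using convex_on_support_line[OF _ x'] G(4) unfolding concave_on_def by blast
  let ?a = "\<lambda>s. 1 * ((s - real m * h)\<^sup>2 / (2 * \<epsilon>) + \<kappa> s)"
  let ?B = "\<lambda>y. G y - \<mu> * (y - x)"
  let ?\<psi> = "\<lambda>p. ?a (fst p) + ?B (snd p)"
  have C12: "C12_on ({0<..<T} \<times> \<Omega>) ?\<psi> (\<lambda>p. 1 * ((fst p - real m * h) / \<epsilon> + \<kappa>' (fst p))) (\<lambda>p. G1 (snd p) - \<mu>)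
      (\<lambda>p. beta q r * U m (snd p) + (U m (snd p) - U (m - 1) (snd p)) / h)"
  proof (rule C12_on_separable[OF penalty_derivative penalty_derivative_continuous _ _ G(3)])
    show "(?B has_real_derivative G1 y - \<mu>) (at y)" if "y \<in> \<Omega>" for y
      by (rule derivative_eq_intros G(1)[OF that] refl | simp)+
    show "((\<lambda>y. G1 y - \<mu>) has_real_derivative beta q r * U m y + (U m y - U (m - 1) y) / h) (at y)"
      if "y \<in> \<Omega>" for y
      using DERIV_diff[OF G(2)[OF that] DERIV_const] by simp
  qed
  have p: "(s, x) \<in> {0<..<T} \<times> \<Omega>" using s' x' by auto
  have "\<forall>\<^sub>F z in nhds (s, x). z \<in> {0<..<T1} \<times> \<Omega>"
    by (rule eventually_nhds_in_open) (use s' x' in \<open>auto intro: open_Times\<close>)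
  then have "\<forall>\<^sub>F z in nhds (s, x). u z - ?\<psi> z \<le> u (s, x) - ?\<psi> (s, x)"
  proof eventually_elim
    case (elim z)
    obtain t y where z: "z = (t, y)" by fastforce
    have ty: "t \<in> {0..T1}" "y \<in> {-1..1}" "y \<in> \<Omega>" using elim z by auto
    from max[OF m ty(1,2)] \<mu>[OF ty(3)] show ?case by (simp add: z F_def)
  qed
  then have "min (1 * ((s - real m * h) / \<epsilon> + \<kappa>' s) - (beta q r * U m x + (U m x - U (m - 1) x) / h)
      + beta q r * u (s, x)) (u (s, x) - phi q r x) \<le> 0"
    using visc[unfolded viscosity_solution_def, rule_format, OF C12 p] by simp
  \<comment> \<open>Since u > U m \<ge> \<phi> at the maximum point, the obstacle alternative in the
    minimum is excluded and the differential inequality remains.\<close>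
  then have "(s - real m * h) / \<epsilon> + \<kappa>' s - (beta q r * U m x + (U m x - U (m - 1) x) / h) + beta q r * u (s, x) \<le> 0"
    using gap0 Um_ge by (simp add: min_le_iff_disj)
  moreover have "(U m x - U (m - 1) x) / h \<le> (s - real m * h) / \<epsilon> + h / (2 * \<epsilon>)"
  proof -
    have "m - 1 \<le> N" using m by simp
    from max[OF this s x] have "(u (s, x) - U (m - 1) x - (u (s, x) - U m x)) - 0 - (s - (real m - 1) * h)\<^sup>2 / (2 * \<epsilon>)
        \<le> - (s - real m * h)\<^sup>2 / (2 * \<epsilon>)"
      using m0 by (simp add: F_def of_nat_diff)
    then have "U m x - U (m - 1) x \<le> ((s - (real m - 1) * h)\<^sup>2 - (s - real m * h)\<^sup>2) / (2 * \<epsilon>)"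
      by (simp add: diff_divide_distrib)
    also have "(s - (real m - 1) * h)\<^sup>2 - (s - real m * h)\<^sup>2 = h * (2 * (s - real m * h) + h)"
      by (simp add: algebra_simps power2_eq_square)
    also have "h * (2 * (s - real m * h) + h) / (2 * \<epsilon>) = h * ((s - real m * h) / \<epsilon> + h / (2 * \<epsilon>))"
      using pos by (simp add: field_simps)
    finally show ?thesis using pos by (simp add: pos_divide_le_eq mult.commute)
  qed
  moreover have "0 \<le> \<kappa>' s" using \<kappa>(4) s by simp
  \<comment> \<open>The terms (s - m h) / \<epsilon> from the penalty and from the difference
    quotient cancel; only the quadratic remainder h / (2 \<epsilon>) survives.\<close>
  ultimately have "beta q r * (u (s, x) - U m x) \<le> h / (2 * \<epsilon>)"
    by (simp add: algebra_simps)
  then have "u (s, x) - U m x \<le> h / (2 * \<epsilon>) / beta q r"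
    by (subst pos_le_divide_eq[OF b]) (simp add: mult.commute)
  then show False using gap big(2) by linarith
qed

text \<open>The mirror image, with one asymmetry: the minimiser can be touched from below only left
  of its contact point. At a positive maximum U m > u \<ge> \<phi>, so the point lies there, and the
  touching is tested on a neighbourhood left of \<open>X m\<close>. The same strict inequality
  excludes m = 0 and the lateral boundary.\<close>

lemma viscosity_lower_bound:
  assumes init: "\<And>m x. m \<le> N \<Longrightarrow> x \<in> {-1..1} \<Longrightarrow> U m x - phi q r x - (real m * h)\<^sup>2 / (2 * \<epsilon>) \<le> \<eta>"
    and final: "\<And>m x. m \<le> N \<Longrightarrow> x \<in> {-1..1} \<Longrightarrow> U m x - u (T1, x) \<le> \<kappa> T1"
    and at: "m0 \<le> N" "s0 \<in> {0..T1}" "x0 \<in> {-1..1}"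
  shows "U m0 x0 - u (s0, x0) - ((s0 - real m0 * h)\<^sup>2 / (2 * \<epsilon>) + \<kappa> s0) \<le> max \<eta> (h / (2 * \<epsilon>) / beta q r)"
proof (rule ccontr)
  assume neg: "\<not> ?thesis"
  define F where "F m p = -1 * (u p - U m (snd p)) - 1 * ((fst p - real m * h)\<^sup>2 / (2 * \<epsilon>) + \<kappa> (fst p))" for m p
  have "continuous_on ({0..T1} \<times> {-1..1}) (F m)" if "m \<le> N" for m
    unfolding F_def by (rule continuous_F[OF that])
  then obtain m s x where m: "m \<le> N" and s: "s \<in> {0..T1}" and x: "x \<in> {-1..1}"
    and max: "\<And>k t y. k \<le> N \<Longrightarrow> t \<in> {0..T1} \<Longrightarrow> y \<in> {-1..1} \<Longrightarrow> F k (t, y) \<le> F m (s, x)"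
    using attains_max_space_time[of N T1 F] T1(1) by auto
  have big: "F m (s, x) > \<eta>" "F m (s, x) > h / (2 * \<epsilon>) / beta q r"
    using neg max[OF at] by (simp_all add: F_def)
  have b: "beta q r > 0" by (rule beta_pos[OF pos(2)])
  have pen: "0 \<le> (s - real m * h)\<^sup>2 / (2 * \<epsilon>)" "0 \<le> \<kappa> s" using pos \<kappa>(3) s by auto
  have gap: "U m x - u (s, x) \<ge> F m (s, x)" using pen by (simp add: F_def)
  have gap0: "u (s, x) < U m x" using gap big pos by linarith
  have "s \<noteq> 0"
  proof
    assume "s = 0"
    then show False using big(1) init[OF m x] u0[OF x] pen by (simp add: F_def)
  qed
  moreover have "s \<noteq> T1"
  proof
    assume "s = T1"
    with big(1) pen(1) pos(4) final[OF m x] show False by (simp add: F_def)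
  qed
  ultimately have s': "0 < s" "s < T1" "s < T" using s T1 by auto
  then have ge: "phi q r x \<le> u (s, x)" using u_ge[of s x] x by simp
  have m0: "m \<noteq> 0"
  proof
    assume "m = 0"
    then show False using gap0 ge discrete_solution_0[OF pos(1,2) sol x] by simp
  qed
  have step: "obstacle_step (beta q r) h (phi q r) (U (m - 1)) (U m) (X m)" by (rule discrete_solution_step[OF pos(1,2) sol m0 m])
  have x': "x \<in> {-1<..<X m}" using obstacle_step_less[OF step x] gap0 ge by simp
  have sub: "{-1<..<X m} \<subseteq> \<Omega>" using step by (auto simp: obstacle_step_def)
  obtain G G1 where G: "\<And>x. x \<in> \<Omega> \<Longrightarrow> (G has_real_derivative G1 x) (at x)"
    "\<And>x. x \<in> \<Omega> \<Longrightarrow> (G1 has_real_derivative beta q r * U m x + (U m x - U (m - 1) x) / h) (at x)"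
    "continuous_on \<Omega> (\<lambda>x. beta q r * U m x + (U m x - U (m - 1) x) / h)"
    "concave_on \<Omega> (\<lambda>x. U m x - G x)" "convex_on {-1<..<X m} (\<lambda>x. U m x - G x)"
    using ex_antiderivatives[OF m0 m] by blast
  obtain \<mu> where \<mu>: "\<And>y. y \<in> {-1<..<X m} \<Longrightarrow> (U m x - G x) + \<mu> * (y - x) \<le> U m y - G y"
    using convex_on_support_line[OF G(5) x'] by blast
  let ?a = "\<lambda>s. -1 * ((s - real m * h)\<^sup>2 / (2 * \<epsilon>) + \<kappa> s)"
  let ?B = "\<lambda>y. G y + \<mu> * (y - x)"
  let ?\<psi> = "\<lambda>p. ?a (fst p) + ?B (snd p)"
  have C12: "C12_on ({0<..<T} \<times> \<Omega>) ?\<psi> (\<lambda>p. -1 * ((fst p - real m * h) / \<epsilon> + \<kappa>' (fst p))) (\<lambda>p. G1 (snd p) + \<mu>)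
      (\<lambda>p. beta q r * U m (snd p) + (U m (snd p) - U (m - 1) (snd p)) / h)"
  proof (rule C12_on_separable[OF penalty_derivative penalty_derivative_continuous _ _ G(3)])
    show "(?B has_real_derivative G1 y + \<mu>) (at y)" if "y \<in> \<Omega>" for y
      by (rule derivative_eq_intros G(1)[OF that] refl | simp)+
    show "((\<lambda>y. G1 y + \<mu>) has_real_derivative beta q r * U m y + (U m y - U (m - 1) y) / h) (at y)"
      if "y \<in> \<Omega>" for y
      using DERIV_add[OF G(2)[OF that] DERIV_const] by simp
  qed
  have p: "(s, x) \<in> {0<..<T} \<times> \<Omega>" using s' x' sub by auto
  have "\<forall>\<^sub>F z in nhds (s, x). z \<in> {0<..<T1} \<times> {-1<..<X m}"
    by (rule eventually_nhds_in_open) (use s' x' in \<open>auto intro: open_Times\<close>)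
  then have "\<forall>\<^sub>F z in nhds (s, x). u z - ?\<psi> z \<ge> u (s, x) - ?\<psi> (s, x)"
  proof eventually_elim
    case (elim z)
    obtain t y where z: "z = (t, y)" by fastforce
    have y: "y \<in> {-1<..<X m}" using elim z by auto
    then have ty: "t \<in> {0..T1}" "y \<in> {-1..1}" using elim z subsetD[OF sub y] by auto
    from max[OF m ty] \<mu>[OF y] show ?case by (simp add: z F_def)
  qed
  then have "min (-1 * ((s - real m * h) / \<epsilon> + \<kappa>' s) - (beta q r * U m x + (U m x - U (m - 1) x) / h)
      + beta q r * u (s, x)) (u (s, x) - phi q r x) \<ge> 0"
    using visc[unfolded viscosity_solution_def, rule_format, OF C12 p] by simp
  then have "0 \<le> - ((s - real m * h) / \<epsilon>) - \<kappa>' s - (beta q r * U m x + (U m x - U (m - 1) x) / h) + beta q r * u (s, x)"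
    by simp
  moreover have "- ((s - real m * h) / \<epsilon>) - h / (2 * \<epsilon>) \<le> (U m x - U (m - 1) x) / h"
  proof -
    have "m - 1 \<le> N" using m by simp
    from max[OF this s x] have "((s - real m * h)\<^sup>2 - (s - (real m - 1) * h)\<^sup>2) / (2 * \<epsilon>) \<le> U m x - U (m - 1) x"
      using m0 by (simp add: F_def of_nat_diff diff_divide_distrib)
    moreover have "(s - real m * h)\<^sup>2 - (s - (real m - 1) * h)\<^sup>2 = h * (- 2 * (s - real m * h) - h)"
      by (simp add: algebra_simps power2_eq_square)
    moreover have "h * (- 2 * (s - real m * h) - h) / (2 * \<epsilon>) = h * (- ((s - real m * h) / \<epsilon>) - h / (2 * \<epsilon>))"
      using pos by (simp add: field_simps)
    ultimately show ?thesis using pos by (simp add: pos_le_divide_eq mult.commute)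
  qed
  moreover have "0 \<le> \<kappa>' s" using \<kappa>(4) s by simp
  ultimately have "beta q r * (U m x - u (s, x)) \<le> h / (2 * \<epsilon>)"
    by (simp add: algebra_simps)
  then have "U m x - u (s, x) \<le> h / (2 * \<epsilon>) / beta q r"
    by (subst pos_le_divide_eq[OF b]) (simp add: mult.commute)
  then show False using gap big(2) by linarith
qed

end

subsection \<open>Convergence of the free boundaries\<close>

text \<open>The two one-sided bounds are evaluated at s = m h, where the time penalty vanishes. What
  remains is the maximum of \<eta>/3 and h / (2 \<epsilon> \<beta>), plus \<kappa>(m h), and each of
  these is made at most \<eta>/3. The behaviour near time 0 fixes \<epsilon> independently of h;
  only then is h made small against it.\<close>

lemma uniform_convergence:
  assumes "0 < q" "q < r" and T0: "0 \<le> T0" "T0 < T" and "\<eta> > 0"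
    and u: "obstacle_solution T q r u"
    and u_ge: "\<And>t x. t \<in> {0<..<T} \<Longrightarrow> x \<in> {-1..1} \<Longrightarrow> phi q r x \<le> u (t, x)"
    and U: "\<And>h. 0 < h \<Longrightarrow> h < h1 \<Longrightarrow> discrete_solution q r h (nat \<lfloor>T / h\<rfloor>) (U h) (X h)" and "h1 > 0"
  shows "\<exists>h0>0. \<forall>h m x. 0 < h \<longrightarrow> h < h0 \<longrightarrow> m \<le> nat \<lfloor>T / h\<rfloor> \<longrightarrow> real m * h \<le> T0 \<longrightarrow> x \<in> {-1..1} \<longrightarrow>
    \<bar>U h m x - u (real m * h, x)\<bar> < \<eta>"
proof -
  have r: "r > 0" using assms by linarith
  define b where "b = beta q r"
  have b: "b > 0" using beta_pos[OF r] by (simp add: b_def)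
  have cu: "continuous_on ({0..<T} \<times> {-1..1}) u" and visc: "viscosity_solution q r ({0<..<T} \<times> \<Omega>) u"
    and u0: "\<And>x. x \<in> {-1..1} \<Longrightarrow> u (0, x) = phi q r x"
    and ub: "\<And>t. t \<in> {0<..<T} \<Longrightarrow> u (t, -1) = phi q r (-1)" "\<And>t. t \<in> {0<..<T} \<Longrightarrow> u (t, 1) = phi q r 1"
    using u unfolding obstacle_solution_def by blast+
  define T1 where "T1 = (T0 + T) / 2"
  have T1: "0 < T1" "T1 < T" "T0 < T1" using T0 by (auto simp: T1_def)
  have comp: "compact ({0..T1} \<times> {-1..1::real})" by (intro compact_Times compact_Icc)
  have cu1: "continuous_on ({0..T1} \<times> {-1..1}) u" using cu by (rule continuous_on_subset) (use T1 in auto)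
  obtain Mu where Mu: "\<forall>p\<in>{0..T1} \<times> {-1..1}. \<bar>u p\<bar> \<le> Mu"
    using compact_imp_bounded[OF compact_continuous_image[OF cu1 comp]] by (auto simp: bounded_iff)
  obtain P where P: "\<forall>x\<in>{-1..1}. \<bar>phi q r x\<bar> \<le> P"
    using continuous_on_Icc_bounded[OF phi_continuous] by blast
  obtain L where L: "L > 0" "\<And>x y. x \<in> {-1..1} \<Longrightarrow> y \<in> {-1..1} \<Longrightarrow> \<bar>phi q r x - phi q r y\<bar> \<le> L * \<bar>x - y\<bar>"
    using phi_Lipschitz by blast
  \<comment> \<open>A bound for |u - U h k| that holds for all h, from the discrete modulus with
    parameter 1 and k h \<le> T. It is needed at the artificial final time T1, where no better
    estimate is available.\<close>
  define M where "M = \<bar>Mu\<bar> + \<bar>P\<bar> + 2 + L\<^sup>2 / 2 * T"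
  have "0 \<le> L\<^sup>2 / 2 * T" using T0 by simp
  then have M: "M > 0" "M \<ge> Mu" unfolding M_def by linarith+
  \<comment> \<open>A high power of s / T1, scaled to equal \<open>M\<close> at T1, is still at most
    \<eta>/3 up to T0 < T1.\<close>
  obtain n where n: "(T0 / T1) ^ n < \<eta> / (3 * M)"
    using real_arch_pow_inv[of "\<eta> / (3 * M)" "T0 / T1"] T1 T0 M assms(5) by auto
  define \<kappa> where "\<kappa> s = M * (s / T1) ^ Suc n" for s
  define \<kappa>' where "\<kappa>' s = M * (real (Suc n) * (s / T1) ^ n * (1 / T1))" for s
  have \<kappa>: "(\<kappa> has_real_derivative \<kappa>' s) (at s)" for s
    unfolding \<kappa>_def \<kappa>'_def
    by (rule derivative_eq_intros refl | use T1 in simp)+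
  have \<kappa>c: "continuous_on UNIV \<kappa>'" unfolding \<kappa>'_def by (intro continuous_intros) (use T1 in auto)
  have \<kappa>0: "0 \<le> \<kappa> s" "0 \<le> \<kappa>' s" if "0 \<le> s" for s
    using that M T1 by (simp_all add: \<kappa>_def \<kappa>'_def)
  have \<kappa>T1: "\<kappa> T1 = M" using T1 by (simp add: \<kappa>_def)
  have \<kappa>T0: "\<kappa> s \<le> \<eta> / 3" if "0 \<le> s" "s \<le> T0" for s
  proof -
    have "(s / T1) ^ Suc n \<le> (T0 / T1) ^ Suc n"
      using that T1 by (intro power_mono divide_right_mono) auto
    also have "\<dots> \<le> (T0 / T1) ^ n" using T1 T0 by (intro power_decreasing) auto
    finally have "\<kappa> s \<le> M * (T0 / T1) ^ n" unfolding \<kappa>_def using M by (intro mult_left_mono) auto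
    also have "\<dots> \<le> M * (\<eta> / (3 * M))" using n M by (intro mult_left_mono) auto
    also have "\<dots> = \<eta> / 3" using M by simp
    finally show ?thesis .
  qed
  have "uniformly_continuous_on ({0..T1} \<times> {-1..1}) u"
    by (rule compact_uniformly_continuous[OF cu1 comp])
  then obtain \<delta> where \<delta>: "\<delta> > 0" "\<And>p p'. p \<in> {0..T1} \<times> {-1..1} \<Longrightarrow> p' \<in> {0..T1} \<times> {-1..1} \<Longrightarrow>
      dist p' p < \<delta> \<Longrightarrow> dist (u p') (u p) < \<eta> / 3"
    using assms(5) unfolding uniformly_continuous_on_def by (metis divide_pos_pos zero_less_numeral)
  \<comment> \<open>The rate L^2 / (2 \<zeta>) of the discrete modulus for \<zeta> = \<eta>/6. The
    maximum of c t - t^2 / (2 \<epsilon>) over t is c^2 \<epsilon> / 2, which the second bound on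
    \<epsilon> makes at most \<eta>/6. The first bound makes the penalty exceed \<open>u\<close> at
    times s \<ge> \<delta>; before \<delta> uniform continuity suffices.\<close>
  define c where "c = 3 * L\<^sup>2 / \<eta>"
  have c: "c > 0" using L(1) assms(5) by (simp add: c_def)
  define \<epsilon> where "\<epsilon> = min (\<delta>\<^sup>2 / (2 * (\<bar>Mu\<bar> + 1))) (\<eta> / (3 * c\<^sup>2))"
  have \<epsilon>: "\<epsilon> > 0" "\<epsilon> \<le> \<delta>\<^sup>2 / (2 * (\<bar>Mu\<bar> + 1))" "\<epsilon> \<le> \<eta> / (3 * c\<^sup>2)"
    using \<delta>(1) c assms(5) by (auto simp: \<epsilon>_def)
  have init1: "u (s, x) - phi q r x - s\<^sup>2 / (2 * \<epsilon>) \<le> \<eta> / 3" if sx: "s \<in> {0..T1}" "x \<in> {-1..1}" for s x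
  proof (cases "s < \<delta>")
    case True
    have "dist (u (s, x)) (u (0, x)) < \<eta> / 3"
      by (rule \<delta>(2)) (use sx True T1 in \<open>auto simp: dist_Pair_Pair dist_real_def\<close>)
    then have "u (s, x) - phi q r x \<le> \<eta> / 3" unfolding dist_real_def u0[OF sx(2)] by linarith
    moreover have "0 \<le> s\<^sup>2 / (2 * \<epsilon>)" using \<epsilon> by simp
    ultimately show ?thesis by linarith
  next
    case False
    have "u (s, x) \<le> \<bar>Mu\<bar> + 1" using bspec[OF Mu, of "(s, x)"] sx by simp
    also have "\<dots> \<le> \<delta>\<^sup>2 / (2 * \<epsilon>)" using \<epsilon> by (simp add: field_simps)
    also have "\<dots> \<le> s\<^sup>2 / (2 * \<epsilon>)"
      using False \<delta>(1) \<epsilon>(1) by (intro divide_right_mono power_mono) auto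
    finally show ?thesis using phi_nonneg[of q r x] assms(5) by linarith
  qed
  define h0 where "h0 = min h1 (2 * \<epsilon> * b * (\<eta> / 3))"
  have "h0 > 0" using assms(5,9) b \<epsilon> by (simp add: h0_def)
  moreover have "\<bar>U h m x - u (real m * h, x)\<bar> < \<eta>"
    if h: "0 < h" "h < h0" and m: "m \<le> nat \<lfloor>T / h\<rfloor>" "real m * h \<le> T0" and x: "x \<in> {-1..1}" for h m x
  proof -
    let ?N = "nat \<lfloor>T / h\<rfloor>"
    have sol: "discrete_solution q r h ?N (U h) (X h)" by (rule U) (use h in \<open>auto simp: h0_def\<close>)
    have herr: "h / (2 * \<epsilon>) / beta q r \<le> \<eta> / 3"
      using h(2) b \<epsilon>(1) by (simp add: h0_def b_def[symmetric] field_simps)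
    have kh: "real k * h \<le> T" "0 \<le> real k * h" if "k \<le> ?N" for k
    proof -
      have "real k \<le> T / h" using that h(1) T0 by (simp add: le_nat_iff le_floor_iff)
      then show "real k * h \<le> T" using h(1) by (simp add: field_simps)
    qed (use h in auto)
    have upper: "U h k y \<le> phi q r y + \<zeta> + L\<^sup>2 / (2 * \<zeta>) * (real k * h)"
      if "\<zeta> > 0" "k \<le> ?N" "y \<in> {-1..1}" for k y \<zeta>
      by (rule discrete_solution_modulus[OF h(1) r sol L(2) that])
    have U0: "0 \<le> U h k y" if "k \<le> ?N" "y \<in> {-1..1}" for k y
      using discrete_solution_ge[OF h(1) r sol that] phi_nonneg[of q r y] by linarith
    have UM: "U h k y + \<bar>Mu\<bar> \<le> M" if "k \<le> ?N" "y \<in> {-1..1}" for k y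
    proof -
      have "L\<^sup>2 / (2 * 1) * (real k * h) \<le> L\<^sup>2 / 2 * T"
        using kh[OF that(1)] by (intro mult_mono) auto
      moreover have "phi q r y \<le> \<bar>P\<bar>" using P that(2) by fastforce
      ultimately show ?thesis using upper[of 1, OF _ that] by (simp add: M_def)
    qed
    have uT1: "\<bar>u (T1, y)\<bar> \<le> \<bar>Mu\<bar>" if "y \<in> {-1..1}" for y
    proof -
      have "(T1, y) \<in> {0..T1} \<times> {-1..1}" using that T1 by simp
      from bspec[OF Mu this] show ?thesis by linarith
    qed
    have init2: "U h k y - phi q r y - (real k * h)\<^sup>2 / (2 * \<epsilon>) \<le> \<eta> / 3" if "k \<le> ?N" "y \<in> {-1..1}" for k y
    proof -
      let ?t = "real k * h"
      have "c = L\<^sup>2 / (2 * (\<eta> / 6))" using assms(5) by (simp add: c_def field_simps)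
      then have "U h k y \<le> phi q r y + \<eta> / 6 + c * ?t"
        using upper[of "\<eta> / 6", OF _ that] assms(5) by simp
      moreover have "c * ?t - ?t\<^sup>2 / (2 * \<epsilon>) \<le> c\<^sup>2 * \<epsilon> / 2"
      proof -
        have "0 \<le> (?t - c * \<epsilon>)\<^sup>2 / (2 * \<epsilon>)" using \<epsilon>(1) by simp
        also have "\<dots> = ?t\<^sup>2 / (2 * \<epsilon>) - c * ?t + c\<^sup>2 * \<epsilon> / 2"
          using \<epsilon>(1) by (simp add: power2_diff field_simps power2_eq_square)
        finally show ?thesis by linarith
      qed
      moreover have "c\<^sup>2 * \<epsilon> / 2 \<le> \<eta> / 6"
        using \<epsilon>(3) c by (simp add: field_simps)
      ultimately show ?thesis by linarith
    qed
    have s0: "real m * h \<in> {0..T1}" using kh[OF m(1)] m(2) T1 by simp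
    have max: "max (\<eta> / 3) (h / (2 * \<epsilon>) / beta q r) = \<eta> / 3" using herr by (simp add: max_def)
    have \<eta>3: "0 \<le> \<eta> / 3" using assms(5) by simp
    have "u (real m * h, x) - U h m x - ((real m * h - real m * h)\<^sup>2 / (2 * \<epsilon>) + \<kappa> (real m * h))
        \<le> max (\<eta> / 3) (h / (2 * \<epsilon>) / beta q r)"
    proof (rule viscosity_upper_bound[OF h(1) r \<epsilon>(1) \<eta>3 T1(1,2) sol cu visc u0 ub u_ge \<kappa> \<kappa>c \<kappa>0 init1 _ m(1) s0 x])
      show "u (T1, y) - U h k y \<le> \<kappa> T1" if "k \<le> ?N" "y \<in> {-1..1}" for k y
        using uT1[OF that(2)] U0[OF that] UM[OF that] \<kappa>T1 by linarith
    qed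
    then have 1: "u (real m * h, x) - U h m x \<le> \<eta> / 3 + \<kappa> (real m * h)" using max by simp
    have "U h m x - u (real m * h, x) - ((real m * h - real m * h)\<^sup>2 / (2 * \<epsilon>) + \<kappa> (real m * h))
        \<le> max (\<eta> / 3) (h / (2 * \<epsilon>) / beta q r)"
    proof (rule viscosity_lower_bound[OF h(1) r \<epsilon>(1) \<eta>3 T1(1,2) sol cu visc u0 ub u_ge \<kappa> \<kappa>c \<kappa>0 init2 _ m(1) s0 x])
      show "U h k y - u (T1, y) \<le> \<kappa> T1" if "k \<le> ?N" "y \<in> {-1..1}" for k y
        using uT1[OF that(2)] UM[OF that] \<kappa>T1 by linarith
    qed
    then have 2: "U h m x - u (real m * h, x) \<le> \<eta> / 3 + \<kappa> (real m * h)" using max by simp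
    show ?thesis using 1 2 \<kappa>T0[of "real m * h"] m(2) s0 assms(5) by auto
  qed
  ultimately show ?thesis by blast
qed

text \<open>If contact began left of x_0, then at some x between max s 0 and x_0 the smooth function
  \<open>phi_ext\<close>, which lies below \<open>u\<close>, would touch it. The supersolution
  inequality would give q e^x \<ge> r, that is x \<ge> x_0. Staying right of 0 ensures that obstacle
  and smooth extension agree at x.\<close>

lemma x_zero_le_contact_point:
  assumes "0 < q" "q < r" "r < q * exp 1" and t: "t \<in> {0<..<T}"
    and visc: "viscosity_solution q r ({0<..<T} \<times> \<Omega>) u"
    and u_ge: "\<And>t x. t \<in> {0<..<T} \<Longrightarrow> x \<in> {-1..1} \<Longrightarrow> phi q r x \<le> u (t, x)"
    and s: "contact_point q r (\<lambda>x. u (t, x)) s"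
  shows "x_zero q r \<le> s"
proof (rule ccontr)
  assume "\<not> x_zero q r \<le> s"
  have x0: "0 < x_zero q r" using assms by (simp add: x_zero_def)
  have "x_zero q r < 1"
  proof -
    have "r / q < exp 1" using assms by (simp add: field_simps)
    then have "ln (r / q) < ln (exp 1)" using assms by (subst ln_less_cancel_iff) auto
    then show ?thesis by (simp add: x_zero_def)
  qed
  obtain x where x: "max s 0 < x" "x < x_zero q r"
    using dense[of "max s 0" "x_zero q r"] x0 \<open>\<not> _\<close> by auto
  then have x\<Omega>: "x \<in> \<Omega>" "x \<in> {s..1}" "0 \<le> x" using \<open>x_zero q r < 1\<close> by auto
  have ux: "u (t, x) = phi_ext q r x" "u (t, x) = phi q r x"
    using s x\<Omega> phi_eq_phi_ext[OF x\<Omega>(3)] by (auto simp: contact_point_def)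
  let ?\<psi> = "\<lambda>p :: real \<times> real. 0 + phi_ext q r (snd p)"
  have C12: "C12_on ({0<..<T} \<times> \<Omega>) ?\<psi> (\<lambda>p. 0) (\<lambda>p. phi_ext1 q r (snd p)) (\<lambda>p. phi_ext2 q r (snd p))"
  proof (rule C12_on_separable[where a = "\<lambda>_. 0" and a' = "\<lambda>_. 0"])
    show "continuous_on \<Omega> (phi_ext2 q r)" unfolding phi_ext2_def by (intro continuous_intros)
  qed (simp_all add: phi_ext_derivatives)
  have p: "(t, x) \<in> {0<..<T} \<times> \<Omega>" using t x\<Omega> by auto
  have "\<forall>\<^sub>F z in nhds (t, x). z \<in> {0<..<T} \<times> \<Omega>"
    by (rule eventually_nhds_in_open[OF _ p]) (auto intro: open_Times)
  then have "\<forall>\<^sub>F z in nhds (t, x). u z - ?\<psi> z \<ge> u (t, x) - ?\<psi> (t, x)"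
  proof eventually_elim
    case (elim z)
    obtain t' y where z: "z = (t', y)" by fastforce
    then have "phi q r y \<le> u (t', y)" using elim by (intro u_ge) auto
    then show ?case using phi_ext_le_phi[of q r y] ux(1) z by simp
  qed
  then have "min (0 - phi_ext2 q r x + beta q r * u (t, x)) (u (t, x) - phi q r x) \<ge> 0"
    using visc[unfolded viscosity_solution_def, rule_format, OF C12 p] by simp
  then have "0 \<le> beta q r * phi_ext q r x - phi_ext2 q r x" using ux(1) by simp
  then have "0 \<le> exp (alpha q r * x) * (q * exp x - r)" by (simp only: phi_ext_operator)
  then have "r / q \<le> exp x" using assms(1) by (simp add: zero_le_mult_iff field_simps)
  then have "ln (r / q) \<le> ln (exp x)" using assms by (subst ln_le_cancel_iff) auto
  then show False using x by (simp add: x_zero_def)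
qed

text \<open>In \<open>ennreal\<close> the supremum always exists and is 0 over an empty set, so
  neither boundedness nor nonemptiness of \<open>A\<close> has to be established.\<close>

lemma ennreal_SUP_tendsto_0:
  fixes f :: "real \<Rightarrow> real \<Rightarrow> real"
  assumes "\<And>e. e > 0 \<Longrightarrow> \<forall>\<^sub>F h in F. \<forall>t\<in>A. \<bar>f h t\<bar> < e"
  shows "((\<lambda>h. SUP t\<in>A. ennreal \<bar>f h t\<bar>) \<longlongrightarrow> 0) F"
proof (rule order_tendstoI)
  fix a :: ennreal assume "0 < a"
  then obtain z where z: "0 < z" "z < a" using dense by blast
  then obtain e where e: "z = ennreal e" "0 \<le> e"
    by (cases z) auto
  then have "e > 0" using z(1) by auto
  from assms[OF this] show "\<forall>\<^sub>F h in F. (SUP t\<in>A. ennreal \<bar>f h t\<bar>) < a"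
  proof eventually_elim
    case (elim h)
    have "(SUP t\<in>A. ennreal \<bar>f h t\<bar>) \<le> z"
      unfolding e(1) using elim by (intro SUP_least ennreal_leI) (auto intro: less_imp_le)
    then show ?case using z(2) by simp
  qed
qed simp

text \<open>The hypothesis contains the continuity of \<open>g\<close>: for \<open>s\<close> near \<open>t\<close> both \<open>g s\<close> and \<open>g t\<close> are close to \<open>f h s\<close> for small \<open>h\<close>.\<close>

lemma uniform_of_local_convergence:
  fixes f :: "real \<Rightarrow> real \<Rightarrow> real" and g :: "real \<Rightarrow> real"
  assumes loc: "\<And>t e. t \<in> S \<Longrightarrow> e > 0 \<Longrightarrow>
      \<exists>d>0. \<forall>s h. s \<in> S \<longrightarrow> \<bar>s - t\<bar> < d \<longrightarrow> 0 < h \<longrightarrow> h < d \<longrightarrow> \<bar>f h s - g t\<bar> < e"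
    and A: "compact A" "A \<subseteq> S" and "e > 0"
  shows "\<forall>\<^sub>F h in at_right 0. \<forall>s\<in>A. \<bar>f h s - g s\<bar> < e"
proof -
  have "\<exists>d>0. \<forall>s h. s \<in> S \<longrightarrow> \<bar>s - t\<bar> < d \<longrightarrow> 0 < h \<longrightarrow> h < d \<longrightarrow> \<bar>f h s - g s\<bar> < e" if t: "t \<in> S" for t
  proof -
    obtain d where d: "d > 0" "\<And>s h. s \<in> S \<Longrightarrow> \<bar>s - t\<bar> < d \<Longrightarrow> 0 < h \<Longrightarrow> h < d \<Longrightarrow> \<bar>f h s - g t\<bar> < e / 4"
      using loc[OF t, of "e / 4"] \<open>e > 0\<close> by auto
    have "\<bar>f h s - g s\<bar> < e" if s: "s \<in> S" "\<bar>s - t\<bar> < d" and h: "0 < h" "h < d" for s h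
    proof -
      obtain d' where d': "d' > 0" "\<And>s' h. s' \<in> S \<Longrightarrow> \<bar>s' - s\<bar> < d' \<Longrightarrow> 0 < h \<Longrightarrow> h < d' \<Longrightarrow> \<bar>f h s' - g s\<bar> < e / 4"
        using loc[OF s(1), of "e / 4"] \<open>e > 0\<close> by auto
      define k where "k = min d d' / 2"
      have k: "0 < k" "k < d" "k < d'" using d(1) d'(1) by (auto simp: k_def)
      have "\<bar>f k s - g s\<bar> < e / 4" using d'(2)[OF s(1) _ k(1,3)] d'(1) by simp
      moreover have "\<bar>f k s - g t\<bar> < e / 4" by (rule d(2)[OF s k(1,2)])
      moreover have "\<bar>f h s - g t\<bar> < e / 4" by (rule d(2)[OF s h])
      ultimately show ?thesis using \<open>e > 0\<close> by linarith
    qed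
    with d(1) show ?thesis by blast
  qed
  then obtain d where d: "\<And>t. t \<in> S \<Longrightarrow> d t > 0"
    "\<And>t s h. t \<in> S \<Longrightarrow> s \<in> S \<Longrightarrow> \<bar>s - t\<bar> < d t \<Longrightarrow> 0 < h \<Longrightarrow> h < d t \<Longrightarrow> \<bar>f h s - g s\<bar> < e"
    by metis
  have "A \<subseteq> (\<Union>t\<in>A. ball t (d t))" using d(1) A(2) by (fastforce simp: subset_iff)
  then obtain C where C: "C \<subseteq> A" "finite C" "A \<subseteq> (\<Union>t\<in>C. ball t (d t))"
    using compactE_image[OF A(1), of A "\<lambda>t. ball t (d t)"] by auto
  have "\<forall>\<^sub>F h in at_right 0. \<forall>t\<in>C. h < d t"
  proof (subst eventually_ball_finite_distrib[OF C(2)], intro ballI)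
    fix t assume "t \<in> C"
    then have "0 < d t" using d(1) C(1) A(2) by auto
    then show "\<forall>\<^sub>F h in at_right 0. h < d t" by (auto simp: eventually_at_right_field)
  qed
  moreover have "\<forall>\<^sub>F h in at_right (0::real). 0 < h" by (simp add: eventually_at_filter)
  ultimately show ?thesis
  proof eventually_elim
    case (elim h)
    show ?case
    proof
      fix s assume s: "s \<in> A"
      then obtain t where t: "t \<in> C" "s \<in> ball t (d t)" using C(3) by auto
      then show "\<bar>f h s - g s\<bar> < e"
        using elim s C(1) A(2) by (intro d(2)[of t]) (auto simp: dist_real_def)
    qed
  qed
qed

theorem theorem2p2:
  fixes T q r \<delta> :: real
    and u :: "real \<times> real \<Rightarrow> real" and xs :: "real \<Rightarrow> real"
    and U :: "real \<Rightarrow> nat \<Rightarrow> real \<Rightarrow> real" and X :: "real \<Rightarrow> nat \<Rightarrow> real"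
  assumes "T > 0" and "q > 0" and "r > 0"
    and "q < r" and "r < q * exp 1"
    and "obstacle_solution T q r u"
    and "free_boundary T q r u xs"
    and "closure (xs ` {0<..<T}) \<subseteq> \<Omega>"
    and "\<And>h. h > 0 \<Longrightarrow> scheme T q r h (U h)"
    and "\<forall>\<^sub>F h in at_right 0. discrete_boundary T q r h (U h) (X h)"
    and "\<delta> > 0"
  shows "((\<lambda>h. SUP t\<in>{0..T - \<delta>}. ennreal \<bar>interpolation h (X h) t - xs t\<bar>) \<longlongrightarrow> 0) (at_right 0)"
proof -
  have cu: "continuous_on ({0..<T} \<times> {-1..1}) u" and visc: "viscosity_solution q r ({0<..<T} \<times> \<Omega>) u"
    and u0: "\<And>x. x \<in> {-1..1} \<Longrightarrow> u (0, x) = phi q r x"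
    and ub: "\<And>t. t \<in> {0<..<T} \<Longrightarrow> u (t, -1) = phi q r (-1)"
    using assms(6) unfolding obstacle_solution_def by blast+
  have xs0: "xs 0 = x_zero q r" and cp: "\<And>t. t \<in> {0<..<T} \<Longrightarrow> contact_point q r (\<lambda>x. u (t, x)) (xs t)"
    using assms(7) unfolding free_boundary_def by blast+
  have x0: "0 < x_zero q r" using assms(2,4) by (simp add: x_zero_def)
  have u_ge: "phi q r x \<le> u (t, x)" if "t \<in> {0<..<T}" "x \<in> {-1..1}" for t x
  proof -
    have "x = -1 \<or> x \<in> {-1<..<xs t} \<or> x \<in> {xs t..1}" using that(2) by auto
    then consider "x = -1" | "x \<in> {-1<..<xs t}" | "x \<in> {xs t..1}" by blast
    then show ?thesis
      using cp[OF that(1)] ub[OF that(1)] by cases (auto simp: contact_point_def less_imp_le)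
  qed
  have xs_ge: "x_zero q r \<le> xs t" if "t \<in> {0..<T}" for t
    using x_zero_le_contact_point[OF assms(2,4,5) _ visc u_ge cp] xs0 that by (cases "t = 0") auto
  obtain h1 where h1: "h1 > 0" "\<And>h. 0 < h \<Longrightarrow> h < h1 \<Longrightarrow> discrete_boundary T q r h (U h) (X h)"
    using assms(10) by (auto simp: eventually_at_right_field)
  have sol: "discrete_solution q r h (nat \<lfloor>T / h\<rfloor>) (U h) (X h)" if "0 < h" "h < h1" for h
    by (rule scheme_discrete_solution[OF that(1) assms(2,4) assms(9)[OF that(1)] h1(2)[OF that]])
  \<comment> \<open>Convergence at a fixed point along nearby times: the grid time m h lies within h
    of s, so uniform convergence on [0, T0] combines with the continuity of \<open>u\<close> at (t,
    y).\<close>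
  have close: "\<exists>d>0. \<forall>s h m. s \<in> {0..<T} \<longrightarrow> \<bar>s - t\<bar> < d \<longrightarrow> 0 < h \<longrightarrow> h < d \<longrightarrow> m = nat \<lfloor>s / h\<rfloor> \<longrightarrow>
      h < h1 \<and> m \<le> nat \<lfloor>T / h\<rfloor> \<and> \<bar>U h m y - u (t, y)\<bar> < e"
    if t: "t \<in> {0..<T}" and y: "y \<in> {-1..1}" and e: "e > 0" for t y e
  proof -
    define T0 where "T0 = (t + T) / 2"
    have T0: "0 \<le> T0" "T0 < T" using t by (auto simp: T0_def)
    obtain h0 where h0: "h0 > 0" "\<And>h m x. 0 < h \<Longrightarrow> h < h0 \<Longrightarrow> m \<le> nat \<lfloor>T / h\<rfloor> \<Longrightarrow> real m * h \<le> T0 \<Longrightarrow>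
        x \<in> {-1..1} \<Longrightarrow> \<bar>U h m x - u (real m * h, x)\<bar> < e / 2"
      using uniform_convergence[OF assms(2,4) T0 _ assms(6) u_ge sol h1(1), of "e / 2"] e by auto
    obtain \<rho> where \<rho>: "\<rho> > 0" "\<And>p. p \<in> {0..<T} \<times> {-1..1} \<Longrightarrow> dist p (t, y) < \<rho> \<Longrightarrow> dist (u p) (u (t, y)) < e / 2"
      using cu[unfolded continuous_on_iff, rule_format, of "(t, y)" "e / 2"] t y e by auto
    define d where "d = min (min h0 h1) (min (\<rho> / 2) ((T - t) / 2))"
    have d: "d > 0" "d \<le> h0" "d \<le> h1" "d \<le> \<rho> / 2" "d \<le> (T - t) / 2"
    proof -
      have "0 < T - t" using t by simp
      then show "d > 0" "d \<le> h0" "d \<le> h1" "d \<le> \<rho> / 2"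
        using h0(1) h1(1) \<rho>(1) by (auto simp: d_def)
      show "d \<le> (T - t) / 2" unfolding d_def by linarith
    qed
    have "h < h1 \<and> m \<le> nat \<lfloor>T / h\<rfloor> \<and> \<bar>U h m y - u (t, y)\<bar> < e"
      if s: "s \<in> {0..<T}" "\<bar>s - t\<bar> < d" and h: "0 < h" "h < d" and m: "m = nat \<lfloor>s / h\<rfloor>" for s h m
    proof -
      have "s / h \<ge> 0" using s h by simp
      then have "real m \<le> s / h" "s / h < real m + 1" unfolding m by linarith+
      then have mh: "real m * h \<le> s" "s < real m * h + h" using h by (simp_all add: field_simps)
      have mN: "m \<le> nat \<lfloor>T / h\<rfloor>"
        unfolding m using s h by (intro nat_mono floor_mono divide_right_mono) auto
      have "\<bar>U h m y - u (real m * h, y)\<bar> < e / 2"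
      proof (rule h0(2)[OF h(1) _ mN _ y])
        show "real m * h \<le> T0" using mh(1) s(2) d(5) by (simp add: T0_def field_simps)
      qed (use h d in auto)
      moreover have "dist (u (real m * h, y)) (u (t, y)) < e / 2"
      proof (rule \<rho>(2))
        show "(real m * h, y) \<in> {0..<T} \<times> {-1..1}" using mh(1) s(1) h y by auto
        have "dist (real m * h, y) (t, y) = \<bar>real m * h - t\<bar>"
          by (simp add: dist_Pair_Pair dist_real_def)
        also have "\<dots> < \<rho>" using mh s(2) h d(4) by linarith
        finally show "dist (real m * h, y) (t, y) < \<rho>" .
      qed
      ultimately have "\<bar>U h m y - u (t, y)\<bar> < e" unfolding dist_real_def by linarith
      with mN h d show ?thesis by linarith
    qed
    with d(1) show ?thesis by blast
  qed
  have X_ge: "x_zero q r \<le> X h m" if "0 < h" "h < h1" "m \<le> nat \<lfloor>T / h\<rfloor>" for h m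
    using h1(2)[OF that(1,2)] that(3) unfolding discrete_boundary_def by (cases "m = 0") (auto simp: less_imp_le)
  have X_le: "X h m \<le> 1" if "0 < h" "h < h1" "m \<le> nat \<lfloor>T / h\<rfloor>" "m \<noteq> 0" for h m
    using h1(2)[OF that(1,2)] that(3,4) unfolding discrete_boundary_def by auto
  have upper: "\<exists>d>0. \<forall>s h. s \<in> {0..<T} \<longrightarrow> \<bar>s - t\<bar> < d \<longrightarrow> 0 < h \<longrightarrow> h < d \<longrightarrow>
      interpolation h (X h) s < xs t + e"
    if t: "t \<in> {0..<T}" and e: "e > 0" for t e
  proof -
    \<comment> \<open>\<open>y\<close> keeps distance e/2 from a discrete boundary assumed beyond xs
      t + e, so nondegeneracy right of \<open>l\<close> yields the gap \<open>c\<close>, independent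
      of h, while u(t, y) = \<phi>(y). The offset e/4 puts \<open>l\<close> strictly between x_0 and
      \<open>y\<close>. The minimum with 1 keeps \<open>y\<close> in [-1, 1] beforehand; in the
      contradictory case X \<le> 1 makes it inactive.\<close>
    define l y where "l = xs t + e / 4" and "y = min 1 (xs t + e / 2)"
    define c where "c = exp (- \<bar>alpha q r\<bar>) * (q * exp l - r) / 2 * (e / 2)\<^sup>2"
    have "x_zero q r < l" using xs_ge[OF t] e by (simp add: l_def)
    then have "exp (ln (r / q)) < exp l" by (simp add: x_zero_def)
    then have "r < q * exp l" using assms(2,3) by (simp add: field_simps)
    then have c: "c > 0" using e by (simp add: c_def)
    have xs0: "0 \<le> xs t" using xs_ge[OF t] x0 by linarith
    have y: "y \<in> {-1..1}" using xs0 e by (auto simp: y_def)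
    obtain d where d: "d > 0" "\<And>s h m. s \<in> {0..<T} \<Longrightarrow> \<bar>s - t\<bar> < d \<Longrightarrow> 0 < h \<Longrightarrow> h < d \<Longrightarrow> m = nat \<lfloor>s / h\<rfloor> \<Longrightarrow>
        h < h1 \<and> m \<le> nat \<lfloor>T / h\<rfloor> \<and> \<bar>U h m y - u (t, y)\<bar> < c"
      using close[OF t y c] by blast
    have "interpolation h (X h) s < xs t + e"
      if s: "s \<in> {0..<T}" "\<bar>s - t\<bar> < d" and h: "0 < h" "h < d" for s h
    proof (rule ccontr)
      define m where "m = nat \<lfloor>s / h\<rfloor>"
      assume "\<not> interpolation h (X h) s < xs t + e"
      then have X: "xs t + e \<le> X h m" by (simp add: interpolation_def m_def)
      have hm: "h < h1" "m \<le> nat \<lfloor>T / h\<rfloor>" "\<bar>U h m y - u (t, y)\<bar> < c"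
        using d(2)[OF s h m_def] by auto
      have "X h 0 = x_zero q r" using h1(2)[OF h(1) hm(1)] by (simp add: discrete_boundary_def)
      then have m0: "m \<noteq> 0" using X xs_ge[OF t] e by (cases "m = 0") auto
      have y_eq: "y = xs t + e / 2" using X X_le[OF h(1) hm(1,2) m0] e by (simp add: y_def)
      have yX: "l < y" "y < X h m" "xs t \<le> y" using X e by (auto simp: l_def y_eq)
      have "c \<le> exp (- \<bar>alpha q r\<bar>) * (q * exp l - r) / 2 * (X h m - y)\<^sup>2"
        unfolding c_def using X e \<open>r < q * exp l\<close> by (intro mult_left_mono power_mono) (auto simp: y_eq)
      also have "\<dots> \<le> U h m y - phi q r y"
        by (rule discrete_solution_nondegenerate[OF h(1) assms(3) sol[OF h(1) hm(1)] assms(2,4) \<open>x_zero q r < l\<close> m0 hm(2) yX(1,2)])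
      also have "phi q r y = u (t, y)"
        using u0[OF y] cp[of t] t y yX(3) by (cases "t = 0") (auto simp: contact_point_def)
      finally show False using hm(3) by linarith
    qed
    with d(1) show ?thesis by blast
  qed
  have lower: "\<exists>d>0. \<forall>s h. s \<in> {0..<T} \<longrightarrow> \<bar>s - t\<bar> < d \<longrightarrow> 0 < h \<longrightarrow> h < d \<longrightarrow>
      xs t - e < interpolation h (X h) s"
    if t: "t \<in> {0..<T}" and e: "e > 0" for t e
  proof (cases "t = 0 \<or> xs t - e \<le> -1")
    case True
    then have "xs t - e < x_zero q r" using xs0 x0 e by auto
    \<comment> \<open>Every discrete boundary lies at or right of x_0 > xs t - e, so here
      \<open>close\<close> supplies only h < h1 and the index bound; the point 0 and the tolerance 1
      are arbitrary.\<close>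
    obtain d where d: "d > 0" "\<And>s h m. s \<in> {0..<T} \<Longrightarrow> \<bar>s - t\<bar> < d \<Longrightarrow> 0 < h \<Longrightarrow> h < d \<Longrightarrow> m = nat \<lfloor>s / h\<rfloor> \<Longrightarrow>
        h < h1 \<and> m \<le> nat \<lfloor>T / h\<rfloor> \<and> \<bar>U h m 0 - u (t, 0)\<bar> < 1"
      using close[OF t, of 0 1] by auto
    have "xs t - e < interpolation h (X h) s"
      if s: "s \<in> {0..<T}" "\<bar>s - t\<bar> < d" and h: "0 < h" "h < d" for s h
      using X_ge[OF h(1), of "nat \<lfloor>s / h\<rfloor>"] d(2)[OF s h refl] \<open>xs t - e < x_zero q r\<close>
      by (simp add: interpolation_def)
    with d(1) show ?thesis by blast
  next
    case False
    then have t': "t \<in> {0<..<T}" using t by auto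
    define y where "y = xs t - e / 2"
    have y: "y \<in> {-1<..<xs t}" "y \<in> {-1..1}"
      using False e cp[OF t'] by (auto simp: y_def contact_point_def)
    have g: "0 < u (t, y) - phi q r y" using cp[OF t'] y(1) by (auto simp: contact_point_def)
    obtain d where d: "d > 0" "\<And>s h m. s \<in> {0..<T} \<Longrightarrow> \<bar>s - t\<bar> < d \<Longrightarrow> 0 < h \<Longrightarrow> h < d \<Longrightarrow> m = nat \<lfloor>s / h\<rfloor> \<Longrightarrow>
        h < h1 \<and> m \<le> nat \<lfloor>T / h\<rfloor> \<and> \<bar>U h m y - u (t, y)\<bar> < u (t, y) - phi q r y"
      using close[OF t y(2) g] by blast
    have "xs t - e < interpolation h (X h) s"
      if s: "s \<in> {0..<T}" "\<bar>s - t\<bar> < d" and h: "0 < h" "h < d" for s h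
    proof -
      define m where "m = nat \<lfloor>s / h\<rfloor>"
      have hm: "h < h1" "m \<le> nat \<lfloor>T / h\<rfloor>" "\<bar>U h m y - u (t, y)\<bar> < u (t, y) - phi q r y"
        using d(2)[OF s h m_def] by auto
      note sol' = sol[OF h(1) hm(1)]
      have less: "phi q r y < U h m y" using hm(3) by linarith
      then have "m \<noteq> 0" using discrete_solution_0[OF h(1) assms(3) sol' y(2)] by (cases "m = 0") auto
      then have "y \<in> {-1<..<X h m}"
        by (rule obstacle_step_less[OF discrete_solution_step[OF h(1) assms(3) sol' _ hm(2)] y(2) less])
      then show ?thesis using e by (simp add: interpolation_def m_def y_def)
    qed
    with d(1) show ?thesis by blast
  qed
  have loc: "\<exists>d>0. \<forall>s h. s \<in> {0..<T} \<longrightarrow> \<bar>s - t\<bar> < d \<longrightarrow> 0 < h \<longrightarrow> h < d \<longrightarrow> \<bar>interpolation h (X h) s - xs t\<bar> < e"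
    if t: "t \<in> {0..<T}" and e: "e > 0" for t e
  proof -
    obtain d1 where d1: "d1 > 0" "\<And>s h. s \<in> {0..<T} \<Longrightarrow> \<bar>s - t\<bar> < d1 \<Longrightarrow> 0 < h \<Longrightarrow> h < d1 \<Longrightarrow>
        interpolation h (X h) s < xs t + e" using upper[OF t e] by blast
    obtain d2 where d2: "d2 > 0" "\<And>s h. s \<in> {0..<T} \<Longrightarrow> \<bar>s - t\<bar> < d2 \<Longrightarrow> 0 < h \<Longrightarrow> h < d2 \<Longrightarrow>
        xs t - e < interpolation h (X h) s" using lower[OF t e] by blast
    have "\<bar>interpolation h (X h) s - xs t\<bar> < e"
      if "s \<in> {0..<T}" "\<bar>s - t\<bar> < min d1 d2" "0 < h" "h < min d1 d2" for s h
      using d1(2)[of s h] d2(2)[of s h] that by auto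
    then show ?thesis using d1(1) d2(1) by (intro exI[of _ "min d1 d2"]) auto
  qed
  show ?thesis
    by (intro ennreal_SUP_tendsto_0 uniform_of_local_convergence[OF loc]) (use assms(11) in auto)
qed

end
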